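(* Let $\mathscr G$ be an ample groupoid. Suppose that $\mathcal O$ is a $\mathscr G$-sheaf of fields and that $\Gamma_c(\mathscr G^{(0)},\mathcal O)$ is a maximal commutative subring of $\Gamma_c(\mathscr G,\mathcal O)$. Then $\Gamma_c(\mathscr G,\mathcal O)$ is semiprimitive.
   Context: "Compact" includes Hausdorff. A groupoid $\mathscr G$ (identified with its set of arrows) has unit space $\mathscr G^{(0)}$, $\boldsymbol d(\gamma)=\gamma^{-1}\gamma$, $\boldsymbol r(\gamma)=\gamma\gamma^{-1}$. It is ample if it is a topological groupoid such that $\mathscr G^{(0)}$ is locally compact Hausdorff with a basis of compact open sets and $\boldsymbol r$ is a local homeomorphism ($\mathscr G$ itself need not be Hausdorff). A bisection is a subset on which $\boldsymbol d$ and $\boldsymbol r$ are injective. A $\mathscr G$-sheaf $(E,p,\alpha)$ is a space $E$, a local homeomorphism $p:E\to\mathscr G^{(0)}$ and a continuous map $\alpha:\mathscr G\times_{\boldsymbol d,p}E\to E$, $(\gamma,e)\mapsto\alpha_\gamma(e)$, with $\alpha_{p(e)}(e)=e$, $p(\alpha_\gamma(e))=\boldsymbol r(\gamma)$, and $\alpha_\beta(\alpha_\gamma(e))=\alpha_{\beta\gamma}(e)$ whenever defined. The stalk at $x$ is $p^{-1}(x)$. A $\mathscr G$-sheaf of rings $\mathcal O=(E,p,\alpha)$ is a $\mathscr G$-sheaf with a unital ring structure on each stalk $\mathcal O_x$ such that fiberwise addition and multiplication $E\times_{p,p}E\to E$ and the unit section $x\mapsto 1_x$ are continuous, and each $\alpha_\gamma:\mathcal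 O_{\boldsymbol d(\gamma)}\to\mathcal O_{\boldsymbol r(\gamma)}$ is a (unital) ring homomorphism. It is a sheaf of fields if every stalk is a field. $\Gamma_c(\mathscr G,\mathcal O)$ is the additive group generated by all maps $f:\mathscr G\to E$ with $p\circ f=\boldsymbol r$ for which there is a compact open bisection $U$ with $f|_U$ continuous and $f=0$ off $U$. It is a ring under pointwise addition and convolution $(f*g)(\gamma)=\sum_{\beta\rho=\gamma}f(\beta)\alpha_\beta(g(\rho))$. $\Gamma_c(\mathscr G^{(0)},\mathcal O)$ is the ring of compactly supported continuous sections $\mathscr G^{(0)}\to E$ of $p$ with pointwise operations, viewed as a subring of $\Gamma_c(\mathscr G,\mathcal O)$ by extending by zero. A ring is semiprimitive if its Jacobson radical is zero; equivalently, if it has a faithful semisimple module. *)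

theory Defs
  imports "HOL-Analysis.Analysis" "HOL-Algebra.Ring" "HOL-Algebra.Generated_Groups"
begin

section \<open>Topological preliminaries\<close>

definition compact_Hausdorff_in :: "'a topology \<Rightarrow> 'a set \<Rightarrow> bool" where
  "compact_Hausdorff_in X K \<longleftrightarrow> compactin X K \<and> Hausdorff_space (subtopology X K)"

definition local_homeomorphism :: "'a topology \<Rightarrow> 'b topology \<Rightarrow> ('a \<Rightarrow> 'b) \<Rightarrow> bool" where
  "local_homeomorphism X Y f \<longleftrightarrow>
     (\<forall>x\<in>topspace X. \<exists>U. openin X U \<and> x \<in> U \<and> openin Y (f ` U) \<and>
        homeomorphic_map (subtopology X U) (subtopology Y (f ` U)) f)"


section \<open>Ample groupoids\<close>

text \<open>
  A groupoid is identified with its set of arrows, here the underlying set of the topology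
  \<open>gtop\<close>. The functions \<open>gmul\<close> and \<open>ginv\<close> are total on the type; \<open>gmul\<close> is only meaningful
  on composable pairs, i.e. those with \<open>gdom \<beta> = gran \<gamma>\<close>.
\<close>

record 'g groupoid =
  gtop :: "'g topology"
  gmul :: "'g \<Rightarrow> 'g \<Rightarrow> 'g"
  ginv :: "'g \<Rightarrow> 'g"

definition arrows :: "'g groupoid \<Rightarrow> 'g set" where
  "arrows \<G> = topspace (gtop \<G>)"

definition gdom :: "'g groupoid \<Rightarrow> 'g \<Rightarrow> 'g" where
  "gdom \<G> \<gamma> = gmul \<G> (ginv \<G> \<gamma>) \<gamma>"

definition gran :: "'g groupoid \<Rightarrow> 'g \<Rightarrow> 'g" where
  "gran \<G> \<gamma> = gmul \<G> \<gamma> (ginv \<G> \<gamma>)"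

definition gunits :: "'g groupoid \<Rightarrow> 'g set" where
  "gunits \<G> = gdom \<G> ` arrows \<G>"

definition unit_space :: "'g groupoid \<Rightarrow> 'g topology" where
  "unit_space \<G> = subtopology (gtop \<G>) (gunits \<G>)"

definition composable :: "'g groupoid \<Rightarrow> ('g \<times> 'g) set" where
  "composable \<G> = {(\<beta>, \<gamma>). \<beta> \<in> arrows \<G> \<and> \<gamma> \<in> arrows \<G> \<and> gdom \<G> \<beta> = gran \<G> \<gamma>}"

locale groupoid =
  fixes \<G> :: "'g groupoid"
  assumes inv_closed: "\<gamma> \<in> arrows \<G> \<Longrightarrow> ginv \<G> \<gamma> \<in> arrows \<G>"
    and dom_inv: "\<gamma> \<in> arrows \<G> \<Longrightarrow> gdom \<G> (ginv \<G> \<gamma>) = gran \<G> \<gamma>"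
    and ran_inv: "\<gamma> \<in> arrows \<G> \<Longrightarrow> gran \<G> (ginv \<G> \<gamma>) = gdom \<G> \<gamma>"
    and mul_closed: "(\<beta>, \<gamma>) \<in> composable \<G> \<Longrightarrow> gmul \<G> \<beta> \<gamma> \<in> arrows \<G>"
    and dom_mul: "(\<beta>, \<gamma>) \<in> composable \<G> \<Longrightarrow> gdom \<G> (gmul \<G> \<beta> \<gamma>) = gdom \<G> \<gamma>"
    and ran_mul: "(\<beta>, \<gamma>) \<in> composable \<G> \<Longrightarrow> gran \<G> (gmul \<G> \<beta> \<gamma>) = gran \<G> \<beta>"
    and mul_assoc: "(\<beta>, \<gamma>) \<in> composable \<G> \<Longrightarrow> (\<gamma>, \<delta>) \<in> composable \<G> \<Longrightarrow>
        gmul \<G> (gmul \<G> \<beta> \<gamma>) \<delta> = gmul \<G> \<beta> (gmul \<G> \<gamma> \<delta>)"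
    and mul_dom: "\<gamma> \<in> arrows \<G> \<Longrightarrow> gmul \<G> \<gamma> (gdom \<G> \<gamma>) = \<gamma>"
    and ran_mul_left: "\<gamma> \<in> arrows \<G> \<Longrightarrow> gmul \<G> (gran \<G> \<gamma>) \<gamma> = \<gamma>"

locale topological_groupoid = groupoid +
  assumes continuous_mul:
      "continuous_map (subtopology (prod_topology (gtop \<G>) (gtop \<G>)) (composable \<G>)) (gtop \<G>)
         (\<lambda>(\<beta>, \<gamma>). gmul \<G> \<beta> \<gamma>)"
    and continuous_inv: "continuous_map (gtop \<G>) (gtop \<G>) (ginv \<G>)"

locale ample_groupoid = topological_groupoid +
  assumes Hausdorff_units: "Hausdorff_space (unit_space \<G>)"
    and locally_compact_units: "locally_compact_space (unit_space \<G>)"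
    and compact_open_basis: "openin (unit_space \<G>) =
        arbitrary union_of (\<lambda>U. openin (unit_space \<G>) U \<and> compact_Hausdorff_in (unit_space \<G>) U)"
    and local_homeomorphism_ran: "local_homeomorphism (gtop \<G>) (unit_space \<G>) (gran \<G>)"

definition bisection :: "'g groupoid \<Rightarrow> 'g set \<Rightarrow> bool" where
  "bisection \<G> U \<longleftrightarrow> U \<subseteq> arrows \<G> \<and> inj_on (gdom \<G>) U \<and> inj_on (gran \<G>) U"


section \<open>Sheaves of rings over a groupoid\<close>

text \<open>
  The field \<open>stalk\<close> packages the ring structures on the fibres of \<open>proj\<close>; its carrier is tied
  to the fibre in the locale below.
\<close>

record ('g, 'e) ring_sheaf =
  total :: "'e topology"
  proj :: "'e \<Rightarrow> 'g"
  act :: "'g \<Rightarrow> 'e \<Rightarrow> 'e"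
  stalk :: "'g \<Rightarrow> 'e ring"

locale groupoid_sheaf = topological_groupoid \<G>
  for \<G> :: "'g groupoid" and \<O> :: "('g, 'e) ring_sheaf" +
  assumes local_homeomorphism_proj: "local_homeomorphism (total \<O>) (unit_space \<G>) (proj \<O>)"
    and proj_in_units: "e \<in> topspace (total \<O>) \<Longrightarrow> proj \<O> e \<in> gunits \<G>"
    and continuous_act:
      "continuous_map
         (subtopology (prod_topology (gtop \<G>) (total \<O>)) {(\<gamma>, e). gdom \<G> \<gamma> = proj \<O> e})
         (total \<O>) (\<lambda>(\<gamma>, e). act \<O> \<gamma> e)"
    and act_unit: "e \<in> topspace (total \<O>) \<Longrightarrow> act \<O> (proj \<O> e) e = e"
    and proj_act: "\<gamma> \<in> arrows \<G> \<Longrightarrow> e \<in> topspace (total \<O>) \<Longrightarrow> gdom \<G> \<gamma> = proj \<O> e \<Longrightarrow>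
        proj \<O> (act \<O> \<gamma> e) = gran \<G> \<gamma>"
    and act_act: "(\<beta>, \<gamma>) \<in> composable \<G> \<Longrightarrow> e \<in> topspace (total \<O>) \<Longrightarrow>
        gdom \<G> \<gamma> = proj \<O> e \<Longrightarrow> act \<O> \<beta> (act \<O> \<gamma> e) = act \<O> (gmul \<G> \<beta> \<gamma>) e"

definition fibre_product :: "('g, 'e) ring_sheaf \<Rightarrow> ('e \<times> 'e) topology" where
  "fibre_product \<O> =
     subtopology (prod_topology (total \<O>) (total \<O>)) {(e, e'). proj \<O> e = proj \<O> e'}"

locale groupoid_sheaf_of_rings = groupoid_sheaf +
  assumes carrier_stalk: "x \<in> gunits \<G> \<Longrightarrow>
        carrier (stalk \<O> x) = {e \<in> topspace (total \<O>). proj \<O> e = x}"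
    and ring_stalk: "x \<in> gunits \<G> \<Longrightarrow> ring (stalk \<O> x)"
    and continuous_add: "continuous_map (fibre_product \<O>) (total \<O>)
        (\<lambda>(e, e'). e \<oplus>\<^bsub>stalk \<O> (proj \<O> e)\<^esub> e')"
    and continuous_mult: "continuous_map (fibre_product \<O>) (total \<O>)
        (\<lambda>(e, e'). e \<otimes>\<^bsub>stalk \<O> (proj \<O> e)\<^esub> e')"
    and continuous_one: "continuous_map (unit_space \<G>) (total \<O>) (\<lambda>x. \<one>\<^bsub>stalk \<O> x\<^esub>)"
    and act_ring_hom: "\<gamma> \<in> arrows \<G> \<Longrightarrow>
        act \<O> \<gamma> \<in> ring_hom (stalk \<O> (gdom \<G> \<gamma>)) (stalk \<O> (gran \<G> \<gamma>))"

locale groupoid_sheaf_of_fields = groupoid_sheaf_of_rings +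
  assumes field_stalk: "x \<in> gunits \<G> \<Longrightarrow> field (stalk \<O> x)"


section \<open>The convolution ring\<close>

text \<open>
  Functions on the set of arrows are made extensional, so that equality of functions is equality
  on arrows.
\<close>

definition section_group :: "'g groupoid \<Rightarrow> ('g, 'e) ring_sheaf \<Rightarrow> ('g \<Rightarrow> 'e) monoid" where
  "section_group \<G> \<O> =
     \<lparr> carrier = {f \<in> arrows \<G> \<rightarrow>\<^sub>E topspace (total \<O>). \<forall>\<gamma>\<in>arrows \<G>. proj \<O> (f \<gamma>) = gran \<G> \<gamma>},
       mult = (\<lambda>f g. \<lambda>\<gamma>\<in>arrows \<G>. f \<gamma> \<oplus>\<^bsub>stalk \<O> (gran \<G> \<gamma>)\<^esub> g \<gamma>),
       one = (\<lambda>\<gamma>\<in>arrows \<G>. \<zero>\<^bsub>stalk \<O> (gran \<G> \<gamma>)\<^esub>) \<rparr>"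

definition bisection_sections :: "'g groupoid \<Rightarrow> ('g, 'e) ring_sheaf \<Rightarrow> ('g \<Rightarrow> 'e) set" where
  "bisection_sections \<G> \<O> =
     {f \<in> carrier (section_group \<G> \<O>).
        \<exists>U. openin (gtop \<G>) U \<and> compact_Hausdorff_in (gtop \<G>) U \<and> bisection \<G> U \<and>
            continuous_map (subtopology (gtop \<G>) U) (total \<O>) f \<and>
            (\<forall>\<gamma>\<in>arrows \<G> - U. f \<gamma> = \<zero>\<^bsub>stalk \<O> (gran \<G> \<gamma>)\<^esub>)}"

text \<open>
  The convolution sum runs over the nonzero summands only, because \<^const>\<open>finsum\<close> takes a default
  value on infinite index sets; for elements of the convolution ring there are finitely many.
\<close>

definition convolution ::
  "'g groupoid \<Rightarrow> ('g, 'e) ring_sheaf \<Rightarrow> ('g \<Rightarrow> 'e) \<Rightarrow> ('g \<Rightarrow> 'e) \<Rightarrow> 'g \<Rightarrow> 'e" where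
  "convolution \<G> \<O> f g = (\<lambda>\<gamma>\<in>arrows \<G>.
     let R = stalk \<O> (gran \<G> \<gamma>); t = (\<lambda>(\<beta>, \<rho>). f \<beta> \<otimes>\<^bsub>R\<^esub> act \<O> \<beta> (g \<rho>))
     in finsum R t {(\<beta>, \<rho>) \<in> composable \<G>. gmul \<G> \<beta> \<rho> = \<gamma> \<and> t (\<beta>, \<rho>) \<noteq> \<zero>\<^bsub>R\<^esub>})"

text \<open>
  The convolution ring need not be unital. The \<open>one\<close> component demanded by the record is the
  extension by zero of the unit section; it lies in the carrier only in the unital case, and no
  notion below refers to it.
\<close>

definition Gamma_c :: "'g groupoid \<Rightarrow> ('g, 'e) ring_sheaf \<Rightarrow> ('g \<Rightarrow> 'e) ring" where
  "Gamma_c \<G> \<O> =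
     \<lparr> carrier = generate (section_group \<G> \<O>) (bisection_sections \<G> \<O>),
       mult = convolution \<G> \<O>,
       one = (\<lambda>\<gamma>\<in>arrows \<G>. if \<gamma> \<in> gunits \<G> then \<one>\<^bsub>stalk \<O> \<gamma>\<^esub> else \<zero>\<^bsub>stalk \<O> (gran \<G> \<gamma>)\<^esub>),
       zero = one (section_group \<G> \<O>),
       add = mult (section_group \<G> \<O>) \<rparr>"

definition unit_sections :: "'g groupoid \<Rightarrow> ('g, 'e) ring_sheaf \<Rightarrow> ('g \<Rightarrow> 'e) set" where
  "unit_sections \<G> \<O> =
     {s. continuous_map (unit_space \<G>) (total \<O>) s \<and> (\<forall>x\<in>gunits \<G>. proj \<O> (s x) = x) \<and>
         compact_Hausdorff_in (unit_space \<G>)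
           (Abstract_Topology.closure_of (unit_space \<G>) {x \<in> gunits \<G>. s x \<noteq> \<zero>\<^bsub>stalk \<O> x\<^esub>})}"

definition extend_by_zero ::
  "'g groupoid \<Rightarrow> ('g, 'e) ring_sheaf \<Rightarrow> ('g \<Rightarrow> 'e) \<Rightarrow> 'g \<Rightarrow> 'e" where
  "extend_by_zero \<G> \<O> s =
     (\<lambda>\<gamma>\<in>arrows \<G>. if \<gamma> \<in> gunits \<G> then s \<gamma> else \<zero>\<^bsub>stalk \<O> (gran \<G> \<gamma>)\<^esub>)"

definition Gamma_c_units :: "'g groupoid \<Rightarrow> ('g, 'e) ring_sheaf \<Rightarrow> ('g \<Rightarrow> 'e) set" where
  "Gamma_c_units \<G> \<O> = extend_by_zero \<G> \<O> ` unit_sections \<G> \<O>"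


section \<open>Rings that need not be unital\<close>

text \<open>
  The library's \<open>subring\<close> requires the identity, which is not available here.
\<close>

definition nonunital_subring :: "'a set \<Rightarrow> ('a, 'b) ring_scheme \<Rightarrow> bool" where
  "nonunital_subring A R \<longleftrightarrow>
     subgroup A (add_monoid R) \<and> (\<forall>x\<in>A. \<forall>y\<in>A. x \<otimes>\<^bsub>R\<^esub> y \<in> A)"

definition commutative_subring :: "'a set \<Rightarrow> ('a, 'b) ring_scheme \<Rightarrow> bool" where
  "commutative_subring A R \<longleftrightarrow>
     nonunital_subring A R \<and> (\<forall>x\<in>A. \<forall>y\<in>A. x \<otimes>\<^bsub>R\<^esub> y = y \<otimes>\<^bsub>R\<^esub> x)"

definition maximal_commutative_subring :: "'a set \<Rightarrow> ('a, 'b) ring_scheme \<Rightarrow> bool" where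
  "maximal_commutative_subring A R \<longleftrightarrow>
     commutative_subring A R \<and> (\<forall>B. commutative_subring B R \<and> A \<subseteq> B \<longrightarrow> B = A)"

definition left_ideal :: "'a set \<Rightarrow> ('a, 'b) ring_scheme \<Rightarrow> bool" where
  "left_ideal L R \<longleftrightarrow>
     subgroup L (add_monoid R) \<and> (\<forall>r\<in>carrier R. \<forall>x\<in>L. r \<otimes>\<^bsub>R\<^esub> x \<in> L)"

definition maximal_left_ideal :: "'a set \<Rightarrow> ('a, 'b) ring_scheme \<Rightarrow> bool" where
  "maximal_left_ideal L R \<longleftrightarrow>
     left_ideal L R \<and> L \<noteq> carrier R \<and>
     (\<forall>L'. left_ideal L' R \<and> L \<subseteq> L' \<longrightarrow> L' = L \<or> L' = carrier R)"

definition modular_left_ideal :: "'a set \<Rightarrow> ('a, 'b) ring_scheme \<Rightarrow> bool" where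
  "modular_left_ideal L R \<longleftrightarrow>
     left_ideal L R \<and> (\<exists>u\<in>carrier R. \<forall>x\<in>carrier R. x \<ominus>\<^bsub>R\<^esub> x \<otimes>\<^bsub>R\<^esub> u \<in> L)"

text \<open>
  The simple left modules of a possibly nonunital ring are, up to isomorphism, the quotients by
  its modular maximal left ideals. In a unital ring every left ideal is modular (take the identity
  for \<open>u\<close>), which gives back the intersection of all maximal left ideals. If there are no such
  ideals, the radical is the whole ring.
\<close>

definition jacobson_radical :: "('a, 'b) ring_scheme \<Rightarrow> 'a set" where
  "jacobson_radical R =
     {x \<in> carrier R. \<forall>L. maximal_left_ideal L R \<and> modular_left_ideal L R \<longrightarrow> x \<in> L}"

definition semiprimitive :: "('a, 'b) ring_scheme \<Rightarrow> bool" where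
  "semiprimitive R \<longleftrightarrow> jacobson_radical R = {\<zero>\<^bsub>R\<^esub>}"

end

theory Submission
  imports Defs
begin

text \<open>
  The convolution ring acts on sections \<open>v\<close> over the unit space by
  \<open>(f v)(z) = \<Sum> f(\<gamma>) \<alpha>\<^sub>\<gamma>(v(d \<gamma>))\<close>, the sum being over the arrows \<open>\<gamma>\<close> with range \<open>z\<close>. The module
  generated by a nonzero section supported at one point is simple, because the stalks are fields and
  bisections move points transitively within an orbit; so the annihilators of such sections are
  modular maximal left ideals and the Jacobson radical lies in the ideal \<open>I\<close> of elements killing
  every section. The diagonal acts faithfully, so \<open>I\<close> meets it only in zero. On the other hand,
  if the diagonal is maximal commutative then every nonzero ideal meets it: take a nonzero element
  of the ideal that is a sum of the least possible number of sections on bisections, and translate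
  it so that one summand lives on the unit space. Its commutators with the diagonal have fewer
  summands and hence vanish, so the element lies in the diagonal.
\<close>

section \<open>Local homeomorphisms\<close>

lemma continuous_map_locally:
  assumes "\<And>x. x \<in> topspace X \<Longrightarrow>
    \<exists>N g. openin X N \<and> x \<in> N \<and> continuous_map (subtopology X N) Y g \<and> (\<forall>y\<in>N. f y = g y)"
  shows "continuous_map X Y f"
proof -
  obtain N g where N: "\<And>x. x \<in> topspace X \<Longrightarrow> openin X (N x) \<and> x \<in> N x \<and>
      continuous_map (subtopology X (N x)) Y (g x) \<and> (\<forall>y\<in>N x. f y = g x y)"
    using assms by metis
  show ?thesis
  proof (rule pasting_lemma[where I = "topspace X" and T = N and f = g])
    fix i j x assume "i \<in> topspace X" "j \<in> topspace X" "x \<in> topspace X \<inter> N i \<inter> N j"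
    then have "f x = g i x" "f x = g j x" using N by blast+
    then show "g i x = g j x" by simp
  qed (use N in blast)+
qed

lemma local_homeomorphism_imp_continuous_map:
  assumes "local_homeomorphism X Y f"
  shows "continuous_map X Y f"
proof (rule continuous_map_locally)
  fix x assume "x \<in> topspace X"
  then obtain U where "openin X U" "x \<in> U"
      "homeomorphic_map (subtopology X U) (subtopology Y (f ` U)) f"
    using assms unfolding local_homeomorphism_def by blast
  moreover from this have "continuous_map (subtopology X U) Y f"
    using homeomorphic_imp_continuous_map by (fastforce simp: continuous_map_in_subtopology)
  ultimately show "\<exists>N g. openin X N \<and> x \<in> N \<and> continuous_map (subtopology X N) Y g \<and> (\<forall>y\<in>N. f y = g y)"
    by (intro exI[of _ U] exI[of _ f]) simp
qed

lemma local_homeomorphism_imp_open_map: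
  assumes "local_homeomorphism X Y f"
  shows "open_map X Y f"
  unfolding open_map_def
proof (intro allI impI)
  fix V assume V: "openin X V"
  show "openin Y (f ` V)"
  proof (subst openin_subopen, intro ballI)
    fix y assume "y \<in> f ` V"
    then obtain x where x: "x \<in> V" "y = f x" by blast
    then have "x \<in> topspace X" using V openin_subset by blast
    then obtain U where U: "openin X U" "x \<in> U" "openin Y (f ` U)"
        "homeomorphic_map (subtopology X U) (subtopology Y (f ` U)) f"
      using assms unfolding local_homeomorphism_def by blast
    have "open_map (subtopology X U) (subtopology Y (f ` U)) f"
      using U(4) homeomorphic_imp_open_map by blast
    moreover have "openin (subtopology X U) (V \<inter> U)"
      using V by (auto simp: openin_subtopology)
    ultimately have "openin (subtopology Y (f ` U)) (f ` (V \<inter> U))"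
      unfolding open_map_def by blast
    then have "openin Y (f ` (V \<inter> U))"
      using U(3) openin_trans_full by blast
    then show "\<exists>T. openin Y T \<and> y \<in> T \<and> T \<subseteq> f ` V"
      using x U(2) by blast
  qed
qed

lemma local_homeomorphism_local_inverse:
  assumes lh: "local_homeomorphism X Y f" and U: "openin X U" and inj: "inj_on f U"
  shows "continuous_map (subtopology Y (f ` U)) X (the_inv_into U f)"
proof -
  have sub: "U \<subseteq> topspace X" using U openin_subset by blast
  have cont: "continuous_map (subtopology X U) (subtopology Y (f ` U)) f"
    using local_homeomorphism_imp_continuous_map[OF lh]
    by (auto simp: continuous_map_in_subtopology continuous_map_from_subtopology)
  have fU: "f ` U \<subseteq> topspace Y"
    using continuous_map_image_subset_topspace[OF local_homeomorphism_imp_continuous_map[OF lh]] sub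
    by blast
  have "open_map (subtopology X U) (subtopology Y (f ` U)) f"
    unfolding open_map_def
  proof (intro allI impI)
    fix V assume "openin (subtopology X U) V"
    then have "openin X V" "V \<subseteq> U"
      using U openin_trans_full openin_imp_subset by blast+
    then show "openin (subtopology Y (f ` U)) (f ` V)"
      using local_homeomorphism_imp_open_map[OF lh]
      unfolding open_map_def openin_subtopology by (intro exI[of _ "f ` V"]) blast
  qed
  moreover have tX: "topspace (subtopology X U) = U" using sub by auto
  moreover have "topspace (subtopology Y (f ` U)) = f ` U" using fU by auto
  ultimately have "homeomorphic_map (subtopology X U) (subtopology Y (f ` U)) f"
    using cont inj by (intro bijective_open_imp_homeomorphic_map) auto
  then obtain g where g: "homeomorphic_maps (subtopology X U) (subtopology Y (f ` U)) f g"
    using homeomorphic_map_maps by blast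
  have "continuous_map (subtopology Y (f ` U)) X g"
    using g unfolding homeomorphic_maps_def by (auto simp: continuous_map_in_subtopology)
  then show ?thesis
    by (rule continuous_map_eq)
      (use g sub inj in \<open>auto simp: homeomorphic_maps_def the_inv_into_f_f\<close>)
qed

lemma local_homeomorphism_injective_neighbourhood:
  assumes "local_homeomorphism X Y f" "x \<in> topspace X"
  obtains U where "openin X U" "x \<in> U" "inj_on f U"
proof -
  obtain U where U: "openin X U" "x \<in> U" "homeomorphic_map (subtopology X U) (subtopology Y (f ` U)) f"
    using assms unfolding local_homeomorphism_def by blast
  then have "inj_on f (topspace (subtopology X U))"
    using homeomorphic_imp_injective_map by blast
  moreover have "topspace (subtopology X U) = U" using U(1) openin_subset by fastforce
  ultimately show thesis using that U by metis
qed

lemma local_homeomorphism_lifts_agree: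
  assumes lh: "local_homeomorphism E Y p"
    and s: "continuous_map X E s" and t: "continuous_map X E t"
    and eq: "\<And>y. y \<in> topspace X \<Longrightarrow> p (s y) = p (t y)"
    and x: "x \<in> topspace X" "s x = t x"
  obtains N where "openin X N" "x \<in> N" "\<And>y. y \<in> N \<Longrightarrow> s y = t y"
proof -
  have "s x \<in> topspace E" using s x by (meson continuous_map_image_subset_topspace image_subset_iff)
  then obtain U where U: "openin E U" "s x \<in> U" "inj_on p U"
    using local_homeomorphism_injective_neighbourhood[OF lh] by blast
  let ?N = "{y \<in> topspace X. s y \<in> U} \<inter> {y \<in> topspace X. t y \<in> U}"
  have "openin X ?N"
    using s t U by (intro openin_Int openin_continuous_map_preimage) auto
  moreover have "s y = t y" if "y \<in> ?N" for y
  proof (rule inj_onD[OF U(3)])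
    show "p (s y) = p (t y)" using eq that by blast
  qed (use that in auto)
  moreover have "x \<in> ?N" using x U(2) by simp
  ultimately show thesis using that[of ?N] by blast
qed

section \<open>Arrows and bisections\<close>

context groupoid
begin

abbreviation d where "d \<equiv> gdom \<G>"
abbreviation r where "r \<equiv> gran \<G>"
abbreviation arr where "arr \<equiv> arrows \<G>"
abbreviation units where "units \<equiv> gunits \<G>"
abbreviation gm (infixl "\<cdot>" 75) where "\<beta> \<cdot> \<gamma> \<equiv> gmul \<G> \<beta> \<gamma>"
abbreviation gi where "gi \<equiv> ginv \<G>"

lemma composable_iff: "(\<beta>, \<gamma>) \<in> composable \<G> \<longleftrightarrow> \<beta> \<in> arr \<and> \<gamma> \<in> arr \<and> d \<beta> = r \<gamma>"
  by (simp add: composable_def)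

lemma inv_mul: "gi \<gamma> \<cdot> \<gamma> = d \<gamma>" and mul_inv: "\<gamma> \<cdot> gi \<gamma> = r \<gamma>"
  by (simp_all add: gdom_def gran_def)

lemma dom_in_units [simp]: "\<gamma> \<in> arr \<Longrightarrow> d \<gamma> \<in> units"
  by (simp add: gunits_def)

lemma ran_in_units [simp]: "\<gamma> \<in> arr \<Longrightarrow> r \<gamma> \<in> units"
  by (metis dom_in_units dom_inv inv_closed)

lemma mul_in_arrows: "\<beta> \<in> arr \<Longrightarrow> \<gamma> \<in> arr \<Longrightarrow> d \<beta> = r \<gamma> \<Longrightarrow> \<beta> \<cdot> \<gamma> \<in> arr"
  by (simp add: mul_closed composable_iff)

lemma dom_mul_eq: "\<beta> \<in> arr \<Longrightarrow> \<gamma> \<in> arr \<Longrightarrow> d \<beta> = r \<gamma> \<Longrightarrow> d (\<beta> \<cdot> \<gamma>) = d \<gamma>"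
  and ran_mul_eq: "\<beta> \<in> arr \<Longrightarrow> \<gamma> \<in> arr \<Longrightarrow> d \<beta> = r \<gamma> \<Longrightarrow> r (\<beta> \<cdot> \<gamma>) = r \<beta>"
  by (simp_all add: dom_mul ran_mul composable_iff)

lemma mul_assoc_eq:
  "\<beta> \<in> arr \<Longrightarrow> \<gamma> \<in> arr \<Longrightarrow> \<delta> \<in> arr \<Longrightarrow> d \<beta> = r \<gamma> \<Longrightarrow> d \<gamma> = r \<delta> \<Longrightarrow>
    \<beta> \<cdot> \<gamma> \<cdot> \<delta> = \<beta> \<cdot> (\<gamma> \<cdot> \<delta>)"
  by (simp add: mul_assoc composable_iff)

lemma unit_in_arrows [simp]: "x \<in> units \<Longrightarrow> x \<in> arr"
  unfolding gunits_def using mul_in_arrows[OF inv_closed] dom_inv inv_mul by (metis imageE)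

lemma dom_unit [simp]: "x \<in> units \<Longrightarrow> d x = x" and ran_unit [simp]: "x \<in> units \<Longrightarrow> r x = x"
proof -
  assume "x \<in> units"
  then obtain \<gamma> where g: "\<gamma> \<in> arr" "x = d \<gamma>" by (auto simp: gunits_def)
  have "d (gi \<gamma> \<cdot> \<gamma>) = d \<gamma>" "r (gi \<gamma> \<cdot> \<gamma>) = r (gi \<gamma>)"
    using g inv_closed dom_inv by (auto intro!: dom_mul_eq ran_mul_eq)
  then show "d x = x" "r x = x"
    using g ran_inv by (auto simp: inv_mul)
qed

lemma ran_mul_self [simp]: "\<gamma> \<in> arr \<Longrightarrow> r \<gamma> \<cdot> \<gamma> = \<gamma>"
  and mul_dom_self [simp]: "\<gamma> \<in> arr \<Longrightarrow> \<gamma> \<cdot> d \<gamma> = \<gamma>"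
  by (simp_all add: ran_mul_left mul_dom)

lemma inv_mul_cancel:
  assumes "\<beta> \<in> arr" "\<rho> \<in> arr" "d \<beta> = r \<rho>"
  shows "gi \<beta> \<cdot> (\<beta> \<cdot> \<rho>) = \<rho>"
  using assms mul_assoc_eq[of "gi \<beta>" \<beta> \<rho>] inv_closed dom_inv by (simp add: inv_mul)

lemma mul_inv_cancel:
  assumes "\<beta> \<in> arr" "\<gamma> \<in> arr" "r \<beta> = r \<gamma>"
  shows "\<beta> \<cdot> (gi \<beta> \<cdot> \<gamma>) = \<gamma>"
  using assms mul_assoc_eq[of \<beta> "gi \<beta>" \<gamma>] inv_closed dom_inv ran_inv by (simp add: mul_inv)

lemma inv_inv [simp]:
  assumes "\<gamma> \<in> arr" shows "gi (gi \<gamma>) = \<gamma>"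
proof -
  have "gi (gi \<gamma>) \<cdot> (gi \<gamma> \<cdot> \<gamma>) = \<gamma>"
    using assms inv_closed by (simp add: inv_mul_cancel dom_inv)
  moreover have "gi \<gamma> \<cdot> \<gamma> = d (gi (gi \<gamma>))"
    using assms inv_closed by (simp add: inv_mul dom_inv ran_inv)
  ultimately show ?thesis using assms inv_closed by simp
qed

lemma inv_unit: "x \<in> units \<Longrightarrow> gi x = x"
  by (metis dom_unit mul_dom_self unit_in_arrows inv_closed inv_mul dom_inv ran_unit)

lemma inv_mul_in_arrows:
  assumes "\<beta> \<in> arr" "\<gamma> \<in> arr" "r \<beta> = r \<gamma>"
  shows "gi \<beta> \<cdot> \<gamma> \<in> arr" "r (gi \<beta> \<cdot> \<gamma>) = d \<beta>" "d (gi \<beta> \<cdot> \<gamma>) = d \<gamma>"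
  using assms inv_closed dom_inv ran_inv by (simp_all add: mul_in_arrows ran_mul_eq dom_mul_eq)

lemma inv_mul_mul:
  assumes "\<beta> \<in> arr" "\<rho> \<in> arr" "\<gamma> \<in> arr" "d \<beta> = r \<rho>" "r \<beta> = r \<gamma>"
  shows "gi (\<beta> \<cdot> \<rho>) \<cdot> \<gamma> = gi \<rho> \<cdot> (gi \<beta> \<cdot> \<gamma>)"
proof -
  let ?\<tau> = "gi \<rho> \<cdot> (gi \<beta> \<cdot> \<gamma>)"
  note 1 = inv_mul_in_arrows[OF assms(1,3,5)]
  have 2: "?\<tau> \<in> arr" "r ?\<tau> = d \<rho>"
    using inv_mul_in_arrows[of \<rho> "gi \<beta> \<cdot> \<gamma>"] 1 assms by auto
  have "\<beta> \<cdot> \<rho> \<cdot> ?\<tau> = \<beta> \<cdot> (\<rho> \<cdot> ?\<tau>)"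
    using assms 2 by (intro mul_assoc_eq) auto
  also have "\<dots> = \<gamma>"
    using assms 1 by (simp add: mul_inv_cancel)
  finally have "\<beta> \<cdot> \<rho> \<cdot> ?\<tau> = \<gamma>" .
  then show ?thesis
    using inv_mul_cancel[of "\<beta> \<cdot> \<rho>" ?\<tau>] 2 assms by (simp add: mul_in_arrows dom_mul_eq)
qed

end

context topological_groupoid
begin

abbreviation \<T> where "\<T> \<equiv> gtop \<G>"

lemma topspace_gtop [simp]: "topspace \<T> = arr"
  by (simp add: arrows_def)

lemma units_subset: "units \<subseteq> arr"
  by auto

lemma topspace_unit_space [simp]: "topspace (unit_space \<G>) = units"
  using units_subset by (auto simp: unit_space_def)

lemma continuous_map_gmul:
  assumes "continuous_map X \<T> f" "continuous_map X \<T> g"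
    and "\<And>x. x \<in> topspace X \<Longrightarrow> d (f x) = r (g x)"
  shows "continuous_map X \<T> (\<lambda>x. f x \<cdot> g x)"
proof -
  have "continuous_map X (subtopology (prod_topology \<T> \<T>) (composable \<G>)) (\<lambda>x. (f x, g x))"
    using assms continuous_map_funspace[OF assms(1)] continuous_map_funspace[OF assms(2)]
    by (auto simp: continuous_map_in_subtopology continuous_map_paired composable_iff Pi_iff)
  from continuous_map_compose[OF this continuous_mul] show ?thesis
    by (simp add: o_def)
qed

lemma continuous_map_ginv: "continuous_map X \<T> f \<Longrightarrow> continuous_map X \<T> (\<lambda>x. gi (f x))"
  using continuous_map_compose[OF _ continuous_inv] by (simp add: o_def)

lemma continuous_map_ran: "continuous_map \<T> (unit_space \<G>) r"
proof -
  have "continuous_map \<T> \<T> (\<lambda>x. x \<cdot> gi x)"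
    using continuous_inv continuous_map_id[unfolded id_def]
    by (intro continuous_map_gmul) (auto simp: ran_inv)
  then show ?thesis
    unfolding unit_space_def continuous_map_in_subtopology by (auto simp: mul_inv)
qed

lemma continuous_map_dom: "continuous_map \<T> (unit_space \<G>) d"
proof -
  have "continuous_map \<T> \<T> (\<lambda>x. gi x \<cdot> x)"
    using continuous_inv continuous_map_id[unfolded id_def]
    by (intro continuous_map_gmul) (auto simp: dom_inv)
  then show ?thesis
    unfolding unit_space_def continuous_map_in_subtopology by (auto simp: inv_mul)
qed

lemma image_inv_eq_preimage:
  assumes "U \<subseteq> arr" shows "gi ` U = {\<gamma> \<in> arr. gi \<gamma> \<in> U}"
proof
  show "gi ` U \<subseteq> {\<gamma> \<in> arr. gi \<gamma> \<in> U}"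
    using assms inv_closed by auto
  show "{\<gamma> \<in> arr. gi \<gamma> \<in> U} \<subseteq> gi ` U"
    by (metis (mono_tags, lifting) image_eqI inv_inv mem_Collect_eq subsetI)
qed

end

definition (in groupoid) compact_open_bisection :: "'g set \<Rightarrow> bool" where
  "compact_open_bisection U \<longleftrightarrow> openin (gtop \<G>) U \<and> compactin (gtop \<G>) U \<and> bisection \<G> U"

lemma (in topological_groupoid) compact_open_bisection_inverse:
  assumes "compact_open_bisection U"
  shows "compact_open_bisection (gi ` U)"
proof -
  have U: "openin \<T> U" "compactin \<T> U" "U \<subseteq> arr" "inj_on d U" "inj_on r U"
    using assms unfolding compact_open_bisection_def bisection_def by auto
  have "openin \<T> (gi ` U)"
    using openin_continuous_map_preimage[OF continuous_inv U(1)] U(3)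
    by (simp add: image_inv_eq_preimage)
  moreover have "compactin \<T> (gi ` U)"
    using image_compactin[OF U(2) continuous_inv] .
  moreover have "bisection \<G> (gi ` U)"
    unfolding bisection_def using U inv_closed
    by (auto simp: inj_on_def dom_inv ran_inv subset_iff)
  ultimately show ?thesis unfolding compact_open_bisection_def by simp
qed

context ample_groupoid
begin

lemma compact_open_unit_neighbourhood:
  assumes "openin (unit_space \<G>) N" "x \<in> N"
  obtains K where "openin (unit_space \<G>) K" "compactin (unit_space \<G>) K" "x \<in> K" "K \<subseteq> N"
proof -
  have "(arbitrary union_of (\<lambda>U. openin (unit_space \<G>) U \<and> compact_Hausdorff_in (unit_space \<G>) U)) N"
    using assms(1) compact_open_basis by metis
  then obtain \<U> where \<U>: "\<And>U. U \<in> \<U> \<Longrightarrow> openin (unit_space \<G>) U \<and> compact_Hausdorff_in (unit_space \<G>) U"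
      "\<Union>\<U> = N"
    unfolding union_of_def arbitrary_def by (metis mem_Collect_eq subset_iff)
  then obtain K where "K \<in> \<U>" "x \<in> K" using assms(2) by auto
  then show thesis
    using that \<U> unfolding compact_Hausdorff_in_def by (metis Union_upper)
qed

lemma bisection_Hausdorff:
  assumes "bisection \<G> U" shows "Hausdorff_space (subtopology \<T> U)"
proof (rule Hausdorff_space_injective_preimage[OF Hausdorff_units])
  show "continuous_map (subtopology \<T> U) (unit_space \<G>) r"
    using continuous_map_ran continuous_map_from_subtopology by blast
  show "inj_on r (topspace (subtopology \<T> U))"
    using assms by (auto simp: bisection_def inj_on_def)
qed

abbreviation lift :: "'a set \<Rightarrow> 'a \<Rightarrow> 'a" where
  "lift U \<equiv> the_inv_into U r"

lemma continuous_map_lift: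
  assumes "openin \<T> U" "bisection \<G> U"
  shows "continuous_map (subtopology (unit_space \<G>) (r ` U)) \<T> (lift U)"
  using assms local_homeomorphism_local_inverse[OF local_homeomorphism_ran]
  by (simp add: bisection_def)

lemma openin_ran_image: "openin \<T> U \<Longrightarrow> openin (unit_space \<G>) (r ` U)"
  using local_homeomorphism_imp_open_map[OF local_homeomorphism_ran] by (simp add: open_map_def)

lemma lift_ran: "bisection \<G> U \<Longrightarrow> \<beta> \<in> U \<Longrightarrow> r \<beta> = x \<Longrightarrow> lift U x = \<beta>"
  unfolding bisection_def by (metis the_inv_into_f_f)

lemma compact_open_bisection_neighbourhood:
  assumes g: "\<gamma> \<in> arr" and N: "openin (unit_space \<G>) N" "d \<gamma> \<in> N"
    and M: "openin (unit_space \<G>) M" "r \<gamma> \<in> M"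
  obtains W where "compact_open_bisection W" "\<gamma> \<in> W" "d ` W \<subseteq> N" "r ` W \<subseteq> M"
proof -
  obtain U1 where U1: "openin \<T> U1" "\<gamma> \<in> U1" "inj_on r U1"
    using local_homeomorphism_injective_neighbourhood[OF local_homeomorphism_ran, of \<gamma>] g by auto
  obtain U2 where U2: "openin \<T> U2" "gi \<gamma> \<in> U2" "inj_on r U2"
    using local_homeomorphism_injective_neighbourhood[OF local_homeomorphism_ran, of "gi \<gamma>"]
      g inv_closed by auto
  let ?U = "U1 \<inter> {x \<in> arr. gi x \<in> U2} \<inter> {x \<in> arr. d x \<in> N} \<inter> {x \<in> arr. r x \<in> M}"
  have "openin \<T> ?U"
    using U1 openin_continuous_map_preimage[OF continuous_inv U2(1)]
      openin_continuous_map_preimage[OF continuous_map_dom N(1)]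
      openin_continuous_map_preimage[OF continuous_map_ran M(1)]
    by (auto intro!: openin_Int)
  moreover have "bisection \<G> ?U"
    unfolding bisection_def
  proof (intro conjI)
    show "inj_on d ?U"
    proof (rule inj_onI)
      fix a b assume ab: "a \<in> ?U" "b \<in> ?U" "d a = d b"
      then have "r (gi a) = r (gi b)" by (simp add: ran_inv)
      then have "gi a = gi b" using ab U2(3) by (auto dest: inj_onD)
      then show "a = b" using ab by (metis (no_types, lifting) IntE inv_inv mem_Collect_eq)
    qed
    show "inj_on r ?U" using U1(3) by (auto simp: inj_on_def)
  qed auto
  moreover have gU: "\<gamma> \<in> ?U" using U1 U2 N M g by auto
  ultimately obtain U where U: "openin \<T> U" "bisection \<G> U" "\<gamma> \<in> U" "U \<subseteq> ?U" by blast
  have UA: "U \<subseteq> arr" using openin_subset[OF U(1)] by simp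
  obtain K where K: "openin (unit_space \<G>) K" "compactin (unit_space \<G>) K" "r \<gamma> \<in> K" "K \<subseteq> r ` U"
    using compact_open_unit_neighbourhood[OF openin_ran_image[OF U(1)], of "r \<gamma>"] U(3) by blast
  let ?W = "{x \<in> U. r x \<in> K}"
  have "openin \<T> ?W"
    using openin_continuous_map_preimage_gen[OF continuous_map_ran U(1) K(1)] .
  moreover have "?W = lift U ` K"
  proof
    show "?W \<subseteq> lift U ` K"
    proof
      fix x assume "x \<in> ?W"
      then have "x = lift U (r x)" "r x \<in> K" using lift_ran[OF U(2)] by auto
      then show "x \<in> lift U ` K" by blast
    qed
    show "lift U ` K \<subseteq> ?W"
    proof
      fix x assume "x \<in> lift U ` K"
      then obtain k where k: "k \<in> K" "x = lift U k" by blast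
      then obtain u where "u \<in> U" "k = r u" using K(4) by blast
      then show "x \<in> ?W" using k lift_ran[OF U(2)] by simp
    qed
  qed
  moreover have "compactin (subtopology (unit_space \<G>) (r ` U)) K"
    using K by (simp add: compactin_subtopology)
  then have "compactin \<T> (lift U ` K)"
    using image_compactin continuous_map_lift[OF U(1,2)] by blast
  moreover have "bisection \<G> ?W"
    using U(2) by (auto simp: bisection_def inj_on_def)
  ultimately have "compact_open_bisection ?W" by (simp add: compact_open_bisection_def)
  then show thesis using that[of ?W] K(3) U(3,4) by auto
qed

lemma compact_open_bisection_mul:
  assumes U: "compact_open_bisection U" and V: "compact_open_bisection V"
  defines "W \<equiv> {\<gamma> \<in> arr. r \<gamma> \<in> r ` U \<and> gi (lift U (r \<gamma>)) \<cdot> \<gamma> \<in> V}"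
  shows "compact_open_bisection W"
    and "continuous_map (subtopology \<T> W) \<T> (\<lambda>\<gamma>. lift U (r \<gamma>))"
    and "continuous_map (subtopology \<T> W) \<T> (\<lambda>\<gamma>. gi (lift U (r \<gamma>)) \<cdot> \<gamma>)"
proof -
  have U': "openin \<T> U" "compactin \<T> U" "bisection \<G> U" "U \<subseteq> arr"
    and V': "openin \<T> V" "compactin \<T> V" "bisection \<G> V" "V \<subseteq> arr"
    using U V unfolding compact_open_bisection_def bisection_def by auto
  define P where "P = {\<gamma> \<in> arr. r \<gamma> \<in> r ` U}"
  have PA: "P \<subseteq> arr" unfolding P_def by blast
  have P: "openin \<T> P"
    unfolding P_def
    using openin_continuous_map_preimage[OF continuous_map_ran openin_ran_image[OF U'(1)]] by simp
  have lU: "lift U (r \<gamma>) \<in> U \<and> r (lift U (r \<gamma>)) = r \<gamma>" if "\<gamma> \<in> P" for \<gamma>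
  proof -
    obtain u where "u \<in> U" "r u = r \<gamma>" using \<open>\<gamma> \<in> P\<close> unfolding P_def by force
    then show ?thesis using lift_ran[OF U'(3)] by metis
  qed
  have lA: "lift U (r \<gamma>) \<in> arr" if "\<gamma> \<in> P" for \<gamma>
    using lU that U'(4) by blast
  have c0: "continuous_map (subtopology \<T> P) (subtopology (unit_space \<G>) (r ` U)) r"
    using continuous_map_ran
    by (auto simp: continuous_map_in_subtopology P_def intro!: continuous_map_from_subtopology)
  have c1: "continuous_map (subtopology \<T> P) \<T> (\<lambda>\<gamma>. lift U (r \<gamma>))"
    using continuous_map_compose[OF c0 continuous_map_lift[OF U'(1,3)]] by (simp add: o_def)
  have c2: "continuous_map (subtopology \<T> P) \<T> (\<lambda>\<gamma>. gi (lift U (r \<gamma>)) \<cdot> \<gamma>)"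
  proof (intro continuous_map_gmul continuous_map_ginv c1)
    show "continuous_map (subtopology \<T> P) \<T> (\<lambda>\<gamma>. \<gamma>)"
      using continuous_map_from_subtopology[OF continuous_map_id[unfolded id_def]] .
    show "d (gi (lift U (r x))) = r x" if "x \<in> topspace (subtopology \<T> P)" for x
      using that lU lA by (simp add: dom_inv)
  qed
  have WP: "W = {\<gamma> \<in> P. gi (lift U (r \<gamma>)) \<cdot> \<gamma> \<in> V}"
    unfolding W_def P_def by blast
  have WsP: "W \<subseteq> P" unfolding WP by blast
  show "continuous_map (subtopology \<T> W) \<T> (\<lambda>\<gamma>. lift U (r \<gamma>))"
    using continuous_map_from_subtopology_mono[OF c1 WsP] .
  show "continuous_map (subtopology \<T> W) \<T> (\<lambda>\<gamma>. gi (lift U (r \<gamma>)) \<cdot> \<gamma>)"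
    using continuous_map_from_subtopology_mono[OF c2 WsP] .
  have "openin (subtopology \<T> P) W"
    using openin_continuous_map_preimage[OF c2 V'(1)] PA unfolding WP
    by (simp add: inf_absorb2)
  then have Wop: "openin \<T> W" using P openin_trans_full by blast
  have Wdec: "\<exists>u\<in>U. \<exists>v\<in>V. \<gamma> = u \<cdot> v \<and> d u = r v \<and> u = lift U (r \<gamma>)" if "\<gamma> \<in> W" for \<gamma>
  proof -
    let ?u = "lift U (r \<gamma>)"
    have "\<gamma> \<in> P" "gi ?u \<cdot> \<gamma> \<in> V" "\<gamma> \<in> arr" using that unfolding WP P_def by auto
    then show ?thesis
      using lU[of \<gamma>] lA[of \<gamma>] mul_inv_cancel[of ?u \<gamma>] inv_mul_in_arrows(2)[of ?u \<gamma>]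
      by (intro bexI[of _ ?u] bexI[of _ "gi ?u \<cdot> \<gamma>"]) auto
  qed
  let ?C = "(U \<times> V) \<inter> composable \<G>"
  have "compactin \<T> W"
  proof -
    have cc: "compact_space (subtopology (prod_topology \<T> \<T>) (U \<times> V))"
      using U'(2) V'(2) compactin_Times[of \<T> \<T> U V] by (metis compactin_subspace)
    have "closedin (subtopology (prod_topology \<T> \<T>) (U \<times> V))
        {x \<in> topspace (subtopology (prod_topology \<T> \<T>) (U \<times> V)). (d \<circ> fst) x = (r \<circ> snd) x}"
      using Hausdorff_units continuous_map_from_subtopology
        continuous_map_compose[OF continuous_map_fst continuous_map_dom]
        continuous_map_compose[OF continuous_map_snd continuous_map_ran]
      by (intro closedin_continuous_maps_eq) blast+
    also have "{x \<in> topspace (subtopology (prod_topology \<T> \<T>) (U \<times> V)). (d \<circ> fst) x = (r \<circ> snd) x} = ?C"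
      using U'(4) V'(4) by (auto simp: composable_iff)
    finally have "compactin (subtopology (prod_topology \<T> \<T>) (U \<times> V)) ?C"
      using cc closedin_compact_space by blast
    then have "compactin (subtopology (prod_topology \<T> \<T>) (composable \<G>)) ?C"
      by (auto simp: compactin_subtopology)
    then have "compactin \<T> ((\<lambda>(\<beta>, \<gamma>). \<beta> \<cdot> \<gamma>) ` ?C)"
      using image_compactin continuous_mul by blast
    also have "(\<lambda>(\<beta>, \<gamma>). \<beta> \<cdot> \<gamma>) ` ?C = W"
    proof
      show "(\<lambda>(\<beta>, \<gamma>). \<beta> \<cdot> \<gamma>) ` ?C \<subseteq> W"
      proof (clarsimp simp: composable_iff)
        fix u v assume uv: "u \<in> U" "v \<in> V" "u \<in> arr" "v \<in> arr" "d u = r v"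
        then have "lift U (r (u \<cdot> v)) = u" using lift_ran[OF U'(3)] ran_mul_eq by auto
        then show "u \<cdot> v \<in> W"
          using uv unfolding W_def by (auto simp: mul_in_arrows ran_mul_eq inv_mul_cancel)
      qed
      show "W \<subseteq> (\<lambda>(\<beta>, \<gamma>). \<beta> \<cdot> \<gamma>) ` ?C"
      proof
        fix \<gamma> assume "\<gamma> \<in> W"
        then obtain u v where "u \<in> U" "v \<in> V" "\<gamma> = u \<cdot> v" "d u = r v" using Wdec by blast
        moreover then have "(u, v) \<in> ?C" using U'(4) V'(4) by (auto simp: composable_iff)
        ultimately show "\<gamma> \<in> (\<lambda>(\<beta>, \<gamma>). \<beta> \<cdot> \<gamma>) ` ?C" by force
      qed
    qed
    finally show ?thesis .
  qed
  moreover have "bisection \<G> W"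
    unfolding bisection_def
  proof (intro conjI inj_onI)
    show "W \<subseteq> arr" using WsP PA by blast
  next
    fix a b assume ab: "a \<in> W" "b \<in> W" "d a = d b"
    obtain u v where uv: "u \<in> U" "v \<in> V" "a = u \<cdot> v" "d u = r v" using Wdec ab by blast
    obtain u' v' where uv': "u' \<in> U" "v' \<in> V" "b = u' \<cdot> v'" "d u' = r v'" using Wdec ab by blast
    have "d v = d v'" using ab uv uv' U'(4) V'(4) dom_mul_eq by (metis subsetD)
    then have "v = v'" using V'(3) uv uv' by (auto simp: bisection_def dest: inj_onD)
    then have "d u = d u'" using uv uv' by simp
    then have "u = u'" using U'(3) uv(1) uv'(1) unfolding bisection_def inj_on_def by blast
    then show "a = b" using \<open>v = v'\<close> uv uv' by simp
  next
    fix a b assume ab: "a \<in> W" "b \<in> W" "r a = r b"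
    obtain u v where uv: "u \<in> U" "v \<in> V" "a = u \<cdot> v" "d u = r v" "u = lift U (r a)"
      using Wdec ab by blast
    obtain u' v' where uv': "u' \<in> U" "v' \<in> V" "b = u' \<cdot> v'" "d u' = r v'" "u' = lift U (r b)"
      using Wdec ab by blast
    have "u = u'" using uv(5) uv'(5) ab(3) by metis
    moreover from this have "r v = r v'" using uv(4) uv'(4) by metis
    ultimately have "v = v'" using V'(3) uv(2) uv'(2) unfolding bisection_def inj_on_def by blast
    then show "a = b" by (simp only: \<open>u = u'\<close> uv(3) uv'(3))
  qed
  ultimately show "compact_open_bisection W"
    using Wop by (simp add: compact_open_bisection_def)
qed

lemma cofinite_open:
  assumes "finite F" shows "openin (unit_space \<G>) (units - F)"
proof -
  have "closedin (unit_space \<G>) (units \<inter> F)"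
    using assms Hausdorff_imp_t1_space[OF Hausdorff_units]
    unfolding t1_space_closedin_finite by (metis finite_Int inf_le1 topspace_unit_space)
  then have "openin (unit_space \<G>) (units - units \<inter> F)"
    by (metis openin_diff openin_topspace topspace_unit_space)
  moreover have "units - units \<inter> F = units - F" by blast
  ultimately show ?thesis by simp
qed

end

section \<open>Finite sums in stalks\<close>

lemma (in abelian_monoid) finsum_swap:
  assumes "finite A" "finite B" "\<And>a b. a \<in> A \<Longrightarrow> b \<in> B \<Longrightarrow> f a b \<in> carrier G"
  shows "finsum G (\<lambda>a. finsum G (f a) B) A = finsum G (\<lambda>b. finsum G (\<lambda>a. f a b) A) B"
  using assms(1,3)
proof (induction A rule: finite_induct)
  case empty
  then show ?case by (simp add: finsum_zero)
next
  case (insert a A)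
  have "finsum G (\<lambda>a. finsum G (f a) B) (insert a A)
      = finsum G (f a) B \<oplus> finsum G (\<lambda>b. finsum G (\<lambda>a. f a b) A) B"
    using insert by (subst finsum_insert) (auto intro!: finsum_closed)
  also have "\<dots> = finsum G (\<lambda>b. f a b \<oplus> finsum G (\<lambda>a. f a b) A) B"
    using insert by (subst finsum_addf) (auto intro!: finsum_closed)
  also have "\<dots> = finsum G (\<lambda>b. finsum G (\<lambda>a. f a b) (insert a A)) B"
    using insert by (intro finsum_cong') (auto intro!: finsum_closed simp: finsum_insert Pi_def)
  finally show ?case .
qed

lemma ring_hom_finsum:
  assumes h: "h \<in> ring_hom R S" and R: "ring R" and S: "ring S"
    and A: "finite A" and f: "\<And>a. a \<in> A \<Longrightarrow> f a \<in> carrier R"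
  shows "h (finsum R f A) = finsum S (\<lambda>a. h (f a)) A"
proof -
  interpret R: ring R by fact
  interpret S: ring S by fact
  show ?thesis
    using A f
  proof (induction A rule: finite_induct)
    case empty
    show ?case using ring_hom_zero[OF h R S] by simp
  next
    case (insert a A)
    then show ?case
      using ring_hom_add[OF h] ring_hom_closed[OF h]
      by (simp add: R.finsum_insert S.finsum_insert Pi_def R.finsum_closed)
  qed
qed

context groupoid_sheaf_of_rings
begin

abbreviation St where "St x \<equiv> stalk \<O> x"
abbreviation C where "C x \<equiv> carrier (stalk \<O> x)"

lemma act_closed: "\<gamma> \<in> arr \<Longrightarrow> e \<in> C (d \<gamma>) \<Longrightarrow> act \<O> \<gamma> e \<in> C (r \<gamma>)"
  using act_ring_hom ring_hom_closed by metis

lemma act_comp: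
  "\<beta> \<in> arr \<Longrightarrow> \<gamma> \<in> arr \<Longrightarrow> d \<beta> = r \<gamma> \<Longrightarrow> e \<in> C (d \<gamma>) \<Longrightarrow>
    act \<O> \<beta> (act \<O> \<gamma> e) = act \<O> (\<beta> \<cdot> \<gamma>) e"
  by (intro act_act) (auto simp: carrier_stalk composable_iff)

lemma act_id: "x \<in> units \<Longrightarrow> e \<in> C x \<Longrightarrow> act \<O> x e = e"
  using act_unit by (force simp: carrier_stalk)

lemma act_zero: "\<gamma> \<in> arr \<Longrightarrow> act \<O> \<gamma> \<zero>\<^bsub>St (d \<gamma>)\<^esub> = \<zero>\<^bsub>St (r \<gamma>)\<^esub>"
  using ring_hom_zero act_ring_hom ring_stalk dom_in_units ran_in_units by metis

lemma act_inv_act: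
  assumes "\<gamma> \<in> arr" "e \<in> C (d \<gamma>)" shows "act \<O> (gi \<gamma>) (act \<O> \<gamma> e) = e"
  using assms act_comp[of "gi \<gamma>" \<gamma> e] inv_closed dom_inv act_id[of "d \<gamma>" e] by (simp add: inv_mul)

lemma act_eq_zero_iff:
  assumes "\<gamma> \<in> arr" "e \<in> C (d \<gamma>)"
  shows "act \<O> \<gamma> e = \<zero>\<^bsub>St (r \<gamma>)\<^esub> \<longleftrightarrow> e = \<zero>\<^bsub>St (d \<gamma>)\<^esub>"
  using assms act_inv_act act_zero[of \<gamma>] act_zero[of "gi \<gamma>"] inv_closed dom_inv ran_inv by metis

abbreviation \<S> where "\<S> \<equiv> section_group \<G> \<O>"

lemma section_iff:
  "f \<in> carrier \<S> \<longleftrightarrow> f \<in> extensional arr \<and> (\<forall>\<gamma>\<in>arr. f \<gamma> \<in> C (r \<gamma>))"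
  unfolding section_group_def by (auto simp: carrier_stalk PiE_def)

lemma section_in: "f \<in> carrier \<S> \<Longrightarrow> \<gamma> \<in> arr \<Longrightarrow> r \<gamma> = x \<Longrightarrow> f \<gamma> \<in> C x"
  by (auto simp: section_iff)

lemma section_eqI:
  assumes "f \<in> carrier \<S>" "g \<in> carrier \<S>" "\<And>\<gamma>. \<gamma> \<in> arr \<Longrightarrow> f \<gamma> = g \<gamma>"
  shows "f = g"
  using assms by (auto simp: section_iff intro: extensionalityI)

lemma section_add: "\<gamma> \<in> arr \<Longrightarrow> (f \<otimes>\<^bsub>\<S>\<^esub> g) \<gamma> = f \<gamma> \<oplus>\<^bsub>St (r \<gamma>)\<^esub> g \<gamma>"
  by (simp add: section_group_def)

lemma section_zero: "\<gamma> \<in> arr \<Longrightarrow> \<one>\<^bsub>\<S>\<^esub> \<gamma> = \<zero>\<^bsub>St (r \<gamma>)\<^esub>"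
  by (simp add: section_group_def)

lemma comm_group_sections: "comm_group \<S>"
proof (rule comm_groupI)
  show "x \<otimes>\<^bsub>\<S>\<^esub> y \<in> carrier \<S>" if "x \<in> carrier \<S>" "y \<in> carrier \<S>" for x y
    using that by (auto simp: section_iff section_add ring.ring_simprules(1)[OF ring_stalk])
      (simp add: section_group_def)
  note add_closed = this
  show one: "\<one>\<^bsub>\<S>\<^esub> \<in> carrier \<S>"
    by (auto simp: section_iff section_zero ring.ring_simprules(2)[OF ring_stalk])
      (simp add: section_group_def)
  show "x \<otimes>\<^bsub>\<S>\<^esub> y \<otimes>\<^bsub>\<S>\<^esub> z = x \<otimes>\<^bsub>\<S>\<^esub> (y \<otimes>\<^bsub>\<S>\<^esub> z)"
    if "x \<in> carrier \<S>" "y \<in> carrier \<S>" "z \<in> carrier \<S>" for x y z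
    using that add_closed
    by (intro section_eqI) (auto simp: section_add section_in ring.ring_simprules(7)[OF ring_stalk])
  show "x \<otimes>\<^bsub>\<S>\<^esub> y = y \<otimes>\<^bsub>\<S>\<^esub> x" if "x \<in> carrier \<S>" "y \<in> carrier \<S>" for x y
    using that add_closed
    by (intro section_eqI) (auto simp: section_add section_in ring.ring_simprules(10)[OF ring_stalk])
  show "\<one>\<^bsub>\<S>\<^esub> \<otimes>\<^bsub>\<S>\<^esub> x = x" if "x \<in> carrier \<S>" for x
    using that add_closed one
    by (intro section_eqI)
      (auto simp: section_add section_zero section_in ring.ring_simprules(8)[OF ring_stalk])
  show "\<exists>y\<in>carrier \<S>. y \<otimes>\<^bsub>\<S>\<^esub> x = \<one>\<^bsub>\<S>\<^esub>" if "x \<in> carrier \<S>" for x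
  proof
    show *: "(\<lambda>\<gamma>\<in>arr. \<ominus>\<^bsub>St (r \<gamma>)\<^esub> x \<gamma>) \<in> carrier \<S>"
      using that by (auto simp: section_iff ring.ring_simprules(3)[OF ring_stalk])
    then show "(\<lambda>\<gamma>\<in>arr. \<ominus>\<^bsub>St (r \<gamma>)\<^esub> x \<gamma>) \<otimes>\<^bsub>\<S>\<^esub> x = \<one>\<^bsub>\<S>\<^esub>"
      using that add_closed one
      by (intro section_eqI)
        (auto simp: section_add section_zero section_in ring.ring_simprules(9)[OF ring_stalk])
  qed
qed

sublocale sections: comm_group \<S>
  by (rule comm_group_sections)

lemma section_inv:
  assumes "f \<in> carrier \<S>" "\<gamma> \<in> arr"
  shows "(inv\<^bsub>\<S>\<^esub> f) \<gamma> = \<ominus>\<^bsub>St (r \<gamma>)\<^esub> f \<gamma>"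
proof -
  interpret ring "St (r \<gamma>)" using assms ring_stalk by simp
  have "(inv\<^bsub>\<S>\<^esub> f) \<gamma> \<oplus>\<^bsub>St (r \<gamma>)\<^esub> f \<gamma> = \<zero>\<^bsub>St (r \<gamma>)\<^esub>"
    using sections.l_inv[OF assms(1)] section_add[OF assms(2)] section_zero[OF assms(2)] by metis
  then show ?thesis
    using minus_equality[of "(inv\<^bsub>\<S>\<^esub> f) \<gamma>" "f \<gamma>"] assms sections.inv_closed[OF assms(1)]
    by (simp add: section_in)
qed

text \<open>
  Convolution with \<open>f\<close> and the action of \<open>f\<close> on sections over the unit space are both of the
  form \<open>pair z f k\<close>, with \<open>k \<sigma> = g (\<sigma>\<^sup>-\<^sup>1 \<gamma>)\<close> and \<open>k \<sigma> = v (d \<sigma>)\<close> respectively, so that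
  associativity needs to be proved only once.
\<close>

definition pair :: "'a \<Rightarrow> ('a \<Rightarrow> 'b) \<Rightarrow> ('a \<Rightarrow> 'b) \<Rightarrow> 'b" where
  "pair z f k = finsum (St z) (\<lambda>\<sigma>. f \<sigma> \<otimes>\<^bsub>St z\<^esub> act \<O> \<sigma> (k \<sigma>)) {\<sigma> \<in> arr. r \<sigma> = z \<and> f \<sigma> \<noteq> \<zero>\<^bsub>St z\<^esub>}"

definition fibre_finite :: "('a \<Rightarrow> 'b) \<Rightarrow> bool" where
  "fibre_finite f \<longleftrightarrow> (\<forall>z\<in>units. finite {\<sigma> \<in> arr. r \<sigma> = z \<and> f \<sigma> \<noteq> \<zero>\<^bsub>St z\<^esub>})"

definition adapted :: "'a \<Rightarrow> ('a \<Rightarrow> 'b) \<Rightarrow> bool" where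
  "adapted z k \<longleftrightarrow> (\<forall>\<sigma>\<in>arr. r \<sigma> = z \<longrightarrow> k \<sigma> \<in> C (d \<sigma>))"

lemma adaptedD: "adapted z k \<Longrightarrow> \<sigma> \<in> arr \<Longrightarrow> r \<sigma> = z \<Longrightarrow> k \<sigma> \<in> C (d \<sigma>)"
  by (simp add: adapted_def)

lemma pair_term_closed:
  assumes "f \<in> carrier \<S>" "adapted z k" "\<sigma> \<in> arr" "r \<sigma> = z"
  shows "f \<sigma> \<otimes>\<^bsub>St z\<^esub> act \<O> \<sigma> (k \<sigma>) \<in> C z"
  using assms ring.ring_simprules(5)[OF ring_stalk] act_closed adaptedD section_in
  by (metis ran_in_units)

lemma pair_closed:
  assumes "f \<in> carrier \<S>" "adapted z k" "z \<in> units"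
  shows "pair z f k \<in> C z"
proof -
  interpret ring "St z" using assms ring_stalk by simp
  show ?thesis
    unfolding pair_def using pair_term_closed[OF assms(1,2)] by (intro finsum_closed) auto
qed

lemma pair_superset:
  assumes "f \<in> carrier \<S>" "adapted z k" "z \<in> units" "finite B"
    and "\<And>\<sigma>. \<sigma> \<in> B \<Longrightarrow> \<sigma> \<in> arr \<and> r \<sigma> = z"
    and "\<And>\<sigma>. \<sigma> \<in> arr \<Longrightarrow> r \<sigma> = z \<Longrightarrow> f \<sigma> \<noteq> \<zero>\<^bsub>St z\<^esub> \<Longrightarrow> \<sigma> \<in> B"
  shows "pair z f k = finsum (St z) (\<lambda>\<sigma>. f \<sigma> \<otimes>\<^bsub>St z\<^esub> act \<O> \<sigma> (k \<sigma>)) B"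
proof -
  interpret ring "St z" using assms ring_stalk by simp
  show ?thesis
    unfolding pair_def
  proof (rule add.finprod_mono_neutral_cong_left)
    show "f i \<otimes>\<^bsub>St z\<^esub> act \<O> i (k i) = \<zero>\<^bsub>St z\<^esub>"
      if "i \<in> B - {\<sigma> \<in> arr. r \<sigma> = z \<and> f \<sigma> \<noteq> \<zero>\<^bsub>St z\<^esub>}" for i
      using that assms(5)[of i] act_closed[of i "k i"] adaptedD[OF assms(2), of i] by auto
    show "(\<lambda>\<sigma>. f \<sigma> \<otimes>\<^bsub>St z\<^esub> act \<O> \<sigma> (k \<sigma>)) \<in> B \<rightarrow> C z"
      using pair_term_closed[OF assms(1,2)] assms(5) by auto
  qed (use assms in auto)
qed

lemma pair_cong:
  assumes "f \<in> carrier \<S>" "adapted z k" "z \<in> units"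
    and "\<And>\<sigma>. \<sigma> \<in> arr \<Longrightarrow> r \<sigma> = z \<Longrightarrow> f \<sigma> \<noteq> \<zero>\<^bsub>St z\<^esub> \<Longrightarrow> k \<sigma> = k' \<sigma>"
  shows "pair z f k = pair z f k'"
proof -
  interpret ring "St z" using assms ring_stalk by simp
  show ?thesis
    unfolding pair_def using pair_term_closed[OF assms(1,2)] assms(4)
    by (intro finsum_cong'[symmetric]) auto
qed

lemma pair_add_left:
  assumes f: "f \<in> carrier \<S>" "fibre_finite f" and g: "g \<in> carrier \<S>" "fibre_finite g"
    and k: "adapted z k" and z: "z \<in> units"
  shows "pair z (f \<otimes>\<^bsub>\<S>\<^esub> g) k = pair z f k \<oplus>\<^bsub>St z\<^esub> pair z g k"
proof -
  interpret ring "St z" using z ring_stalk by simp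
  let ?B = "{\<sigma> \<in> arr. r \<sigma> = z \<and> f \<sigma> \<noteq> \<zero>\<^bsub>St z\<^esub>} \<union> {\<sigma> \<in> arr. r \<sigma> = z \<and> g \<sigma> \<noteq> \<zero>\<^bsub>St z\<^esub>}"
  have fin: "finite ?B" using f g z by (simp add: fibre_finite_def)
  have eq: "pair z h k = finsum (St z) (\<lambda>\<sigma>. h \<sigma> \<otimes>\<^bsub>St z\<^esub> act \<O> \<sigma> (k \<sigma>)) ?B"
    if "h \<in> carrier \<S>" "\<And>\<sigma>. \<sigma> \<in> arr \<Longrightarrow> r \<sigma> = z \<Longrightarrow> h \<sigma> \<noteq> \<zero>\<^bsub>St z\<^esub> \<Longrightarrow> \<sigma> \<in> ?B" for h
    by (rule pair_superset[OF that(1) k z fin]) (use that(2) in auto)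
  have "pair z (f \<otimes>\<^bsub>\<S>\<^esub> g) k = finsum (St z) (\<lambda>\<sigma>. (f \<otimes>\<^bsub>\<S>\<^esub> g) \<sigma> \<otimes>\<^bsub>St z\<^esub> act \<O> \<sigma> (k \<sigma>)) ?B"
    using f g by (intro eq) (auto simp: section_add ring.ring_simprules(2,8)[OF ring_stalk])
  also have "\<dots> = finsum (St z) (\<lambda>\<sigma>. f \<sigma> \<otimes>\<^bsub>St z\<^esub> act \<O> \<sigma> (k \<sigma>) \<oplus>\<^bsub>St z\<^esub> g \<sigma> \<otimes>\<^bsub>St z\<^esub> act \<O> \<sigma> (k \<sigma>)) ?B"
  proof (rule finsum_cong')
    fix \<sigma> assume "\<sigma> \<in> ?B"
    then have s: "\<sigma> \<in> arr" "r \<sigma> = z" by auto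
    then show "(f \<otimes>\<^bsub>\<S>\<^esub> g) \<sigma> \<otimes>\<^bsub>St z\<^esub> act \<O> \<sigma> (k \<sigma>)
        = f \<sigma> \<otimes>\<^bsub>St z\<^esub> act \<O> \<sigma> (k \<sigma>) \<oplus>\<^bsub>St z\<^esub> g \<sigma> \<otimes>\<^bsub>St z\<^esub> act \<O> \<sigma> (k \<sigma>)"
      using f g act_closed[OF s(1) adaptedD[OF k s]] by (simp add: section_add l_distr section_in)
  qed (use pair_term_closed[OF f(1) k] pair_term_closed[OF g(1) k] in \<open>auto intro!: a_closed\<close>)
  also have "\<dots> = pair z f k \<oplus>\<^bsub>St z\<^esub> pair z g k"
    using f g pair_term_closed[OF f(1) k] pair_term_closed[OF g(1) k]
    by (subst finsum_addf) (auto simp: eq)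
  finally show ?thesis .
qed

lemma pair_add_right:
  assumes f: "f \<in> carrier \<S>"
    and k: "adapted z k" and l: "adapted z l" and z: "z \<in> units"
  shows "pair z f (\<lambda>\<sigma>. k \<sigma> \<oplus>\<^bsub>St (d \<sigma>)\<^esub> l \<sigma>) = pair z f k \<oplus>\<^bsub>St z\<^esub> pair z f l"
proof -
  interpret ring "St z" using z ring_stalk by simp
  let ?B = "{\<sigma> \<in> arr. r \<sigma> = z \<and> f \<sigma> \<noteq> \<zero>\<^bsub>St z\<^esub>}"
  have "pair z f (\<lambda>\<sigma>. k \<sigma> \<oplus>\<^bsub>St (d \<sigma>)\<^esub> l \<sigma>)
      = finsum (St z) (\<lambda>\<sigma>. f \<sigma> \<otimes>\<^bsub>St z\<^esub> act \<O> \<sigma> (k \<sigma>) \<oplus>\<^bsub>St z\<^esub> f \<sigma> \<otimes>\<^bsub>St z\<^esub> act \<O> \<sigma> (l \<sigma>)) ?B"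
    unfolding pair_def
  proof (rule finsum_cong')
    fix \<sigma> assume "\<sigma> \<in> ?B"
    then have s: "\<sigma> \<in> arr" "r \<sigma> = z" by auto
    have "act \<O> \<sigma> (k \<sigma> \<oplus>\<^bsub>St (d \<sigma>)\<^esub> l \<sigma>) = act \<O> \<sigma> (k \<sigma>) \<oplus>\<^bsub>St z\<^esub> act \<O> \<sigma> (l \<sigma>)"
      using ring_hom_add[OF act_ring_hom[OF s(1)] adaptedD[OF k s] adaptedD[OF l s]] s by simp
    then show "f \<sigma> \<otimes>\<^bsub>St z\<^esub> act \<O> \<sigma> (k \<sigma> \<oplus>\<^bsub>St (d \<sigma>)\<^esub> l \<sigma>)
        = f \<sigma> \<otimes>\<^bsub>St z\<^esub> act \<O> \<sigma> (k \<sigma>) \<oplus>\<^bsub>St z\<^esub> f \<sigma> \<otimes>\<^bsub>St z\<^esub> act \<O> \<sigma> (l \<sigma>)"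
      using f act_closed[OF s(1) adaptedD[OF k s]] act_closed[OF s(1) adaptedD[OF l s]] s
      by (simp add: r_distr section_in)
  qed (use pair_term_closed[OF f(1) k] pair_term_closed[OF f(1) l] in \<open>auto intro!: a_closed\<close>)
  also have "\<dots> = pair z f k \<oplus>\<^bsub>St z\<^esub> pair z f l"
    unfolding pair_def using pair_term_closed[OF f(1) k] pair_term_closed[OF f(1) l]
    by (subst finsum_addf) auto
  finally show ?thesis .
qed

lemma pair_eq_zero:
  assumes "z \<in> units"
    and "\<And>\<sigma>. \<sigma> \<in> arr \<Longrightarrow> r \<sigma> = z \<Longrightarrow> f \<sigma> \<otimes>\<^bsub>St z\<^esub> act \<O> \<sigma> (k \<sigma>) = \<zero>\<^bsub>St z\<^esub>"
  shows "pair z f k = \<zero>\<^bsub>St z\<^esub>"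
proof -
  interpret ring "St z" using assms ring_stalk by simp
  show ?thesis unfolding pair_def using assms by (intro add.finprod_one_eqI) auto
qed

lemma pair_single:
  assumes f: "f \<in> carrier \<S>" "fibre_finite f" and k: "adapted z k" and z: "z \<in> units"
    and \<tau>: "\<tau> \<in> arr" "r \<tau> = z"
    and "\<And>\<sigma>. \<sigma> \<in> arr \<Longrightarrow> r \<sigma> = z \<Longrightarrow> \<sigma> \<noteq> \<tau> \<Longrightarrow> f \<sigma> \<otimes>\<^bsub>St z\<^esub> act \<O> \<sigma> (k \<sigma>) = \<zero>\<^bsub>St z\<^esub>"
  shows "pair z f k = f \<tau> \<otimes>\<^bsub>St z\<^esub> act \<O> \<tau> (k \<tau>)"
proof -
  interpret ring "St z" using z ring_stalk by simp
  let ?B = "insert \<tau> {\<sigma> \<in> arr. r \<sigma> = z \<and> f \<sigma> \<noteq> \<zero>\<^bsub>St z\<^esub>}"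
  have "pair z f k = finsum (St z) (\<lambda>\<sigma>. f \<sigma> \<otimes>\<^bsub>St z\<^esub> act \<O> \<sigma> (k \<sigma>)) ?B"
    using f k z \<tau> by (intro pair_superset) (auto simp: fibre_finite_def)
  also have "\<dots> = finsum (St z) (\<lambda>\<sigma>. f \<sigma> \<otimes>\<^bsub>St z\<^esub> act \<O> \<sigma> (k \<sigma>)) {\<tau>}"
    using f z \<tau> assms(7) pair_term_closed[OF f(1) k]
    by (intro add.finprod_mono_neutral_cong_right) (auto simp: fibre_finite_def)
  also have "\<dots> = f \<tau> \<otimes>\<^bsub>St z\<^esub> act \<O> \<tau> (k \<tau>)"
    using pair_term_closed[OF f(1) k \<tau>] by (subst finsum_insert) (auto simp: finsum_empty)
  finally show ?thesis .
qed

lemma adapted_translate: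
  assumes "g \<in> carrier \<S>" "\<gamma> \<in> arr" "r \<gamma> = z"
  shows "adapted z (\<lambda>\<sigma>. g (gi \<sigma> \<cdot> \<gamma>))"
  unfolding adapted_def using assms inv_mul_in_arrows section_in by auto

lemma convolution_eq_pair:
  assumes f: "f \<in> carrier \<S>" "fibre_finite f" and g: "g \<in> carrier \<S>" and \<gamma>: "\<gamma> \<in> arr"
  shows "convolution \<G> \<O> f g \<gamma> = pair (r \<gamma>) f (\<lambda>\<sigma>. g (gi \<sigma> \<cdot> \<gamma>))"
proof -
  let ?z = "r \<gamma>"
  let ?B = "{\<sigma> \<in> arr. r \<sigma> = ?z \<and> f \<sigma> \<noteq> \<zero>\<^bsub>St ?z\<^esub>}"
  let ?t = "\<lambda>(\<beta>, \<rho>). f \<beta> \<otimes>\<^bsub>St ?z\<^esub> act \<O> \<beta> (g \<rho>)"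
  let ?h = "\<lambda>\<sigma>. (\<sigma>, gi \<sigma> \<cdot> \<gamma>)"
  interpret ring "St ?z" using \<gamma> ring_stalk by simp
  note k = adapted_translate[OF g \<gamma> refl]
  have decomp: "(\<beta>, \<rho>) \<in> composable \<G> \<and> \<beta> \<cdot> \<rho> = \<gamma> \<longleftrightarrow> \<beta> \<in> arr \<and> r \<beta> = ?z \<and> \<rho> = gi \<beta> \<cdot> \<gamma>" for \<beta> \<rho>
    using \<gamma> inv_mul_in_arrows[of \<beta> \<gamma>] mul_inv_cancel[of \<beta> \<gamma>] inv_mul_cancel[of \<beta> \<rho>] ran_mul_eq[of \<beta> \<rho>]
    by (auto simp: composable_iff)
  let ?T = "{(\<beta>, \<rho>) \<in> composable \<G>. \<beta> \<cdot> \<rho> = \<gamma> \<and> ?t (\<beta>, \<rho>) \<noteq> \<zero>\<^bsub>St ?z\<^esub>}"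
  have zero: "f \<sigma> \<noteq> \<zero>\<^bsub>St ?z\<^esub>"
    if "?t (?h \<sigma>) \<noteq> \<zero>\<^bsub>St ?z\<^esub>" "\<sigma> \<in> arr" "r \<sigma> = ?z" for \<sigma>
    using that act_closed[OF that(2) adaptedD[OF k that(2,3)]] by auto
  have "?T \<subseteq> ?h ` ?B"
  proof
    fix p assume p: "p \<in> ?T"
    then obtain \<beta> \<rho> where pe: "p = (\<beta>, \<rho>)" by (cases p)
    with p have "\<beta> \<in> arr" "r \<beta> = ?z" "\<rho> = gi \<beta> \<cdot> \<gamma>" "?t (?h \<beta>) \<noteq> \<zero>\<^bsub>St ?z\<^esub>"
      using decomp[of \<beta> \<rho>] by auto
    then show "p \<in> ?h ` ?B" using zero[of \<beta>] pe by auto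
  qed
  moreover have "?t p = \<zero>\<^bsub>St ?z\<^esub>" if "p \<in> ?h ` ?B - ?T" for p
    using that decomp by auto
  moreover have "?t \<in> ?h ` ?B \<rightarrow> C ?z"
    using pair_term_closed[OF f(1) k] by auto
  ultimately have "finsum (St ?z) ?t ?T = finsum (St ?z) ?t (?h ` ?B)"
    using f(2) \<gamma> by (intro add.finprod_mono_neutral_cong_left) (auto simp: fibre_finite_def)
  also have "\<dots> = finsum (St ?z) (\<lambda>\<sigma>. ?t (?h \<sigma>)) ?B"
    using pair_term_closed[OF f(1) k] by (intro finsum_reindex) (auto simp: inj_on_def)
  finally show ?thesis
    using \<gamma> by (simp add: convolution_def pair_def Let_def)
qed

lemma convolution_section:
  assumes "f \<in> carrier \<S>" "fibre_finite f" "g \<in> carrier \<S>"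
  shows "convolution \<G> \<O> f g \<in> carrier \<S>"
  unfolding section_iff
proof
  show "convolution \<G> \<O> f g \<in> extensional arr" by (simp add: convolution_def)
  show "\<forall>\<gamma>\<in>arr. convolution \<G> \<O> f g \<gamma> \<in> C (r \<gamma>)"
    using assms convolution_eq_pair pair_closed adapted_translate by simp
qed

lemma pair_convolution:
  assumes f: "f \<in> carrier \<S>" "fibre_finite f" and g: "g \<in> carrier \<S>" "fibre_finite g"
    and k: "adapted z k" and z: "z \<in> units"
  shows "pair z (convolution \<G> \<O> f g) k = pair z f (\<lambda>\<beta>. pair (d \<beta>) g (\<lambda>\<rho>. k (\<beta> \<cdot> \<rho>)))"
proof -
  interpret ring "St z" using z ring_stalk by simp
  let ?B = "{\<sigma> \<in> arr. r \<sigma> = z \<and> f \<sigma> \<noteq> \<zero>\<^bsub>St z\<^esub>}"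
  let ?C = "\<lambda>\<beta>. {\<rho> \<in> arr. r \<rho> = d \<beta> \<and> g \<rho> \<noteq> \<zero>\<^bsub>St (d \<beta>)\<^esub>}"
  define D where "D = (\<Union>\<beta>\<in>?B. (\<lambda>\<rho>. \<beta> \<cdot> \<rho>) ` ?C \<beta>)"
  have finB: "finite ?B" using f z by (simp add: fibre_finite_def)
  have finD: "finite D" unfolding D_def using finB g(2) by (auto simp: fibre_finite_def)
  have D: "\<sigma> \<in> arr \<and> r \<sigma> = z" if "\<sigma> \<in> D" for \<sigma>
    using that unfolding D_def by (auto simp: mul_in_arrows ran_mul_eq)
  have conv: "convolution \<G> \<O> f g \<sigma>
      = finsum (St z) (\<lambda>\<beta>. f \<beta> \<otimes>\<^bsub>St z\<^esub> act \<O> \<beta> (g (gi \<beta> \<cdot> \<sigma>))) ?B"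
    if "\<sigma> \<in> arr" "r \<sigma> = z" for \<sigma>
    using convolution_eq_pair[OF f g(1) that(1)] that by (simp add: pair_def)
  have gD: "\<rho> \<in> arr \<and> r \<rho> = d \<beta> \<and> act \<O> \<beta> (g \<rho>) \<in> C z"
    if "\<beta> \<in> arr" "r \<beta> = z" "\<sigma> \<in> arr" "r \<sigma> = z" "\<rho> = gi \<beta> \<cdot> \<sigma>" for \<beta> \<sigma> \<rho>
    using inv_mul_in_arrows[of \<beta> \<sigma>] that act_closed[of \<beta> "g \<rho>"] g(1) section_in by auto
  let ?x = "\<lambda>\<beta> \<sigma>. f \<beta> \<otimes>\<^bsub>St z\<^esub> act \<O> \<beta> (g (gi \<beta> \<cdot> \<sigma>)) \<otimes>\<^bsub>St z\<^esub> act \<O> \<sigma> (k \<sigma>)"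
  have actk: "act \<O> \<sigma> (k \<sigma>) \<in> C z" if "\<sigma> \<in> arr" "r \<sigma> = z" for \<sigma>
    using act_closed[OF that(1) adaptedD[OF k that]] that by simp
  have fB: "f \<beta> \<in> C z" if "\<beta> \<in> arr" "r \<beta> = z" for \<beta> using f that section_in by simp
  have xC: "?x \<beta> \<sigma> \<in> C z" if "\<beta> \<in> ?B" "\<sigma> \<in> D" for \<beta> \<sigma>
  proof -
    have "\<beta> \<in> arr" "r \<beta> = z" "\<sigma> \<in> arr" "r \<sigma> = z" using that D by auto
    then show ?thesis using gD[OF _ _ _ _ refl] fB actk by (intro m_closed) blast+
  qed
  have "pair z (convolution \<G> \<O> f g) k
      = finsum (St z) (\<lambda>\<sigma>. convolution \<G> \<O> f g \<sigma> \<otimes>\<^bsub>St z\<^esub> act \<O> \<sigma> (k \<sigma>)) D"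
  proof (rule pair_superset[OF convolution_section[OF f g(1)] k z finD D])
    fix \<sigma> assume s: "\<sigma> \<in> arr" "r \<sigma> = z" "convolution \<G> \<O> f g \<sigma> \<noteq> \<zero>\<^bsub>St z\<^esub>"
    show "\<sigma> \<in> D"
    proof (rule ccontr)
      assume nD: "\<sigma> \<notin> D"
      have "f \<beta> \<otimes>\<^bsub>St z\<^esub> act \<O> \<beta> (g (gi \<beta> \<cdot> \<sigma>)) = \<zero>\<^bsub>St z\<^esub>" if b: "\<beta> \<in> ?B" for \<beta>
      proof -
        have "g (gi \<beta> \<cdot> \<sigma>) = \<zero>\<^bsub>St (d \<beta>)\<^esub>"
        proof (rule ccontr)
          assume "g (gi \<beta> \<cdot> \<sigma>) \<noteq> \<zero>\<^bsub>St (d \<beta>)\<^esub>"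
          then have "gi \<beta> \<cdot> \<sigma> \<in> ?C \<beta>" using gD[of \<beta> \<sigma>] b s by auto
          moreover have "\<sigma> = \<beta> \<cdot> (gi \<beta> \<cdot> \<sigma>)" using mul_inv_cancel[of \<beta> \<sigma>] b s by auto
          ultimately show False using nD b unfolding D_def by blast
        qed
        then show ?thesis using b act_zero[of \<beta>] fB[of \<beta>] by auto
      qed
      then have "convolution \<G> \<O> f g \<sigma> = \<zero>\<^bsub>St z\<^esub>"
        unfolding conv[OF s(1,2)] by (rule add.finprod_one_eqI)
      with s show False by simp
    qed
  qed auto
  also have "\<dots> = finsum (St z) (\<lambda>\<sigma>. finsum (St z) (\<lambda>\<beta>. ?x \<beta> \<sigma>) ?B) D"
  proof (rule finsum_cong')
    fix \<sigma> assume "\<sigma> \<in> D"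
    then have s: "\<sigma> \<in> arr" "r \<sigma> = z" using D by auto
    have "(\<lambda>\<beta>. f \<beta> \<otimes>\<^bsub>St z\<^esub> act \<O> \<beta> (g (gi \<beta> \<cdot> \<sigma>))) \<in> ?B \<rightarrow> C z"
    proof
      fix \<beta> assume "\<beta> \<in> ?B"
      then have "\<beta> \<in> arr" "r \<beta> = z" by auto
      then show "f \<beta> \<otimes>\<^bsub>St z\<^esub> act \<O> \<beta> (g (gi \<beta> \<cdot> \<sigma>)) \<in> C z"
        using gD[OF _ _ s refl, of \<beta>] fB[of \<beta>] by (intro m_closed) simp_all
    qed
    then show "convolution \<G> \<O> f g \<sigma> \<otimes>\<^bsub>St z\<^esub> act \<O> \<sigma> (k \<sigma>) = finsum (St z) (\<lambda>\<beta>. ?x \<beta> \<sigma>) ?B"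
      unfolding conv[OF s] by (rule finsum_ldistr[OF finB actk[OF s]])
  qed (rule refl, intro Pi_I finsum_closed, rule xC)
  also have "\<dots> = finsum (St z) (\<lambda>\<beta>. finsum (St z) (\<lambda>\<sigma>. ?x \<beta> \<sigma>) D) ?B"
    using xC by (intro finsum_swap[OF finD finB]) auto
  also have "\<dots> = pair z f (\<lambda>\<beta>. pair (d \<beta>) g (\<lambda>\<rho>. k (\<beta> \<cdot> \<rho>)))"
    unfolding pair_def[of z f]
  proof (rule finsum_cong'[symmetric])
    fix \<beta> assume b: "\<beta> \<in> ?B"
    then have b': "\<beta> \<in> arr" "r \<beta> = z" "d \<beta> \<in> units" by auto
    interpret S: ring "St (d \<beta>)" using b' ring_stalk by simp
    have k': "adapted (d \<beta>) (\<lambda>\<rho>. k (\<beta> \<cdot> \<rho>))"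
      unfolding adapted_def
    proof (intro ballI impI)
      fix \<rho> assume "\<rho> \<in> arr" "r \<rho> = d \<beta>"
      then show "k (\<beta> \<cdot> \<rho>) \<in> C (d \<rho>)"
        using adaptedD[OF k, of "\<beta> \<cdot> \<rho>"] b' by (simp add: mul_in_arrows ran_mul_eq dom_mul_eq)
    qed
    let ?h = "\<lambda>\<sigma>. gi \<beta> \<cdot> \<sigma>"
    let ?t = "\<lambda>\<rho>. g \<rho> \<otimes>\<^bsub>St (d \<beta>)\<^esub> act \<O> \<rho> (k (\<beta> \<cdot> \<rho>))"
    have tC: "?t (?h \<sigma>) \<in> C (d \<beta>)" if "\<sigma> \<in> D" for \<sigma>
      using D[OF that] gD[of \<beta> \<sigma>] b' pair_term_closed[OF g(1) k', of "?h \<sigma>"] by auto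
    have "pair (d \<beta>) g (\<lambda>\<rho>. k (\<beta> \<cdot> \<rho>)) = finsum (St (d \<beta>)) ?t (?h ` D)"
    proof (rule pair_superset[OF g(1) k' b'(3)])
      show "finite (?h ` D)" using finD by simp
      show "\<sigma> \<in> arr \<and> r \<sigma> = d \<beta>" if "\<sigma> \<in> ?h ` D" for \<sigma>
        using that D gD b' by blast
      fix \<rho> assume "\<rho> \<in> arr" "r \<rho> = d \<beta>" "g \<rho> \<noteq> \<zero>\<^bsub>St (d \<beta>)\<^esub>"
      moreover then have "\<beta> \<cdot> \<rho> \<in> D" unfolding D_def using b by blast
      ultimately show "\<rho> \<in> ?h ` D" using inv_mul_cancel[of \<beta> \<rho>] b' by (metis imageI)
    qed
    also have "\<dots> = finsum (St (d \<beta>)) (\<lambda>\<sigma>. ?t (?h \<sigma>)) D"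
    proof (rule S.finsum_reindex)
      show "inj_on ?h D"
      proof (rule inj_onI)
        fix a a' assume "a \<in> D" "a' \<in> D" "?h a = ?h a'"
        then show "a = a'" using mul_inv_cancel[of \<beta> a] mul_inv_cancel[of \<beta> a'] D b' by metis
      qed
    qed (use tC in auto)
    finally have "f \<beta> \<otimes>\<^bsub>St z\<^esub> act \<O> \<beta> (pair (d \<beta>) g (\<lambda>\<rho>. k (\<beta> \<cdot> \<rho>)))
        = f \<beta> \<otimes>\<^bsub>St z\<^esub> finsum (St z) (\<lambda>\<sigma>. act \<O> \<beta> (?t (?h \<sigma>))) D"
      using ring_hom_finsum[OF act_ring_hom[OF b'(1)] S.ring_axioms _ finD, of "\<lambda>\<sigma>. ?t (?h \<sigma>)"]
        b' ring_axioms tC by simp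
    also have "\<dots> = finsum (St z) (\<lambda>\<sigma>. f \<beta> \<otimes>\<^bsub>St z\<^esub> act \<O> \<beta> (?t (?h \<sigma>))) D"
      using tC act_closed[of \<beta>] b' fB by (intro finsum_rdistr[OF finD]) auto
    also have "\<dots> = finsum (St z) (\<lambda>\<sigma>. ?x \<beta> \<sigma>) D"
    proof (rule finsum_cong')
      fix \<sigma> assume "\<sigma> \<in> D"
      then have s: "\<sigma> \<in> arr" "r \<sigma> = z" using D by auto
      note 1 = inv_mul_in_arrows[of \<beta> \<sigma>] mul_inv_cancel[of \<beta> \<sigma>]
      have ks: "k \<sigma> \<in> C (d \<sigma>)" using adaptedD[OF k s] .
      have "act \<O> \<beta> (?t (?h \<sigma>)) = act \<O> \<beta> (g (?h \<sigma>)) \<otimes>\<^bsub>St z\<^esub> act \<O> \<beta> (act \<O> (?h \<sigma>) (k \<sigma>))"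
        using ring_hom_mult[OF act_ring_hom[OF b'(1)], of "g (?h \<sigma>)" "act \<O> (?h \<sigma>) (k \<sigma>)"]
          1 b' s ks act_closed[of "?h \<sigma>" "k \<sigma>"] section_in[OF g(1), of "?h \<sigma>"] by simp
      also have "act \<O> \<beta> (act \<O> (?h \<sigma>) (k \<sigma>)) = act \<O> \<sigma> (k \<sigma>)"
        using act_comp[of \<beta> "?h \<sigma>" "k \<sigma>"] 1 b' s ks by simp
      finally show "f \<beta> \<otimes>\<^bsub>St z\<^esub> act \<O> \<beta> (?t (?h \<sigma>)) = ?x \<beta> \<sigma>"
        using gD[of \<beta> \<sigma>] b' s fB[of \<beta>] actk[OF s] by (simp add: m_assoc)
    qed (use xC b in auto)
    finally show "f \<beta> \<otimes>\<^bsub>St z\<^esub> act \<O> \<beta> (pair (d \<beta>) g (\<lambda>\<rho>. k (\<beta> \<cdot> \<rho>))) = finsum (St z) (\<lambda>\<sigma>. ?x \<beta> \<sigma>) D" .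
  qed (rule refl, intro Pi_I finsum_closed, rule xC)
  finally show ?thesis .
qed

end

section \<open>Continuous sections\<close>

context groupoid_sheaf_of_rings
begin

abbreviation \<E> where "\<E> \<equiv> total \<O>"
abbreviation \<pi> where "\<pi> \<equiv> proj \<O>"

lemma in_stalk_iff: "x \<in> units \<Longrightarrow> e \<in> C x \<longleftrightarrow> e \<in> topspace \<E> \<and> \<pi> e = x"
  by (simp add: carrier_stalk)

lemma total_in_stalk: "e \<in> topspace \<E> \<Longrightarrow> e \<in> C (\<pi> e)"
  by (simp add: carrier_stalk proj_in_units)

lemma continuous_map_in_total: "continuous_map X \<E> a \<Longrightarrow> x \<in> topspace X \<Longrightarrow> a x \<in> C (\<pi> (a x))"
  using continuous_map_funspace[of X \<E> a] by (intro total_in_stalk) auto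

lemma continuous_map_proj: "continuous_map X \<E> a \<Longrightarrow> continuous_map X (unit_space \<G>) (\<lambda>x. \<pi> (a x))"
  using continuous_map_compose[OF _ local_homeomorphism_imp_continuous_map[OF local_homeomorphism_proj]]
  by (auto simp: o_def)

lemma continuous_map_fibre_product:
  assumes "continuous_map X \<E> a" "continuous_map X \<E> b"
    and "\<And>x. x \<in> topspace X \<Longrightarrow> \<pi> (a x) = \<pi> (b x)"
  shows "continuous_map X (fibre_product \<O>) (\<lambda>x. (a x, b x))"
  using assms unfolding fibre_product_def
  by (auto simp: continuous_map_in_subtopology continuous_map_paired)

lemma continuous_map_stalk_add:
  assumes "continuous_map X \<E> a" "continuous_map X \<E> b"
    and "\<And>x. x \<in> topspace X \<Longrightarrow> \<pi> (a x) = q x" "\<And>x. x \<in> topspace X \<Longrightarrow> \<pi> (b x) = q x"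
  shows "continuous_map X \<E> (\<lambda>x. a x \<oplus>\<^bsub>St (q x)\<^esub> b x)"
proof -
  have "continuous_map X \<E> (\<lambda>x. a x \<oplus>\<^bsub>St (\<pi> (a x))\<^esub> b x)"
    using continuous_map_compose[OF continuous_map_fibre_product[OF assms(1,2)] continuous_add] assms(3,4)
    by (simp add: o_def)
  then show ?thesis by (rule continuous_map_eq) (simp add: assms)
qed

lemma continuous_map_stalk_mult:
  assumes "continuous_map X \<E> a" "continuous_map X \<E> b"
    and "\<And>x. x \<in> topspace X \<Longrightarrow> \<pi> (a x) = q x" "\<And>x. x \<in> topspace X \<Longrightarrow> \<pi> (b x) = q x"
  shows "continuous_map X \<E> (\<lambda>x. a x \<otimes>\<^bsub>St (q x)\<^esub> b x)"
proof -
  have "continuous_map X \<E> (\<lambda>x. a x \<otimes>\<^bsub>St (\<pi> (a x))\<^esub> b x)"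
    using continuous_map_compose[OF continuous_map_fibre_product[OF assms(1,2)] continuous_mult] assms(3,4)
    by (simp add: o_def)
  then show ?thesis by (rule continuous_map_eq) (simp add: assms)
qed

lemma continuous_map_act:
  assumes "continuous_map X \<T> c" "continuous_map X \<E> a"
    and "\<And>x. x \<in> topspace X \<Longrightarrow> d (c x) = \<pi> (a x)"
  shows "continuous_map X \<E> (\<lambda>x. act \<O> (c x) (a x))"
proof -
  have "continuous_map X (subtopology (prod_topology \<T> \<E>) {(\<gamma>, e). d \<gamma> = \<pi> e}) (\<lambda>x. (c x, a x))"
    using assms by (auto simp: continuous_map_in_subtopology continuous_map_paired)
  from continuous_map_compose[OF this continuous_act] show ?thesis by (simp add: o_def)
qed

lemma local_section:
  assumes "x \<in> units" "e \<in> C x"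
  obtains M s where "openin (unit_space \<G>) M" "x \<in> M" "s x = e"
    "continuous_map (subtopology (unit_space \<G>) M) \<E> s" "\<And>y. y \<in> M \<Longrightarrow> \<pi> (s y) = y"
proof -
  have e: "e \<in> topspace \<E>" "\<pi> e = x" using assms by (simp_all add: in_stalk_iff)
  then obtain U where U: "openin \<E> U" "e \<in> U" "inj_on \<pi> U"
    using local_homeomorphism_injective_neighbourhood[OF local_homeomorphism_proj] by blast
  let ?s = "the_inv_into U \<pi>"
  show thesis
  proof (rule that[of "\<pi> ` U" ?s])
    show "openin (unit_space \<G>) (\<pi> ` U)"
      using local_homeomorphism_imp_open_map[OF local_homeomorphism_proj] U(1) by (simp add: open_map_def)
    show "continuous_map (subtopology (unit_space \<G>) (\<pi> ` U)) \<E> ?s"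
      by (rule local_homeomorphism_local_inverse[OF local_homeomorphism_proj U(1,3)])
    show "x \<in> \<pi> ` U" using e U(2) by blast
    show "?s x = e" using the_inv_into_f_f[OF U(3,2)] e by simp
    show "\<pi> (?s y) = y" if "y \<in> \<pi> ` U" for y using f_the_inv_into_f[OF U(3) that] .
  qed
qed

text \<open>
  Continuity of subtraction is not among the axioms of a sheaf of rings: a local section through
  \<open>a x - b x\<close>, added to \<open>b\<close>, agrees with \<open>a\<close> at \<open>x\<close> and hence near \<open>x\<close>.
\<close>

lemma continuous_map_stalk_diff:
  assumes a: "continuous_map X \<E> a" and b: "continuous_map X \<E> b"
    and qa: "\<And>x. x \<in> topspace X \<Longrightarrow> \<pi> (a x) = q x" and qb: "\<And>x. x \<in> topspace X \<Longrightarrow> \<pi> (b x) = q x"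
  shows "continuous_map X \<E> (\<lambda>x. a x \<ominus>\<^bsub>St (q x)\<^esub> b x)"
proof (rule continuous_map_locally)
  fix x assume x: "x \<in> topspace X"
  have ab: "q y \<in> units" "a y \<in> C (q y)" "b y \<in> C (q y)" if "y \<in> topspace X" for y
    using continuous_map_in_total[OF a that] continuous_map_in_total[OF b that] qa[OF that] qb[OF that]
      continuous_map_funspace[OF continuous_map_proj[OF a]] that by (auto simp: Pi_iff)
  have q: "continuous_map X (unit_space \<G>) q"
    using continuous_map_proj[OF a] by (rule continuous_map_eq) (simp add: qa)
  have "a x \<ominus>\<^bsub>St (q x)\<^esub> b x \<in> C (q x)"
    using ab[OF x] ring.ring_simprules(4)[OF ring_stalk] by metis
  then obtain M s where s: "openin (unit_space \<G>) M" "q x \<in> M" "s (q x) = a x \<ominus>\<^bsub>St (q x)\<^esub> b x"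
    "continuous_map (subtopology (unit_space \<G>) M) \<E> s" "\<And>y. y \<in> M \<Longrightarrow> \<pi> (s y) = y"
    using local_section ab(1)[OF x] by metis
  let ?N = "{y \<in> topspace X. q y \<in> M}"
  let ?X = "subtopology X ?N"
  have N: "openin X ?N" using openin_continuous_map_preimage[OF q s(1)] .
  have tX: "topspace ?X = ?N" by auto
  have "continuous_map ?X (subtopology (unit_space \<G>) M) q"
    using q by (auto simp: continuous_map_in_subtopology intro: continuous_map_from_subtopology)
  from continuous_map_compose[OF this s(4)]
  have sq: "continuous_map ?X \<E> (\<lambda>y. s (q y))" by (simp add: o_def)
  have a': "continuous_map ?X \<E> a" and b': "continuous_map ?X \<E> b"
    using a b continuous_map_from_subtopology by blast+
  have sb: "continuous_map ?X \<E> (\<lambda>y. s (q y) \<oplus>\<^bsub>St (q y)\<^esub> b y)"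
    by (rule continuous_map_stalk_add[OF sq b']) (use s(5) qb in auto)
  have sC: "s (q y) \<in> C (q y)" if "y \<in> ?N" for y
    using continuous_map_in_total[OF sq, of y] s(5)[of "q y"] that by simp
  obtain N' where N': "openin ?X N'" "x \<in> N'" "\<And>y. y \<in> N' \<Longrightarrow> s (q y) \<oplus>\<^bsub>St (q y)\<^esub> b y = a y"
  proof (rule local_homeomorphism_lifts_agree[OF local_homeomorphism_proj sb a'])
    fix y assume y: "y \<in> topspace ?X"
    then have "q y \<in> units" "s (q y) \<oplus>\<^bsub>St (q y)\<^esub> b y \<in> C (q y)"
      using ab[of y] sC[of y] ring.ring_simprules(1)[OF ring_stalk] by auto
    then show "\<pi> (s (q y) \<oplus>\<^bsub>St (q y)\<^esub> b y) = \<pi> (a y)"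
      using y qa[of y] by (simp add: in_stalk_iff)
  next
    interpret ring "St (q x)" using ring_stalk ab[OF x] by simp
    show "s (q x) \<oplus>\<^bsub>St (q x)\<^esub> b x = a x"
      using ab[OF x] s(3) by (simp add: minus_eq a_assoc l_neg)
  qed (use x s(2) that in auto)
  have N'N: "N' \<subseteq> ?N" using openin_subset[OF N'(1)] tX by simp
  have "a y \<ominus>\<^bsub>St (q y)\<^esub> b y = s (q y)" if "y \<in> N'" for y
  proof -
    have y: "y \<in> topspace X" "y \<in> ?N" using that N'N by auto
    interpret ring "St (q y)" using ring_stalk ab[OF y(1)] by simp
    show ?thesis
      using N'(3)[OF that] ab[OF y(1)] sC[OF y(2)] by (metis minus_eq a_assoc r_neg r_zero a_inv_closed)
  qed
  moreover have "openin X N'" using N N'(1) openin_trans_full by blast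
  moreover have "continuous_map (subtopology X N') \<E> (\<lambda>y. s (q y))"
    using continuous_map_from_subtopology_mono[OF sq N'N] .
  ultimately show "\<exists>N g. openin X N \<and> x \<in> N \<and> continuous_map (subtopology X N) \<E> g \<and>
      (\<forall>y\<in>N. a y \<ominus>\<^bsub>St (q y)\<^esub> b y = g y)"
    using N'(2) by blast
qed

lemma one_in_stalk: "x \<in> units \<Longrightarrow> \<one>\<^bsub>St x\<^esub> \<in> C x"
  using ring.ring_simprules(6)[OF ring_stalk] .

lemma zero_in_stalk: "x \<in> units \<Longrightarrow> \<zero>\<^bsub>St x\<^esub> \<in> C x"
  using ring.ring_simprules(2)[OF ring_stalk] .

lemma proj_one: "x \<in> units \<Longrightarrow> \<pi> \<one>\<^bsub>St x\<^esub> = x"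
  using one_in_stalk in_stalk_iff by simp

lemma proj_zero: "x \<in> units \<Longrightarrow> \<pi> \<zero>\<^bsub>St x\<^esub> = x"
  using zero_in_stalk in_stalk_iff by simp

lemma continuous_zero: "continuous_map (unit_space \<G>) \<E> (\<lambda>x. \<zero>\<^bsub>St x\<^esub>)"
proof (rule continuous_map_eq)
  show "continuous_map (unit_space \<G>) \<E> (\<lambda>x. \<one>\<^bsub>St x\<^esub> \<ominus>\<^bsub>St x\<^esub> \<one>\<^bsub>St x\<^esub>)"
    by (intro continuous_map_stalk_diff continuous_one) (simp_all add: proj_one)
  show "\<one>\<^bsub>St x\<^esub> \<ominus>\<^bsub>St x\<^esub> \<one>\<^bsub>St x\<^esub> = \<zero>\<^bsub>St x\<^esub>" if "x \<in> topspace (unit_space \<G>)" for x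
  proof -
    interpret ring "St x" using ring_stalk that by simp
    show ?thesis by (simp add: minus_eq r_neg)
  qed
qed

lemma section_proj: "f \<in> carrier \<S> \<Longrightarrow> \<gamma> \<in> arr \<Longrightarrow> \<pi> (f \<gamma>) = r \<gamma>"
  using in_stalk_iff section_in ran_in_units by metis

definition bisection_section_on :: "'a set \<Rightarrow> ('a \<Rightarrow> 'b) \<Rightarrow> bool" where
  "bisection_section_on U f \<longleftrightarrow> compact_open_bisection U \<and> f \<in> carrier \<S> \<and>
     continuous_map (subtopology \<T> U) \<E> f \<and> (\<forall>\<gamma>\<in>arr - U. f \<gamma> = \<zero>\<^bsub>St (r \<gamma>)\<^esub>)"

lemma bisection_section_onD:
  assumes "bisection_section_on U f"
  shows "compact_open_bisection U" "openin \<T> U" "bisection \<G> U" "U \<subseteq> arr" "f \<in> carrier \<S>"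
    "continuous_map (subtopology \<T> U) \<E> f"
    "\<And>\<gamma>. \<gamma> \<in> arr \<Longrightarrow> \<gamma> \<notin> U \<Longrightarrow> f \<gamma> = \<zero>\<^bsub>St (r \<gamma>)\<^esub>"
  using assms unfolding bisection_section_on_def compact_open_bisection_def bisection_def by auto

lemma bisection_section_fibre_finite:
  assumes "bisection_section_on U f"
  shows "fibre_finite f"
  unfolding fibre_finite_def
proof
  note U = bisection_section_onD[OF assms]
  fix z assume "z \<in> units"
  have "inj_on r {\<sigma> \<in> arr. r \<sigma> = z \<and> f \<sigma> \<noteq> \<zero>\<^bsub>St z\<^esub>}"
  proof (rule inj_on_subset)
    show "inj_on r U" using U(3) by (simp add: bisection_def)
    show "{\<sigma> \<in> arr. r \<sigma> = z \<and> f \<sigma> \<noteq> \<zero>\<^bsub>St z\<^esub>} \<subseteq> U"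
    proof
      fix \<sigma> assume "\<sigma> \<in> {\<sigma> \<in> arr. r \<sigma> = z \<and> f \<sigma> \<noteq> \<zero>\<^bsub>St z\<^esub>}"
      then show "\<sigma> \<in> U" using U(7)[of \<sigma>] by (cases "\<sigma> \<in> U") auto
    qed
  qed
  moreover have "r ` {\<sigma> \<in> arr. r \<sigma> = z \<and> f \<sigma> \<noteq> \<zero>\<^bsub>St z\<^esub>} \<subseteq> {z}" by auto
  ultimately show "finite {\<sigma> \<in> arr. r \<sigma> = z \<and> f \<sigma> \<noteq> \<zero>\<^bsub>St z\<^esub>}"
    using finite_subset finite_imageD by blast
qed

lemma bisection_section_inv:
  assumes "bisection_section_on U f"
  shows "bisection_section_on U (inv\<^bsub>\<S>\<^esub> f)"
proof -
  note U = bisection_section_onD[OF assms]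
  let ?X = "subtopology \<T> U"
  have tX: "topspace ?X = U" using U(4) by auto
  have cr: "continuous_map ?X (unit_space \<G>) r"
    using continuous_map_from_subtopology[OF continuous_map_ran] .
  from continuous_map_compose[OF this continuous_zero]
  have c0: "continuous_map ?X \<E> (\<lambda>\<gamma>. \<zero>\<^bsub>St (r \<gamma>)\<^esub>)" by (simp add: o_def)
  have "continuous_map ?X \<E> (\<lambda>\<gamma>. \<zero>\<^bsub>St (r \<gamma>)\<^esub> \<ominus>\<^bsub>St (r \<gamma>)\<^esub> f \<gamma>)"
    by (rule continuous_map_stalk_diff[OF c0 U(6)]) (use tX U(4) in \<open>auto simp: proj_zero section_proj[OF U(5)] subset_iff\<close>)
  moreover have eq: "\<zero>\<^bsub>St (r \<gamma>)\<^esub> \<ominus>\<^bsub>St (r \<gamma>)\<^esub> f \<gamma> = (inv\<^bsub>\<S>\<^esub> f) \<gamma>" if "\<gamma> \<in> arr" for \<gamma>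
  proof -
    interpret ring "St (r \<gamma>)" using ring_stalk that by simp
    show ?thesis using section_inv[OF U(5) that] section_in[OF U(5) that refl] by (simp add: minus_eq)
  qed
  ultimately have "continuous_map ?X \<E> (inv\<^bsub>\<S>\<^esub> f)"
    by (rule continuous_map_eq) (use tX U(4) in auto)
  moreover have "(inv\<^bsub>\<S>\<^esub> f) \<gamma> = \<zero>\<^bsub>St (r \<gamma>)\<^esub>" if "\<gamma> \<in> arr - U" for \<gamma>
  proof -
    interpret ring "St (r \<gamma>)" using ring_stalk that by simp
    show ?thesis using section_inv[OF U(5), of \<gamma>] U(7)[of \<gamma>] that by simp
  qed
  ultimately show ?thesis
    unfolding bisection_section_on_def using U(1,5) sections.inv_closed by blast
qed

lemma bisection_section_cut:
  assumes W: "compact_open_bisection W" and s: "continuous_map (subtopology \<T> W) \<E> s"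
    and p: "\<And>\<gamma>. \<gamma> \<in> W \<Longrightarrow> \<pi> (s \<gamma>) = r \<gamma>"
  shows "bisection_section_on W (\<lambda>\<gamma>\<in>arr. if \<gamma> \<in> W then s \<gamma> else \<zero>\<^bsub>St (r \<gamma>)\<^esub>)" (is "bisection_section_on W ?h")
proof -
  have WA: "W \<subseteq> arr" using W by (simp add: compact_open_bisection_def bisection_def)
  then have tW: "topspace (subtopology \<T> W) = W" by auto
  have sC: "s \<gamma> \<in> C (r \<gamma>)" if "\<gamma> \<in> W" for \<gamma>
    using continuous_map_in_total[OF s, of \<gamma>] p[OF that] tW that WA by auto
  have "?h \<in> carrier \<S>"
    unfolding section_iff using sC zero_in_stalk by auto
  moreover have "continuous_map (subtopology \<T> W) \<E> ?h"
    using s by (rule continuous_map_eq) (use WA in auto)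
  ultimately show ?thesis
    unfolding bisection_section_on_def using W by auto
qed

lemma bisection_section_one:
  assumes W: "compact_open_bisection W"
  shows "bisection_section_on W (\<lambda>\<gamma>\<in>arr. if \<gamma> \<in> W then \<one>\<^bsub>St (r \<gamma>)\<^esub> else \<zero>\<^bsub>St (r \<gamma>)\<^esub>)"
proof (rule bisection_section_cut[OF W])
  have WA: "W \<subseteq> arr" using W by (simp add: compact_open_bisection_def bisection_def)
  show "continuous_map (subtopology \<T> W) \<E> (\<lambda>\<gamma>. \<one>\<^bsub>St (r \<gamma>)\<^esub>)"
    using continuous_map_compose[OF continuous_map_from_subtopology[OF continuous_map_ran] continuous_one]
    by (simp add: o_def)
  show "\<pi> \<one>\<^bsub>St (r \<gamma>)\<^esub> = r \<gamma>" if "\<gamma> \<in> W" for \<gamma>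
    using that WA by (auto simp: proj_one subset_iff)
qed

end

locale ample_sheaf_of_rings = ample_groupoid \<G> + groupoid_sheaf_of_rings \<G> \<O>
  for \<G> :: "'g groupoid" and \<O> :: "('g, 'e) ring_sheaf"
begin

lemma bisection_sections_iff: "f \<in> bisection_sections \<G> \<O> \<longleftrightarrow> (\<exists>U. bisection_section_on U f)"
  unfolding bisection_sections_def bisection_section_on_def compact_open_bisection_def
    compact_Hausdorff_in_def using bisection_Hausdorff by blast

lemma bisection_section_through:
  assumes \<gamma>: "\<gamma> \<in> arr" and e: "e \<in> C (r \<gamma>)" and N: "openin (unit_space \<G>) N" "d \<gamma> \<in> N"
  obtains W h where "bisection_section_on W h" "\<gamma> \<in> W" "d ` W \<subseteq> N" "h \<gamma> = e"
proof -
  obtain M s where s: "openin (unit_space \<G>) M" "r \<gamma> \<in> M" "s (r \<gamma>) = e"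
    "continuous_map (subtopology (unit_space \<G>) M) \<E> s" "\<And>y. y \<in> M \<Longrightarrow> \<pi> (s y) = y"
    using local_section[OF ran_in_units[OF \<gamma>] e] by metis
  obtain W where W: "compact_open_bisection W" "\<gamma> \<in> W" "d ` W \<subseteq> N" "r ` W \<subseteq> M"
    using compact_open_bisection_neighbourhood[OF \<gamma> N s(1,2)] by metis
  have "continuous_map (subtopology \<T> W) (subtopology (unit_space \<G>) M) r"
    using W(4) continuous_map_from_subtopology[OF continuous_map_ran, of W]
    by (auto simp: continuous_map_in_subtopology)
  from continuous_map_compose[OF this s(4)]
  have "continuous_map (subtopology \<T> W) \<E> (\<lambda>\<gamma>. s (r \<gamma>))" by (simp add: o_def)
  from bisection_section_cut[OF W(1) this]
  have "bisection_section_on W (\<lambda>\<gamma>\<in>arr. if \<gamma> \<in> W then s (r \<gamma>) else \<zero>\<^bsub>St (r \<gamma>)\<^esub>)"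
    using W(4) s(5) by blast
  then show thesis using that[of W] W s(3) \<gamma> by simp
qed

lemma bisection_section_convolution:
  assumes f: "bisection_section_on U f" and g: "bisection_section_on V g"
  obtains W where "bisection_section_on W (convolution \<G> \<O> f g)"
proof -
  note U = bisection_section_onD[OF f] and V = bisection_section_onD[OF g]
  note ff = bisection_section_fibre_finite[OF f]
  define W where "W = {\<gamma> \<in> arr. r \<gamma> \<in> r ` U \<and> gi (lift U (r \<gamma>)) \<cdot> \<gamma> \<in> V}"
  note W = compact_open_bisection_mul[OF U(1) V(1), folded W_def]
  have WA: "W \<subseteq> arr" unfolding W_def by blast
  then have tW: "topspace (subtopology \<T> W) = W" by auto
  have lU: "lift U (r \<gamma>) \<in> U \<and> r (lift U (r \<gamma>)) = r \<gamma>" if "r \<gamma> \<in> r ` U" for \<gamma>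
    using that lift_ran[OF U(3)] by force
  have zero: "f \<sigma> \<otimes>\<^bsub>St (r \<gamma>)\<^esub> act \<O> \<sigma> (g (gi \<sigma> \<cdot> \<gamma>)) = \<zero>\<^bsub>St (r \<gamma>)\<^esub>"
    if s: "\<sigma> \<in> arr" "r \<sigma> = r \<gamma>" "\<gamma> \<in> arr" "\<gamma> \<notin> W \<or> \<sigma> \<noteq> lift U (r \<gamma>)" for \<sigma> \<gamma>
  proof -
    interpret ring "St (r \<gamma>)" using ring_stalk s by simp
    note 1 = inv_mul_in_arrows[OF s(1,3,2)]
    show ?thesis
    proof (cases "\<sigma> \<in> U")
      case True
      then have "lift U (r \<gamma>) = \<sigma>" using lift_ran[OF U(3)] s(2) by blast
      moreover from True have "r \<gamma> \<in> r ` U" using s(2) by (metis imageI)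
      ultimately have "gi \<sigma> \<cdot> \<gamma> \<notin> V" using s unfolding W_def by auto
      then have "g (gi \<sigma> \<cdot> \<gamma>) = \<zero>\<^bsub>St (d \<sigma>)\<^esub>" using V(7)[of "gi \<sigma> \<cdot> \<gamma>"] 1 by simp
      then show ?thesis using act_zero[OF s(1)] section_in[OF U(5) s(1,2)] s(2) by simp
    next
      case False
      then show ?thesis
        using U(7)[OF s(1)] s(2) act_closed[OF s(1), of "g (gi \<sigma> \<cdot> \<gamma>)"] section_in[OF V(5) 1(1,2)] by simp
    qed
  qed
  have off: "convolution \<G> \<O> f g \<gamma> = \<zero>\<^bsub>St (r \<gamma>)\<^esub>" if "\<gamma> \<in> arr - W" for \<gamma>
    using that zero convolution_eq_pair[OF U(5) ff V(5)] by (simp add: pair_eq_zero)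
  have on: "convolution \<G> \<O> f g \<gamma>
      = f (lift U (r \<gamma>)) \<otimes>\<^bsub>St (r \<gamma>)\<^esub> act \<O> (lift U (r \<gamma>)) (g (gi (lift U (r \<gamma>)) \<cdot> \<gamma>))"
    if g: "\<gamma> \<in> W" for \<gamma>
  proof -
    have "\<gamma> \<in> arr" "lift U (r \<gamma>) \<in> arr" "r (lift U (r \<gamma>)) = r \<gamma>"
      using g lU[of \<gamma>] U(4) unfolding W_def by auto
    then show ?thesis
      using zero convolution_eq_pair[OF U(5) ff V(5)] adapted_translate[OF V(5)]
      by (simp add: pair_single[OF U(5) ff])
  qed
  have "continuous_map (subtopology \<T> W) (subtopology \<T> U) (\<lambda>\<gamma>. lift U (r \<gamma>))"
    using W(2) lU tW unfolding continuous_map_in_subtopology W_def by auto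
  from continuous_map_compose[OF this U(6)]
  have 1: "continuous_map (subtopology \<T> W) \<E> (\<lambda>\<gamma>. f (lift U (r \<gamma>)))" by (simp add: o_def)
  have "continuous_map (subtopology \<T> W) (subtopology \<T> V) (\<lambda>\<gamma>. gi (lift U (r \<gamma>)) \<cdot> \<gamma>)"
    using W(3) tW unfolding continuous_map_in_subtopology W_def by auto
  from continuous_map_compose[OF this V(6)]
  have 2: "continuous_map (subtopology \<T> W) \<E> (\<lambda>\<gamma>. g (gi (lift U (r \<gamma>)) \<cdot> \<gamma>))" by (simp add: o_def)
  have pg: "\<pi> (g (gi (lift U (r \<gamma>)) \<cdot> \<gamma>)) = d (lift U (r \<gamma>))"
    and lA: "lift U (r \<gamma>) \<in> arr" "r (lift U (r \<gamma>)) = r \<gamma>"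
    and gC: "g (gi (lift U (r \<gamma>)) \<cdot> \<gamma>) \<in> C (d (lift U (r \<gamma>)))" if "\<gamma> \<in> W" for \<gamma>
  proof -
    have "\<gamma> \<in> arr" and l: "lift U (r \<gamma>) \<in> arr" "r (lift U (r \<gamma>)) = r \<gamma>"
      using that lU[of \<gamma>] U(4) unfolding W_def by auto
    note i = inv_mul_in_arrows[OF l(1) this(1) l(2)]
    show "\<pi> (g (gi (lift U (r \<gamma>)) \<cdot> \<gamma>)) = d (lift U (r \<gamma>))"
      using section_proj[OF V(5) i(1)] i(2) by simp
    show "g (gi (lift U (r \<gamma>)) \<cdot> \<gamma>) \<in> C (d (lift U (r \<gamma>)))"
      using section_in[OF V(5) i(1,2)] .
    show "lift U (r \<gamma>) \<in> arr" "r (lift U (r \<gamma>)) = r \<gamma>" using l by auto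
  qed
  have 3: "continuous_map (subtopology \<T> W) \<E> (\<lambda>\<gamma>. act \<O> (lift U (r \<gamma>)) (g (gi (lift U (r \<gamma>)) \<cdot> \<gamma>)))"
    by (rule continuous_map_act[OF W(2) 2]) (use pg tW in simp)
  have "continuous_map (subtopology \<T> W) \<E> (\<lambda>\<gamma>. f (lift U (r \<gamma>)) \<otimes>\<^bsub>St (r \<gamma>)\<^esub>
      act \<O> (lift U (r \<gamma>)) (g (gi (lift U (r \<gamma>)) \<cdot> \<gamma>)))"
  proof (rule continuous_map_stalk_mult[OF 1 3])
    fix \<gamma> assume "\<gamma> \<in> topspace (subtopology \<T> W)"
    then have g: "\<gamma> \<in> W" using tW by simp
    show "\<pi> (f (lift U (r \<gamma>))) = r \<gamma>"
      using section_proj[OF U(5) lA(1)[OF g]] lA(2)[OF g] by simp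
    show "\<pi> (act \<O> (lift U (r \<gamma>)) (g (gi (lift U (r \<gamma>)) \<cdot> \<gamma>))) = r \<gamma>"
      using act_closed[OF lA(1)[OF g] gC[OF g]] lA[OF g] in_stalk_iff ran_in_units by metis
  qed
  then have "continuous_map (subtopology \<T> W) \<E> (convolution \<G> \<O> f g)"
    by (rule continuous_map_eq) (use on tW in simp)
  then show thesis
    using that[of W] W(1) off convolution_section[OF U(5) ff V(5)]
    unfolding bisection_section_on_def by blast
qed

lemma unit_supported_fibre_finite:
  assumes "\<And>\<gamma>. \<gamma> \<in> arr \<Longrightarrow> \<gamma> \<notin> units \<Longrightarrow> a \<gamma> = \<zero>\<^bsub>St (r \<gamma>)\<^esub>"
  shows "fibre_finite a"
  unfolding fibre_finite_def
proof
  fix z assume "z \<in> units"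
  have "{\<sigma> \<in> arr. r \<sigma> = z \<and> a \<sigma> \<noteq> \<zero>\<^bsub>St z\<^esub>} \<subseteq> {z}"
  proof
    fix \<sigma> assume "\<sigma> \<in> {\<sigma> \<in> arr. r \<sigma> = z \<and> a \<sigma> \<noteq> \<zero>\<^bsub>St z\<^esub>}"
    then show "\<sigma> \<in> {z}" using assms[of \<sigma>] by (cases "\<sigma> \<in> units") auto
  qed
  then show "finite {\<sigma> \<in> arr. r \<sigma> = z \<and> a \<sigma> \<noteq> \<zero>\<^bsub>St z\<^esub>}"
    using finite_subset by blast
qed

lemma convolution_unit_left:
  assumes a: "a \<in> carrier \<S>" "\<And>\<gamma>. \<gamma> \<in> arr \<Longrightarrow> \<gamma> \<notin> units \<Longrightarrow> a \<gamma> = \<zero>\<^bsub>St (r \<gamma>)\<^esub>"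
    and f: "f \<in> carrier \<S>" and \<gamma>: "\<gamma> \<in> arr"
  shows "convolution \<G> \<O> a f \<gamma> = a (r \<gamma>) \<otimes>\<^bsub>St (r \<gamma>)\<^esub> f \<gamma>"
proof -
  interpret ring "St (r \<gamma>)" using ring_stalk \<gamma> by simp
  have ff: "fibre_finite a" using a(2) by (rule unit_supported_fibre_finite)
  have "convolution \<G> \<O> a f \<gamma>
      = a (r \<gamma>) \<otimes>\<^bsub>St (r \<gamma>)\<^esub> act \<O> (r \<gamma>) (f (gi (r \<gamma>) \<cdot> \<gamma>))"
    unfolding convolution_eq_pair[OF a(1) ff f \<gamma>]
  proof (rule pair_single[OF a(1) ff adapted_translate[OF f \<gamma> refl]])
    fix \<sigma> assume s: "\<sigma> \<in> arr" "r \<sigma> = r \<gamma>" "\<sigma> \<noteq> r \<gamma>"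
    then have "\<sigma> \<notin> units" by auto
    then have "a \<sigma> = \<zero>\<^bsub>St (r \<gamma>)\<^esub>" using a(2)[OF s(1)] s(2) by simp
    moreover have "act \<O> \<sigma> (f (gi \<sigma> \<cdot> \<gamma>)) \<in> C (r \<gamma>)"
      using act_closed[OF s(1) adaptedD[OF adapted_translate[OF f \<gamma> refl] s(1,2)]] s(2) by simp
    ultimately show "a \<sigma> \<otimes>\<^bsub>St (r \<gamma>)\<^esub> act \<O> \<sigma> (f (gi \<sigma> \<cdot> \<gamma>)) = \<zero>\<^bsub>St (r \<gamma>)\<^esub>" by simp
  qed (use \<gamma> in auto)
  also have "act \<O> (r \<gamma>) (f (gi (r \<gamma>) \<cdot> \<gamma>)) = f \<gamma>"
    using \<gamma> act_id[of "r \<gamma>" "f \<gamma>"] section_in[OF f \<gamma> refl] by (simp add: inv_unit)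
  finally show ?thesis .
qed

lemma convolution_unit_right:
  assumes a: "a \<in> carrier \<S>" "\<And>\<gamma>. \<gamma> \<in> arr \<Longrightarrow> \<gamma> \<notin> units \<Longrightarrow> a \<gamma> = \<zero>\<^bsub>St (r \<gamma>)\<^esub>"
    and f: "f \<in> carrier \<S>" "fibre_finite f" and \<gamma>: "\<gamma> \<in> arr"
  shows "convolution \<G> \<O> f a \<gamma> = f \<gamma> \<otimes>\<^bsub>St (r \<gamma>)\<^esub> act \<O> \<gamma> (a (d \<gamma>))"
proof -
  interpret ring "St (r \<gamma>)" using ring_stalk \<gamma> by simp
  have "convolution \<G> \<O> f a \<gamma> = f \<gamma> \<otimes>\<^bsub>St (r \<gamma>)\<^esub> act \<O> \<gamma> (a (gi \<gamma> \<cdot> \<gamma>))"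
    unfolding convolution_eq_pair[OF f a(1) \<gamma>]
  proof (rule pair_single[OF f adapted_translate[OF a(1) \<gamma> refl]])
    fix \<sigma> assume s: "\<sigma> \<in> arr" "r \<sigma> = r \<gamma>" "\<sigma> \<noteq> \<gamma>"
    note i = inv_mul_in_arrows[OF s(1) \<gamma> s(2)]
    have "gi \<sigma> \<cdot> \<gamma> \<notin> units"
    proof
      assume u: "gi \<sigma> \<cdot> \<gamma> \<in> units"
      then have "gi \<sigma> \<cdot> \<gamma> = d \<sigma>" using i(2) by (metis ran_unit)
      then have "\<sigma> = \<gamma>" using mul_inv_cancel[OF s(1) \<gamma> s(2)] s(1) by simp
      with s(3) show False by simp
    qed
    then have "a (gi \<sigma> \<cdot> \<gamma>) = \<zero>\<^bsub>St (d \<sigma>)\<^esub>" using a(2)[OF i(1)] i(2) by simp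
    then show "f \<sigma> \<otimes>\<^bsub>St (r \<gamma>)\<^esub> act \<O> \<sigma> (a (gi \<sigma> \<cdot> \<gamma>)) = \<zero>\<^bsub>St (r \<gamma>)\<^esub>"
      using act_zero[OF s(1)] section_in[OF f(1) s(1,2)] s(2) by simp
  qed (use \<gamma> in auto)
  then show ?thesis by (simp add: inv_mul)
qed

end

section \<open>The convolution ring\<close>

text \<open>The double centralizer of the commuting set \<open>insert f A\<close> is a commutative subring.\<close>

lemma maximal_commutative_subring_centralizer:
  assumes R: "abelian_group R"
    and closed: "\<And>x y. x \<in> carrier R \<Longrightarrow> y \<in> carrier R \<Longrightarrow> x \<otimes>\<^bsub>R\<^esub> y \<in> carrier R"
    and assoc: "\<And>x y z. x \<in> carrier R \<Longrightarrow> y \<in> carrier R \<Longrightarrow> z \<in> carrier R \<Longrightarrow>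
      x \<otimes>\<^bsub>R\<^esub> y \<otimes>\<^bsub>R\<^esub> z = x \<otimes>\<^bsub>R\<^esub> (y \<otimes>\<^bsub>R\<^esub> z)"
    and ldistr: "\<And>x y z. x \<in> carrier R \<Longrightarrow> y \<in> carrier R \<Longrightarrow> z \<in> carrier R \<Longrightarrow>
      (x \<oplus>\<^bsub>R\<^esub> y) \<otimes>\<^bsub>R\<^esub> z = x \<otimes>\<^bsub>R\<^esub> z \<oplus>\<^bsub>R\<^esub> y \<otimes>\<^bsub>R\<^esub> z"
    and rdistr: "\<And>x y z. x \<in> carrier R \<Longrightarrow> y \<in> carrier R \<Longrightarrow> z \<in> carrier R \<Longrightarrow>
      x \<otimes>\<^bsub>R\<^esub> (y \<oplus>\<^bsub>R\<^esub> z) = x \<otimes>\<^bsub>R\<^esub> y \<oplus>\<^bsub>R\<^esub> x \<otimes>\<^bsub>R\<^esub> z"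
    and max: "maximal_commutative_subring A R"
    and f: "f \<in> carrier R" and comm: "\<And>a. a \<in> A \<Longrightarrow> a \<otimes>\<^bsub>R\<^esub> f = f \<otimes>\<^bsub>R\<^esub> a"
  shows "f \<in> A"
proof -
  interpret abelian_group R by fact
  define cen where "cen S = {x \<in> carrier R. \<forall>s\<in>S. x \<otimes>\<^bsub>R\<^esub> s = s \<otimes>\<^bsub>R\<^esub> x}" for S
  have cA: "subgroup A (add_monoid R)" "\<And>a b. a \<in> A \<Longrightarrow> b \<in> A \<Longrightarrow> a \<otimes>\<^bsub>R\<^esub> b = b \<otimes>\<^bsub>R\<^esub> a"
    using max unfolding maximal_commutative_subring_def commutative_subring_def nonunital_subring_def
    by blast+
  have A: "A \<subseteq> carrier R" using subgroup.subset[OF cA(1)] by simp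
  have lz: "\<zero>\<^bsub>R\<^esub> \<otimes>\<^bsub>R\<^esub> x = \<zero>\<^bsub>R\<^esub>" and rz: "x \<otimes>\<^bsub>R\<^esub> \<zero>\<^bsub>R\<^esub> = \<zero>\<^bsub>R\<^esub>" if "x \<in> carrier R" for x
    using that ldistr[of "\<zero>\<^bsub>R\<^esub>" "\<zero>\<^bsub>R\<^esub>" x] rdistr[of x "\<zero>\<^bsub>R\<^esub>" "\<zero>\<^bsub>R\<^esub>"] closed[of "\<zero>\<^bsub>R\<^esub>" x] closed[of x "\<zero>\<^bsub>R\<^esub>"]
    by simp_all
  have ln: "\<ominus>\<^bsub>R\<^esub> x \<otimes>\<^bsub>R\<^esub> y = \<ominus>\<^bsub>R\<^esub> (x \<otimes>\<^bsub>R\<^esub> y)" and rn: "y \<otimes>\<^bsub>R\<^esub> (\<ominus>\<^bsub>R\<^esub> x) = \<ominus>\<^bsub>R\<^esub> (y \<otimes>\<^bsub>R\<^esub> x)"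
    if "x \<in> carrier R" "y \<in> carrier R" for x y
    using that ldistr[of "\<ominus>\<^bsub>R\<^esub> x" x y] rdistr[of y "\<ominus>\<^bsub>R\<^esub> x" x] lz[of y] rz[of y]
    by (auto intro!: minus_equality[symmetric] closed simp: l_neg)
  have cen_subring: "nonunital_subring (cen S) R" if S: "S \<subseteq> carrier R" for S
    unfolding nonunital_subring_def
  proof (intro conjI ballI)
    show "subgroup (cen S) (add_monoid R)"
    proof (rule add.subgroupI)
      show "cen S \<noteq> {}" using S lz rz by (auto simp: cen_def intro!: exI[of _ "\<zero>\<^bsub>R\<^esub>"])
      show "\<ominus>\<^bsub>R\<^esub> a \<in> cen S" if "a \<in> cen S" for a
        using that S ln rn by (auto simp: cen_def subset_iff)
      show "a \<oplus>\<^bsub>R\<^esub> b \<in> cen S" if "a \<in> cen S" "b \<in> cen S" for a b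
        using that S ldistr rdistr by (auto simp: cen_def subset_iff)
    qed (auto simp: cen_def)
    show "x \<otimes>\<^bsub>R\<^esub> y \<in> cen S" if x: "x \<in> cen S" and y: "y \<in> cen S" for x y
      unfolding cen_def
    proof (intro CollectI conjI ballI)
      show "x \<otimes>\<^bsub>R\<^esub> y \<in> carrier R" using x y closed by (auto simp: cen_def)
      fix s assume s: "s \<in> S"
      then have c: "x \<in> carrier R" "y \<in> carrier R" "s \<in> carrier R" "x \<otimes>\<^bsub>R\<^esub> s = s \<otimes>\<^bsub>R\<^esub> x" "y \<otimes>\<^bsub>R\<^esub> s = s \<otimes>\<^bsub>R\<^esub> y"
        using x y S by (auto simp: cen_def)
      have "x \<otimes>\<^bsub>R\<^esub> y \<otimes>\<^bsub>R\<^esub> s = x \<otimes>\<^bsub>R\<^esub> (s \<otimes>\<^bsub>R\<^esub> y)" using c assoc by simp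
      also have "\<dots> = s \<otimes>\<^bsub>R\<^esub> x \<otimes>\<^bsub>R\<^esub> y" using c assoc by metis
      finally show "x \<otimes>\<^bsub>R\<^esub> y \<otimes>\<^bsub>R\<^esub> s = s \<otimes>\<^bsub>R\<^esub> (x \<otimes>\<^bsub>R\<^esub> y)" using c assoc by simp
    qed
  qed
  define S where "S = insert f A"
  have SR: "S \<subseteq> carrier R" using A f unfolding S_def by simp
  have SS: "S \<subseteq> cen S" using cA(2) comm SR unfolding S_def cen_def by auto
  let ?B = "cen (cen S)"
  have BS: "?B \<subseteq> cen S" using SS unfolding cen_def by blast
  have "commutative_subring ?B R"
    unfolding commutative_subring_def
  proof (intro conjI ballI)
    show "nonunital_subring ?B R" by (rule cen_subring) (auto simp: cen_def)
    show "x \<otimes>\<^bsub>R\<^esub> y = y \<otimes>\<^bsub>R\<^esub> x" if "x \<in> ?B" "y \<in> ?B" for x y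
    proof -
      have "y \<in> cen S" using that(2) BS by blast
      then show ?thesis using that(1) unfolding cen_def[of "cen S"] by simp
    qed
  qed
  moreover have SB: "S \<subseteq> ?B" using SR unfolding cen_def by auto
  ultimately have "?B = A"
    using max SB unfolding maximal_commutative_subring_def S_def by auto
  then show ?thesis using SB unfolding S_def by auto
qed

context groupoid_sheaf_of_rings
begin

definition point_section :: "'a \<Rightarrow> 'b \<Rightarrow> 'a \<Rightarrow> 'b" where
  "point_section y e = (\<lambda>x. if x = y then e else \<zero>\<^bsub>St x\<^esub>)"

definition unit_section :: "('a \<Rightarrow> 'b) \<Rightarrow> bool" where
  "unit_section v \<longleftrightarrow> (\<forall>x\<in>units. v x \<in> C x)"

definition module_act :: "('a \<Rightarrow> 'b) \<Rightarrow> ('a \<Rightarrow> 'b) \<Rightarrow> 'a \<Rightarrow> 'b" where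
  "module_act f v = (\<lambda>z. pair z f (\<lambda>\<sigma>. v (d \<sigma>)))"

lemma point_section_unit_section: "e \<in> C y \<Longrightarrow> unit_section (point_section y e)"
  by (simp add: unit_section_def point_section_def zero_in_stalk)

lemma adapted_dom: "unit_section v \<Longrightarrow> adapted z (\<lambda>\<sigma>. v (d \<sigma>))"
  by (simp add: unit_section_def adapted_def)

lemma module_act_unit_section:
  "f \<in> carrier \<S> \<Longrightarrow> unit_section v \<Longrightarrow> unit_section (module_act f v)"
  using pair_closed adapted_dom by (simp add: unit_section_def module_act_def)

lemma module_act_convolution:
  assumes "f \<in> carrier \<S>" "fibre_finite f" "g \<in> carrier \<S>" "fibre_finite g"
    and v: "unit_section v" and z: "z \<in> units"
  shows "module_act (convolution \<G> \<O> f g) v z = module_act f (module_act g v) z"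
proof -
  have "adapted z (\<lambda>\<beta>. pair (d \<beta>) g (\<lambda>\<rho>. v (d (\<beta> \<cdot> \<rho>))) )"
    unfolding adapted_def
  proof (intro ballI impI)
    fix \<beta> assume "\<beta> \<in> arr" "r \<beta> = z"
    moreover from this have "adapted (d \<beta>) (\<lambda>\<rho>. v (d (\<beta> \<cdot> \<rho>)))"
      using v by (auto simp: adapted_def unit_section_def dom_mul_eq)
    ultimately show "pair (d \<beta>) g (\<lambda>\<rho>. v (d (\<beta> \<cdot> \<rho>))) \<in> C (d \<beta>)"
      using assms pair_closed by simp
  qed
  moreover have "pair (d \<beta>) g (\<lambda>\<rho>. v (d (\<beta> \<cdot> \<rho>))) = pair (d \<beta>) g (\<lambda>\<rho>. v (d \<rho>))"
    if "\<beta> \<in> arr" for \<beta>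
    by (rule pair_cong[symmetric]) (use that assms adapted_dom[OF v] in \<open>auto simp: dom_mul_eq\<close>)
  ultimately have "pair z f (\<lambda>\<beta>. pair (d \<beta>) g (\<lambda>\<rho>. v (d (\<beta> \<cdot> \<rho>))))
      = pair z f (\<lambda>\<beta>. pair (d \<beta>) g (\<lambda>\<rho>. v (d \<rho>)))"
    by (intro pair_cong[OF assms(1) _ z]) blast+
  then show ?thesis
    unfolding module_act_def
    using pair_convolution[OF assms(1-4) adapted_dom[OF v] z] by simp
qed

lemma fibre_finite_add:
  assumes "fibre_finite f" "fibre_finite g"
  shows "fibre_finite (f \<otimes>\<^bsub>\<S>\<^esub> g)"
  unfolding fibre_finite_def
proof
  fix z assume z: "z \<in> units"
  have "{\<sigma> \<in> arr. r \<sigma> = z \<and> (f \<otimes>\<^bsub>\<S>\<^esub> g) \<sigma> \<noteq> \<zero>\<^bsub>St z\<^esub>}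
      \<subseteq> {\<sigma> \<in> arr. r \<sigma> = z \<and> f \<sigma> \<noteq> \<zero>\<^bsub>St z\<^esub>} \<union> {\<sigma> \<in> arr. r \<sigma> = z \<and> g \<sigma> \<noteq> \<zero>\<^bsub>St z\<^esub>}"
    using z by (auto simp: section_add ring.ring_simprules(2,8)[OF ring_stalk])
  then show "finite {\<sigma> \<in> arr. r \<sigma> = z \<and> (f \<otimes>\<^bsub>\<S>\<^esub> g) \<sigma> \<noteq> \<zero>\<^bsub>St z\<^esub>}"
    using assms z unfolding fibre_finite_def by (meson finite_Un finite_subset)
qed

lemma fibre_finite_one: "fibre_finite \<one>\<^bsub>\<S>\<^esub>"
  unfolding fibre_finite_def by (auto simp: section_zero intro!: finite_subset[of _ "{}"])

lemma module_act_add: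
  assumes "f \<in> carrier \<S>" "fibre_finite f" "g \<in> carrier \<S>" "fibre_finite g"
    and "unit_section v" "z \<in> units"
  shows "module_act (f \<otimes>\<^bsub>\<S>\<^esub> g) v z = module_act f v z \<oplus>\<^bsub>St z\<^esub> module_act g v z"
  using assms pair_add_left adapted_dom unfolding module_act_def by blast

lemma module_act_one: "z \<in> units \<Longrightarrow> unit_section v \<Longrightarrow> module_act \<one>\<^bsub>\<S>\<^esub> v z = \<zero>\<^bsub>St z\<^esub>"
  unfolding module_act_def
proof (rule pair_eq_zero)
  fix \<sigma> assume a: "z \<in> units" "unit_section v" "\<sigma> \<in> arr" "r \<sigma> = z"
  interpret ring "St z" using ring_stalk a by simp
  show "\<one>\<^bsub>\<S>\<^esub> \<sigma> \<otimes>\<^bsub>St z\<^esub> act \<O> \<sigma> (v (d \<sigma>)) = \<zero>\<^bsub>St z\<^esub>"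
    using a act_closed[of \<sigma> "v (d \<sigma>)"] by (auto simp: section_zero unit_section_def)
qed

lemma module_act_zero:
  assumes f: "f \<in> carrier \<S>" and z: "z \<in> units" and v: "\<And>x. x \<in> units \<Longrightarrow> v x = \<zero>\<^bsub>St x\<^esub>"
  shows "module_act f v z = \<zero>\<^bsub>St z\<^esub>"
  unfolding module_act_def
proof (rule pair_eq_zero[OF z])
  fix \<sigma> assume a: "\<sigma> \<in> arr" "r \<sigma> = z"
  interpret ring "St z" using ring_stalk z by simp
  show "f \<sigma> \<otimes>\<^bsub>St z\<^esub> act \<O> \<sigma> (v (d \<sigma>)) = \<zero>\<^bsub>St z\<^esub>"
    using a v act_zero[OF a(1)] section_in[OF f a] by simp
qed

lemma module_act_inv:
  assumes f: "f \<in> carrier \<S>" "fibre_finite f" "fibre_finite (inv\<^bsub>\<S>\<^esub> f)"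
    and v: "unit_section v" and z: "z \<in> units"
  shows "module_act (inv\<^bsub>\<S>\<^esub> f) v z = \<ominus>\<^bsub>St z\<^esub> module_act f v z"
proof -
  interpret ring "St z" using ring_stalk z by simp
  have "module_act (inv\<^bsub>\<S>\<^esub> f) v z \<oplus>\<^bsub>St z\<^esub> module_act f v z = \<zero>\<^bsub>St z\<^esub>"
    using module_act_add[OF sections.inv_closed[OF f(1)] f(3) f(1,2) v z] module_act_one[OF z v]
      sections.l_inv[OF f(1)] by simp
  moreover have "module_act (inv\<^bsub>\<S>\<^esub> f) v z \<in> C z" "module_act f v z \<in> C z"
    using module_act_unit_section[OF sections.inv_closed[OF f(1)] v] module_act_unit_section[OF f(1) v] z
    by (auto simp: unit_section_def)
  ultimately show ?thesis using minus_equality by simp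
qed

lemma module_act_point:
  assumes h: "bisection_section_on W h" and w: "unit_section w" and \<gamma>: "\<gamma> \<in> W"
    and 0: "\<And>\<sigma>. \<sigma> \<in> W \<Longrightarrow> \<sigma> \<noteq> \<gamma> \<Longrightarrow> w (d \<sigma>) = \<zero>\<^bsub>St (d \<sigma>)\<^esub>" and z: "z \<in> units"
  shows "module_act h w z = point_section (r \<gamma>) (h \<gamma> \<otimes>\<^bsub>St (r \<gamma>)\<^esub> act \<O> \<gamma> (w (d \<gamma>))) z"
proof -
  note W = bisection_section_onD[OF h]
  interpret ring "St z" using ring_stalk z by simp
  have zero: "h \<sigma> \<otimes>\<^bsub>St z\<^esub> act \<O> \<sigma> (w (d \<sigma>)) = \<zero>\<^bsub>St z\<^esub>"
    if s: "\<sigma> \<in> arr" "r \<sigma> = z" "\<sigma> \<noteq> \<gamma>" for \<sigma>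
  proof (cases "\<sigma> \<in> W")
    case True
    then show ?thesis using 0 s act_zero[OF s(1)] section_in[OF W(5) s(1,2)] by simp
  next
    case False
    then show ?thesis
      using W(7)[OF s(1)] s act_closed[OF s(1), of "w (d \<sigma>)"] w by (simp add: unit_section_def)
  qed
  have gA: "\<gamma> \<in> arr" using \<gamma> W(4) by blast
  show ?thesis
  proof (cases "z = r \<gamma>")
    case True
    then show ?thesis
      using pair_single[OF W(5) bisection_section_fibre_finite[OF h] adapted_dom[OF w] z gA] zero
      by (simp add: module_act_def point_section_def)
  next
    case False
    then show ?thesis
      using zero unfolding module_act_def point_section_def by (auto intro!: pair_eq_zero[OF z])
  qed
qed

lemma convolution_add_left:
  assumes "f \<in> carrier \<S>" "fibre_finite f" "g \<in> carrier \<S>" "fibre_finite g" "h \<in> carrier \<S>"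
  shows "convolution \<G> \<O> (f \<otimes>\<^bsub>\<S>\<^esub> g) h = convolution \<G> \<O> f h \<otimes>\<^bsub>\<S>\<^esub> convolution \<G> \<O> g h"
proof (rule section_eqI)
  fix \<gamma> assume g: "\<gamma> \<in> arr"
  show "convolution \<G> \<O> (f \<otimes>\<^bsub>\<S>\<^esub> g) h \<gamma> = (convolution \<G> \<O> f h \<otimes>\<^bsub>\<S>\<^esub> convolution \<G> \<O> g h) \<gamma>"
    using assms g fibre_finite_add adapted_translate[OF assms(5) g refl]
    by (simp add: section_add convolution_eq_pair pair_add_left)
qed (use assms fibre_finite_add in \<open>auto intro!: convolution_section\<close>)

lemma convolution_add_right:
  assumes f: "f \<in> carrier \<S>" "fibre_finite f" and g: "g \<in> carrier \<S>" and h: "h \<in> carrier \<S>"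
  shows "convolution \<G> \<O> f (g \<otimes>\<^bsub>\<S>\<^esub> h) = convolution \<G> \<O> f g \<otimes>\<^bsub>\<S>\<^esub> convolution \<G> \<O> f h"
proof (rule section_eqI)
  fix \<gamma> assume \<gamma>: "\<gamma> \<in> arr"
  have "pair (r \<gamma>) f (\<lambda>\<sigma>. (g \<otimes>\<^bsub>\<S>\<^esub> h) (gi \<sigma> \<cdot> \<gamma>))
      = pair (r \<gamma>) f (\<lambda>\<sigma>. g (gi \<sigma> \<cdot> \<gamma>) \<oplus>\<^bsub>St (d \<sigma>)\<^esub> h (gi \<sigma> \<cdot> \<gamma>))"
  proof (rule pair_cong[OF f(1)])
    show "adapted (r \<gamma>) (\<lambda>\<sigma>. (g \<otimes>\<^bsub>\<S>\<^esub> h) (gi \<sigma> \<cdot> \<gamma>))"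
      using g h \<gamma> by (intro adapted_translate) auto
    show "(g \<otimes>\<^bsub>\<S>\<^esub> h) (gi \<sigma> \<cdot> \<gamma>) = g (gi \<sigma> \<cdot> \<gamma>) \<oplus>\<^bsub>St (d \<sigma>)\<^esub> h (gi \<sigma> \<cdot> \<gamma>)"
      if "\<sigma> \<in> arr" "r \<sigma> = r \<gamma>" for \<sigma>
      using inv_mul_in_arrows[OF that(1) \<gamma> that(2)] by (simp add: section_add)
  qed (use \<gamma> in simp)
  then show "convolution \<G> \<O> f (g \<otimes>\<^bsub>\<S>\<^esub> h) \<gamma> = (convolution \<G> \<O> f g \<otimes>\<^bsub>\<S>\<^esub> convolution \<G> \<O> f h) \<gamma>"
    using f g h \<gamma> adapted_translate[OF g \<gamma> refl] adapted_translate[OF h \<gamma> refl]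
    by (simp add: section_add convolution_eq_pair pair_add_right)
qed (use assms in \<open>auto intro!: convolution_section\<close>)

lemma convolution_zero_left:
  assumes "h \<in> carrier \<S>" shows "convolution \<G> \<O> \<one>\<^bsub>\<S>\<^esub> h = \<one>\<^bsub>\<S>\<^esub>"
proof -
  have c: "convolution \<G> \<O> \<one>\<^bsub>\<S>\<^esub> h \<in> carrier \<S>"
    using assms fibre_finite_one convolution_section by simp
  have "convolution \<G> \<O> \<one>\<^bsub>\<S>\<^esub> h = convolution \<G> \<O> \<one>\<^bsub>\<S>\<^esub> h \<otimes>\<^bsub>\<S>\<^esub> convolution \<G> \<O> \<one>\<^bsub>\<S>\<^esub> h"
    using convolution_add_left[of "\<one>\<^bsub>\<S>\<^esub>" "\<one>\<^bsub>\<S>\<^esub>" h] assms fibre_finite_one by simp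
  then show ?thesis using c sections.l_cancel_one by metis
qed

lemma convolution_zero_right:
  assumes "f \<in> carrier \<S>" "fibre_finite f" shows "convolution \<G> \<O> f \<one>\<^bsub>\<S>\<^esub> = \<one>\<^bsub>\<S>\<^esub>"
proof -
  have c: "convolution \<G> \<O> f \<one>\<^bsub>\<S>\<^esub> \<in> carrier \<S>"
    using assms convolution_section by simp
  have "convolution \<G> \<O> f \<one>\<^bsub>\<S>\<^esub> = convolution \<G> \<O> f \<one>\<^bsub>\<S>\<^esub> \<otimes>\<^bsub>\<S>\<^esub> convolution \<G> \<O> f \<one>\<^bsub>\<S>\<^esub>"
    using convolution_add_right[of f "\<one>\<^bsub>\<S>\<^esub>" "\<one>\<^bsub>\<S>\<^esub>"] assms by simp
  then show ?thesis using c sections.l_cancel_one by metis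
qed

lemma convolution_assoc:
  assumes f: "f \<in> carrier \<S>" "fibre_finite f" and g: "g \<in> carrier \<S>" "fibre_finite g"
    and h: "h \<in> carrier \<S>" and fg: "fibre_finite (convolution \<G> \<O> f g)"
  shows "convolution \<G> \<O> (convolution \<G> \<O> f g) h = convolution \<G> \<O> f (convolution \<G> \<O> g h)"
proof (rule section_eqI)
  note cfg = convolution_section[OF f g(1)] and cgh = convolution_section[OF g h]
  show "convolution \<G> \<O> (convolution \<G> \<O> f g) h \<in> carrier \<S>"
    "convolution \<G> \<O> f (convolution \<G> \<O> g h) \<in> carrier \<S>"
    using convolution_section[OF cfg fg h] convolution_section[OF f cgh] .
  fix \<gamma> assume \<gamma>: "\<gamma> \<in> arr"
  have "convolution \<G> \<O> (convolution \<G> \<O> f g) h \<gamma>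
      = pair (r \<gamma>) f (\<lambda>\<beta>. pair (d \<beta>) g (\<lambda>\<rho>. h (gi (\<beta> \<cdot> \<rho>) \<cdot> \<gamma>)))"
    using convolution_eq_pair[OF cfg fg h \<gamma>] pair_convolution[OF f g adapted_translate[OF h \<gamma> refl]] \<gamma>
    by simp
  also have "\<dots> = pair (r \<gamma>) f (\<lambda>\<beta>. convolution \<G> \<O> g h (gi \<beta> \<cdot> \<gamma>))"
  proof (rule pair_cong[symmetric, OF f(1) adapted_translate[OF cgh \<gamma> refl]])
    fix \<beta> assume b: "\<beta> \<in> arr" "r \<beta> = r \<gamma>"
    note i = inv_mul_in_arrows[OF b(1) \<gamma> b(2)]
    have "convolution \<G> \<O> g h (gi \<beta> \<cdot> \<gamma>) = pair (d \<beta>) g (\<lambda>\<rho>. h (gi \<rho> \<cdot> (gi \<beta> \<cdot> \<gamma>)))"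
      using convolution_eq_pair[OF g h i(1)] i(2) by simp
    also have "\<dots> = pair (d \<beta>) g (\<lambda>\<rho>. h (gi (\<beta> \<cdot> \<rho>) \<cdot> \<gamma>))"
      using adapted_translate[OF h i(1,2)] b \<gamma>
      by (intro pair_cong[OF g(1)]) (auto simp: inv_mul_mul)
    finally show "convolution \<G> \<O> g h (gi \<beta> \<cdot> \<gamma>) = pair (d \<beta>) g (\<lambda>\<rho>. h (gi (\<beta> \<cdot> \<rho>) \<cdot> \<gamma>))" .
  qed (use \<gamma> in simp)
  also have "\<dots> = convolution \<G> \<O> f (convolution \<G> \<O> g h) \<gamma>"
    using convolution_eq_pair[OF f cgh \<gamma>] by simp
  finally show "convolution \<G> \<O> (convolution \<G> \<O> f g) h \<gamma>
      = convolution \<G> \<O> f (convolution \<G> \<O> g h) \<gamma>" .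
qed

end

context ample_sheaf_of_rings
begin

abbreviation \<Gamma> where "\<Gamma> \<equiv> Gamma_c \<G> \<O>"

inductive sum_of_bisections :: "nat \<Rightarrow> ('g \<Rightarrow> 'e) \<Rightarrow> bool" where
  zero: "sum_of_bisections 0 \<one>\<^bsub>\<S>\<^esub>"
| add: "bisection_section_on U g \<Longrightarrow> sum_of_bisections n h \<Longrightarrow> sum_of_bisections (Suc n) (g \<otimes>\<^bsub>\<S>\<^esub> h)"

lemma sum_of_bisections_section:
  assumes "sum_of_bisections n f" shows "f \<in> carrier \<S>" "fibre_finite f"
  using assms
  by (induction rule: sum_of_bisections.induct)
    (simp_all add: fibre_finite_one fibre_finite_add bisection_section_fibre_finite
      bisection_section_onD(5) sections.m_closed)

lemma sum_of_bisections_single: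
  assumes "bisection_section_on U g" shows "sum_of_bisections 1 g"
  using sum_of_bisections.add[OF assms sum_of_bisections.zero] bisection_section_onD(5)[OF assms] by simp

lemma sum_of_bisections_add:
  assumes "sum_of_bisections m f" "sum_of_bisections n g"
  shows "sum_of_bisections (m + n) (f \<otimes>\<^bsub>\<S>\<^esub> g)"
  using assms(1)
proof (induction rule: sum_of_bisections.induct)
  case zero
  then show ?case using assms(2) sum_of_bisections_section(1) by simp
next
  case (add U g' k h)
  then have "g' \<otimes>\<^bsub>\<S>\<^esub> h \<otimes>\<^bsub>\<S>\<^esub> g = g' \<otimes>\<^bsub>\<S>\<^esub> (h \<otimes>\<^bsub>\<S>\<^esub> g)"
    using sum_of_bisections_section(1) assms(2) bisection_section_onD(5) sections.m_assoc by blast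
  then show ?case using sum_of_bisections.add[OF add(1,3)] by simp
qed

lemma Gamma_simps:
  "carrier \<Gamma> = generate \<S> (bisection_sections \<G> \<O>)" "mult \<Gamma> = convolution \<G> \<O>"
  "zero \<Gamma> = \<one>\<^bsub>\<S>\<^esub>" "add \<Gamma> = mult \<S>"
  by (simp_all add: Gamma_c_def)

lemma Gamma_iff: "f \<in> carrier \<Gamma> \<longleftrightarrow> (\<exists>n. sum_of_bisections n f)"
proof
  assume "f \<in> carrier \<Gamma>"
  then have "f \<in> generate \<S> (bisection_sections \<G> \<O>)" by (simp add: Gamma_simps)
  then show "\<exists>n. sum_of_bisections n f"
  proof (induction rule: generate.induct)
    case one
    show ?case using sum_of_bisections.zero by blast
  next
    case (incl h)
    then show ?case using sum_of_bisections_single bisection_sections_iff by blast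
  next
    case (inv h)
    then show ?case using sum_of_bisections_single bisection_sections_iff bisection_section_inv by blast
  next
    case (eng h1 h2)
    then show ?case using sum_of_bisections_add by blast
  qed
next
  assume "\<exists>n. sum_of_bisections n f"
  then obtain n where "sum_of_bisections n f" by blast
  then show "f \<in> carrier \<Gamma>"
    unfolding Gamma_simps
  proof (induction rule: sum_of_bisections.induct)
    case zero
    show ?case by (rule generate.one)
  next
    case (add U g n h)
    then have "g \<in> bisection_sections \<G> \<O>" using bisection_sections_iff by blast
    then show ?case using add.IH generate.eng generate.incl by metis
  qed
qed

lemma Gamma_section: "f \<in> carrier \<Gamma> \<Longrightarrow> f \<in> carrier \<S>"
  and Gamma_fibre_finite: "f \<in> carrier \<Gamma> \<Longrightarrow> fibre_finite f"
  using Gamma_iff sum_of_bisections_section by blast+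

lemma bisection_section_in_Gamma: "bisection_section_on U f \<Longrightarrow> f \<in> carrier \<Gamma>"
  using Gamma_iff sum_of_bisections_single by blast

lemma subgroup_Gamma: "subgroup (carrier \<Gamma>) \<S>"
  unfolding Gamma_simps
  by (rule sections.generate_is_subgroup) (auto simp: bisection_sections_def)

lemma add_monoid_Gamma: "add_monoid \<Gamma> = \<S>\<lparr>carrier := carrier \<Gamma>\<rparr>"
  by (simp add: Gamma_c_def)

lemma abelian_group_Gamma: "abelian_group \<Gamma>"
proof (rule comm_group_abelian_groupI)
  interpret G: group "\<S>\<lparr>carrier := carrier \<Gamma>\<rparr>"
    using subgroup.subgroup_is_group[OF subgroup_Gamma] sections.is_group by blast
  show "comm_group (add_monoid \<Gamma>)"
    unfolding add_monoid_Gamma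
    by (rule G.group_comm_groupI) (use Gamma_section sections.m_comm in auto)
qed

sublocale Gamma: abelian_group \<Gamma>
  by (rule abelian_group_Gamma)

lemma Gamma_a_inv: "f \<in> carrier \<Gamma> \<Longrightarrow> \<ominus>\<^bsub>\<Gamma>\<^esub> f = inv\<^bsub>\<S>\<^esub> f"
  unfolding a_inv_def add_monoid_Gamma using sections.m_inv_consistent[OF subgroup_Gamma] by simp

lemma Gamma_mult_closed:
  assumes f: "f \<in> carrier \<Gamma>" and g: "g \<in> carrier \<Gamma>"
  shows "f \<otimes>\<^bsub>\<Gamma>\<^esub> g \<in> carrier \<Gamma>"
proof -
  have one: "f \<otimes>\<^bsub>\<Gamma>\<^esub> g \<in> carrier \<Gamma>" if f: "bisection_section_on U f" and g: "g \<in> carrier \<Gamma>" for U f g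
  proof -
    note fS = bisection_section_onD(5)[OF f] bisection_section_fibre_finite[OF f]
    obtain n where "sum_of_bisections n g" using g Gamma_iff by blast
    then show ?thesis
    proof (induction rule: sum_of_bisections.induct)
      case zero
      show ?case using convolution_zero_right[OF fS] Gamma.zero_closed by (simp add: Gamma_simps(2,3))
    next
      case (add V g n h)
      have "g \<in> carrier \<S>" "h \<in> carrier \<S>"
        using bisection_section_onD(5)[OF add(1)] sum_of_bisections_section(1)[OF add(2)] .
      then have "f \<otimes>\<^bsub>\<Gamma>\<^esub> (g \<otimes>\<^bsub>\<S>\<^esub> h) = convolution \<G> \<O> f g \<oplus>\<^bsub>\<Gamma>\<^esub> f \<otimes>\<^bsub>\<Gamma>\<^esub> h"
        using convolution_add_right[OF fS] by (simp add: Gamma_simps(2,4))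
      moreover have "convolution \<G> \<O> f g \<in> carrier \<Gamma>"
        using bisection_section_convolution[OF f add(1)] bisection_section_in_Gamma by blast
      ultimately show ?case using add.IH Gamma.a_closed by metis
    qed
  qed
  obtain n where "sum_of_bisections n f" using f Gamma_iff by blast
  then show ?thesis
  proof (induction rule: sum_of_bisections.induct)
    case zero
    show ?case
      using convolution_zero_left[OF Gamma_section[OF g]] Gamma.zero_closed by (simp add: Gamma_simps(2,3))
  next
    case (add V f n h)
    have "f \<in> carrier \<S>" "fibre_finite f" "h \<in> carrier \<S>" "fibre_finite h"
      using bisection_section_onD(5)[OF add(1)] bisection_section_fibre_finite[OF add(1)]
        sum_of_bisections_section[OF add(2)] .
    then have "(f \<otimes>\<^bsub>\<S>\<^esub> h) \<otimes>\<^bsub>\<Gamma>\<^esub> g = f \<otimes>\<^bsub>\<Gamma>\<^esub> g \<oplus>\<^bsub>\<Gamma>\<^esub> h \<otimes>\<^bsub>\<Gamma>\<^esub> g"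
      using convolution_add_left Gamma_section[OF g] by (simp add: Gamma_simps(2,4))
    then show ?case using add.IH one[OF add(1) g] Gamma.a_closed by metis
  qed
qed

lemma Gamma_assoc:
  assumes "x \<in> carrier \<Gamma>" "y \<in> carrier \<Gamma>" "z \<in> carrier \<Gamma>"
  shows "x \<otimes>\<^bsub>\<Gamma>\<^esub> y \<otimes>\<^bsub>\<Gamma>\<^esub> z = x \<otimes>\<^bsub>\<Gamma>\<^esub> (y \<otimes>\<^bsub>\<Gamma>\<^esub> z)"
  using assms Gamma_section Gamma_fibre_finite Gamma_fibre_finite[OF Gamma_mult_closed[OF assms(1,2)]]
  unfolding Gamma_simps(2) by (intro convolution_assoc) blast+

lemma Gamma_l_distr:
  assumes "x \<in> carrier \<Gamma>" "y \<in> carrier \<Gamma>" "z \<in> carrier \<Gamma>"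
  shows "(x \<oplus>\<^bsub>\<Gamma>\<^esub> y) \<otimes>\<^bsub>\<Gamma>\<^esub> z = x \<otimes>\<^bsub>\<Gamma>\<^esub> z \<oplus>\<^bsub>\<Gamma>\<^esub> y \<otimes>\<^bsub>\<Gamma>\<^esub> z"
  using assms Gamma_section Gamma_fibre_finite
  unfolding Gamma_simps(2,4) by (intro convolution_add_left) blast+

lemma Gamma_r_distr:
  assumes "x \<in> carrier \<Gamma>" "y \<in> carrier \<Gamma>" "z \<in> carrier \<Gamma>"
  shows "x \<otimes>\<^bsub>\<Gamma>\<^esub> (y \<oplus>\<^bsub>\<Gamma>\<^esub> z) = x \<otimes>\<^bsub>\<Gamma>\<^esub> y \<oplus>\<^bsub>\<Gamma>\<^esub> x \<otimes>\<^bsub>\<Gamma>\<^esub> z"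
  using assms Gamma_section Gamma_fibre_finite
  unfolding Gamma_simps(2,4) by (intro convolution_add_right) blast+

section \<open>The module of sections over the unit space\<close>

lemma act_mult:
  assumes "f \<in> carrier \<Gamma>" "g \<in> carrier \<Gamma>" "unit_section v" "z \<in> units"
  shows "module_act (f \<otimes>\<^bsub>\<Gamma>\<^esub> g) v z = module_act f (module_act g v) z"
  using assms module_act_convolution Gamma_section Gamma_fibre_finite by (simp add: Gamma_simps(2))

lemma act_add:
  assumes "f \<in> carrier \<Gamma>" "g \<in> carrier \<Gamma>" "unit_section v" "z \<in> units"
  shows "module_act (f \<oplus>\<^bsub>\<Gamma>\<^esub> g) v z = module_act f v z \<oplus>\<^bsub>St z\<^esub> module_act g v z"
  using assms module_act_add Gamma_section Gamma_fibre_finite by (simp add: Gamma_simps(4))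

lemma act_neg:
  assumes "f \<in> carrier \<Gamma>" "unit_section v" "z \<in> units"
  shows "module_act (\<ominus>\<^bsub>\<Gamma>\<^esub> f) v z = \<ominus>\<^bsub>St z\<^esub> module_act f v z"
  using assms module_act_inv Gamma_section Gamma_fibre_finite Gamma_fibre_finite[OF Gamma.a_inv_closed[OF assms(1)]]
  by (simp add: Gamma_a_inv)

lemma act_diff:
  assumes "f \<in> carrier \<Gamma>" "g \<in> carrier \<Gamma>" "unit_section v" "z \<in> units"
  shows "module_act (f \<ominus>\<^bsub>\<Gamma>\<^esub> g) v z = module_act f v z \<ominus>\<^bsub>St z\<^esub> module_act g v z"
  using assms by (simp add: a_minus_def act_add act_neg)

lemma act_in_stalk:
  "f \<in> carrier \<Gamma> \<Longrightarrow> unit_section v \<Longrightarrow> z \<in> units \<Longrightarrow> module_act f v z \<in> C z"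
  using module_act_unit_section[OF Gamma_section] by (simp add: unit_section_def)

lemma act_cong:
  assumes "f \<in> carrier \<Gamma>" "unit_section v" "z \<in> units" "\<And>x. x \<in> units \<Longrightarrow> v x = w x"
  shows "module_act f v z = module_act f w z"
  unfolding module_act_def
  using assms Gamma_section adapted_dom by (intro pair_cong) auto

definition annihilator :: "('g \<Rightarrow> 'e) \<Rightarrow> ('g \<Rightarrow> 'e) set" where
  "annihilator v = {f \<in> carrier \<Gamma>. \<forall>z\<in>units. module_act f v z = \<zero>\<^bsub>St z\<^esub>}"

lemma left_ideal_annihilator:
  assumes v: "unit_section v"
  shows "left_ideal (annihilator v) \<Gamma>"
  unfolding left_ideal_def
proof (intro conjI ballI)
  show "subgroup (annihilator v) (add_monoid \<Gamma>)"
  proof (rule Gamma.add.subgroupI)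
    have "\<zero>\<^bsub>\<Gamma>\<^esub> \<in> annihilator v"
      using Gamma.zero_closed module_act_one v by (simp add: annihilator_def Gamma_simps(3))
    then show "annihilator v \<noteq> {}" by blast
    show "annihilator v \<subseteq> carrier \<Gamma>" by (auto simp: annihilator_def)
    show "\<ominus>\<^bsub>\<Gamma>\<^esub> f \<in> annihilator v" if "f \<in> annihilator v" for f
    proof -
      have "\<ominus>\<^bsub>St z\<^esub> \<zero>\<^bsub>St z\<^esub> = \<zero>\<^bsub>St z\<^esub>" if "z \<in> units" for z
      proof -
        interpret ring "St z" using ring_stalk that .
        show ?thesis by simp
      qed
      then show ?thesis using that v by (simp add: annihilator_def act_neg)
    qed
    show "f \<oplus>\<^bsub>\<Gamma>\<^esub> g \<in> annihilator v" if "f \<in> annihilator v" "g \<in> annihilator v" for f g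
      using that v by (simp add: annihilator_def act_add ring.ring_simprules(2,8)[OF ring_stalk])
  qed
  show "f \<otimes>\<^bsub>\<Gamma>\<^esub> g \<in> annihilator v" if "f \<in> carrier \<Gamma>" "g \<in> annihilator v" for f g
    using that v module_act_zero[OF Gamma_section[OF that(1)]]
    by (simp add: annihilator_def act_mult Gamma_mult_closed)
qed

lemma finite_support_act:
  assumes f: "f \<in> carrier \<Gamma>" and y: "y \<in> units" "e \<in> C y"
  shows "finite {z \<in> units. module_act f (point_section y e) z \<noteq> \<zero>\<^bsub>St z\<^esub>}"
proof -
  let ?v = "point_section y e"
  note v = point_section_unit_section[OF y(2)]
  let ?supp = "\<lambda>f. {z \<in> units. module_act f ?v z \<noteq> \<zero>\<^bsub>St z\<^esub>}"
  obtain n where "sum_of_bisections n f" using f Gamma_iff by blast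
  then show ?thesis
  proof (induction rule: sum_of_bisections.induct)
    case zero
    have "?supp \<one>\<^bsub>\<S>\<^esub> = {}" using module_act_one[OF _ v] by blast
    then show ?case by (metis finite.emptyI)
  next
    case (add U g n h)
    note U = bisection_section_onD[OF add(1)]
    have "?supp g \<subseteq> r ` {\<sigma> \<in> U. d \<sigma> = y}"
    proof (rule ccontr)
      assume "\<not> ?thesis"
      then obtain z where z: "z \<in> units" "module_act g ?v z \<noteq> \<zero>\<^bsub>St z\<^esub>" "z \<notin> r ` {\<sigma> \<in> U. d \<sigma> = y}"
        by blast
      have "module_act g ?v z = \<zero>\<^bsub>St z\<^esub>"
        unfolding module_act_def
      proof (rule pair_eq_zero[OF z(1)])
        fix \<sigma> assume s: "\<sigma> \<in> arr" "r \<sigma> = z"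
        interpret ring "St z" using ring_stalk z by simp
        show "g \<sigma> \<otimes>\<^bsub>St z\<^esub> act \<O> \<sigma> (?v (d \<sigma>)) = \<zero>\<^bsub>St z\<^esub>"
        proof (cases "\<sigma> \<in> U")
          case True
          then have "d \<sigma> \<noteq> y" using z(3) s(2) by blast
          then show ?thesis
            using act_zero[OF s(1)] section_in[OF U(5) s] s(2) by (simp add: point_section_def)
        next
          case False
          then show ?thesis
            using U(7)[OF s(1)] s(2) act_closed[OF s(1), of "?v (d \<sigma>)"] v s(1) by (simp add: unit_section_def)
        qed
      qed
      with z(2) show False by simp
    qed
    moreover have "finite {\<sigma> \<in> U. d \<sigma> = y}"
    proof -
      have "inj_on d {\<sigma> \<in> U. d \<sigma> = y}" using U(3) by (auto simp: bisection_def inj_on_def)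
      moreover have "d ` {\<sigma> \<in> U. d \<sigma> = y} \<subseteq> {y}" by auto
      ultimately show ?thesis using finite_subset finite_imageD by blast
    qed
    ultimately have "finite (?supp g)" using finite_subset by blast
    moreover have "?supp (g \<otimes>\<^bsub>\<S>\<^esub> h) \<subseteq> ?supp g \<union> ?supp h"
      using module_act_add[OF U(5) bisection_section_fibre_finite[OF add(1)] sum_of_bisections_section[OF add(2)] v]
      by (auto simp: ring.ring_simprules(2,8)[OF ring_stalk])
    ultimately show ?case using add.IH finite_subset by blast
  qed
qed

end

locale ample_sheaf_of_fields = ample_sheaf_of_rings \<G> \<O> + groupoid_sheaf_of_fields \<G> \<O>
  for \<G> :: "'g groupoid" and \<O> :: "('g, 'e) ring_sheaf"
begin

text \<open>
  The module generated by a point section is simple: a bisection section supported near an arrow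
  \<open>z \<rightarrow> y\<close> isolates the value at \<open>z\<close> and moves it to any prescribed value at \<open>y\<close>.
\<close>

lemma act_transitive:
  assumes y: "y \<in> units" "e \<in> C y" and g: "g \<in> carrier \<Gamma>"
    and z: "z \<in> units" "module_act g (point_section y e) z \<noteq> \<zero>\<^bsub>St z\<^esub>"
  obtains h where "h \<in> carrier \<Gamma>"
    "\<And>x. x \<in> units \<Longrightarrow> module_act (h \<otimes>\<^bsub>\<Gamma>\<^esub> g) (point_section y e) x = point_section y e x"
proof -
  let ?v = "point_section y e"
  note v = point_section_unit_section[OF y(2)]
  let ?w = "module_act g ?v"
  have w: "unit_section ?w" using module_act_unit_section[OF Gamma_section[OF g] v] .
  have "\<exists>\<sigma>\<in>arr. r \<sigma> = z \<and> d \<sigma> = y"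
  proof (rule ccontr)
    assume "\<not> ?thesis"
    then have n: "d \<sigma> \<noteq> y" if "\<sigma> \<in> arr" "r \<sigma> = z" for \<sigma> using that by blast
    have "?w z = \<zero>\<^bsub>St z\<^esub>"
      unfolding module_act_def
    proof (rule pair_eq_zero[OF z(1)])
      fix \<sigma> assume s: "\<sigma> \<in> arr" "r \<sigma> = z"
      interpret ring "St z" using ring_stalk z by simp
      show "g \<sigma> \<otimes>\<^bsub>St z\<^esub> act \<O> \<sigma> (?v (d \<sigma>)) = \<zero>\<^bsub>St z\<^esub>"
        using n[OF s] act_zero[OF s(1)] section_in[OF Gamma_section[OF g] s] s(2)
        by (simp add: point_section_def)
    qed
    with z(2) show False by simp
  qed
  then obtain \<sigma> where \<sigma>: "\<sigma> \<in> arr" "r \<sigma> = z" "d \<sigma> = y" by blast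
  define \<gamma> where "\<gamma> = gi \<sigma>"
  have \<gamma>: "\<gamma> \<in> arr" "d \<gamma> = z" "r \<gamma> = y"
    using \<sigma> inv_closed dom_inv ran_inv unfolding \<gamma>_def by auto
  let ?c = "act \<O> \<gamma> (?w z)"
  have wz: "?w z \<in> C z" using w z(1) by (simp add: unit_section_def)
  interpret F: field "St y" using field_stalk y(1) .
  have c: "?c \<in> C y" "?c \<noteq> \<zero>\<^bsub>St y\<^esub>"
    using act_closed[OF \<gamma>(1)] act_eq_zero_iff[OF \<gamma>(1)] wz z(2) \<gamma> by auto
  then have ci: "inv\<^bsub>St y\<^esub> ?c \<in> C y" "inv\<^bsub>St y\<^esub> ?c \<otimes>\<^bsub>St y\<^esub> ?c = \<one>\<^bsub>St y\<^esub>"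
    using F.field_Units F.Units_inv_closed F.Units_l_inv by auto
  let ?e = "e \<otimes>\<^bsub>St y\<^esub> inv\<^bsub>St y\<^esub> ?c"
  let ?N = "units - ({x \<in> units. ?w x \<noteq> \<zero>\<^bsub>St x\<^esub>} - {z})"
  have N: "openin (unit_space \<G>) ?N"
    using finite_support_act[OF g y] by (intro cofinite_open) simp
  have eC: "?e \<in> C (r \<gamma>)" using ci y \<gamma> by simp
  have dN: "d \<gamma> \<in> ?N" using \<gamma> z by simp
  obtain W h where h: "bisection_section_on W h" "\<gamma> \<in> W" "d ` W \<subseteq> ?N" "h \<gamma> = ?e"
    using bisection_section_through[OF \<gamma>(1) eC N dN] by blast
  note W = bisection_section_onD[OF h(1)]
  have off: "?w (d \<tau>) = \<zero>\<^bsub>St (d \<tau>)\<^esub>" if "\<tau> \<in> W" "\<tau> \<noteq> \<gamma>" for \<tau>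
  proof -
    have "d \<tau> \<noteq> z"
      using that h(2) W(3) \<gamma>(2) unfolding bisection_def by (metis inj_onD)
    moreover have "d \<tau> \<in> ?N" using h(3) that(1) by blast
    then have "?w (d \<tau>) \<noteq> \<zero>\<^bsub>St (d \<tau>)\<^esub> \<Longrightarrow> d \<tau> = z" by blast
    ultimately show ?thesis by blast
  qed
  have ee: "?e \<otimes>\<^bsub>St y\<^esub> ?c = e"
    using ci c y F.m_assoc by simp
  have hG: "h \<in> carrier \<Gamma>" using bisection_section_in_Gamma[OF h(1)] .
  have "module_act (h \<otimes>\<^bsub>\<Gamma>\<^esub> g) ?v x = ?v x" if "x \<in> units" for x
    using act_mult[OF hG g v that] module_act_point[OF h(1) w h(2) off that] h(4) \<gamma> ee by simp
  with hG show thesis using that by blast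
qed

lemma annihilator_maximal_modular:
  assumes y: "y \<in> units" "e \<in> C y" "e \<noteq> \<zero>\<^bsub>St y\<^esub>"
  shows "maximal_left_ideal (annihilator (point_section y e)) \<Gamma>"
    and "modular_left_ideal (annihilator (point_section y e)) \<Gamma>"
proof -
  let ?v = "point_section y e" let ?L = "annihilator ?v"
  note v = point_section_unit_section[OF y(2)]
  interpret R: field "St y" using field_stalk y(1) .
  have unit: "f \<ominus>\<^bsub>\<Gamma>\<^esub> f \<otimes>\<^bsub>\<Gamma>\<^esub> u \<in> ?L"
    if f: "f \<in> carrier \<Gamma>" and u: "u \<in> carrier \<Gamma>" "\<And>x. x \<in> units \<Longrightarrow> module_act u ?v x = ?v x" for f u
  proof -
    have "module_act (f \<ominus>\<^bsub>\<Gamma>\<^esub> f \<otimes>\<^bsub>\<Gamma>\<^esub> u) ?v z = \<zero>\<^bsub>St z\<^esub>" if z: "z \<in> units" for z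
    proof -
      interpret ring "St z" using ring_stalk z .
      have "module_act f (module_act u ?v) z = module_act f ?v z"
        using act_cong[OF f v z, of "module_act u ?v"] u(2) by simp
      then have "module_act (f \<otimes>\<^bsub>\<Gamma>\<^esub> u) ?v z = module_act f ?v z"
        using act_mult[OF f u(1) v z] by simp
      then show ?thesis
        using act_diff[OF f Gamma_mult_closed[OF f u(1)] v z] act_in_stalk[OF f v z]
        by (simp add: minus_eq r_neg)
    qed
    then show ?thesis using Gamma_mult_closed f u(1) by (simp add: annihilator_def)
  qed
  have "openin (unit_space \<G>) units" by (metis openin_topspace topspace_unit_space)
  moreover have "y \<in> arr" "\<one>\<^bsub>St y\<^esub> \<in> C (r y)" "d y \<in> units" using y(1) by auto
  ultimately obtain W u where u: "bisection_section_on W u" "y \<in> W" "u y = \<one>\<^bsub>St y\<^esub>"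
    using bisection_section_through by metis
  have off: "?v (d \<sigma>) = \<zero>\<^bsub>St (d \<sigma>)\<^esub>" if "\<sigma> \<in> W" "\<sigma> \<noteq> y" for \<sigma>
  proof -
    have "d \<sigma> \<noteq> d y"
      using that u(2) bisection_section_onD(3)[OF u(1)] unfolding bisection_def by (metis inj_onD)
    then show ?thesis using y(1) by (simp add: point_section_def)
  qed
  have uG: "u \<in> carrier \<Gamma>" using bisection_section_in_Gamma[OF u(1)] .
  have uv: "module_act u ?v x = ?v x" if "x \<in> units" for x
    using module_act_point[OF u(1) v u(2) off that] y u(3) act_id[of y e]
    by (simp add: point_section_def)
  show "modular_left_ideal ?L \<Gamma>"
    unfolding modular_left_ideal_def using left_ideal_annihilator[OF v] unit uG uv by blast
  show "maximal_left_ideal ?L \<Gamma>"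
    unfolding maximal_left_ideal_def
  proof (intro conjI allI impI left_ideal_annihilator[OF v])
    have "module_act u ?v y \<noteq> \<zero>\<^bsub>St y\<^esub>" using uv[OF y(1)] y(3) by (simp add: point_section_def)
    then have "u \<notin> ?L" using y(1) unfolding annihilator_def by blast
    with uG show "?L \<noteq> carrier \<Gamma>" by blast
    fix L' assume L': "left_ideal L' \<Gamma> \<and> ?L \<subseteq> L'"
    then have sub: "subgroup L' (add_monoid \<Gamma>)" and L'G: "L' \<subseteq> carrier \<Gamma>"
      using subgroup.subset[of L' "add_monoid \<Gamma>"] unfolding left_ideal_def by auto
    show "L' = ?L \<or> L' = carrier \<Gamma>"
    proof (rule disjCI)
      assume "L' \<noteq> carrier \<Gamma>"
      show "L' = ?L"
      proof (rule ccontr)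
        assume "L' \<noteq> ?L"
        then obtain g where g: "g \<in> L'" "g \<notin> ?L" using L' by blast
        then have gG: "g \<in> carrier \<Gamma>" using L'G by blast
        then obtain z where "z \<in> units" "module_act g ?v z \<noteq> \<zero>\<^bsub>St z\<^esub>"
          using g(2) by (auto simp: annihilator_def)
        then obtain h where h: "h \<in> carrier \<Gamma>"
          "\<And>x. x \<in> units \<Longrightarrow> module_act (h \<otimes>\<^bsub>\<Gamma>\<^esub> g) ?v x = ?v x"
          using act_transitive[OF y(1,2) gG] by blast
        have hg: "h \<otimes>\<^bsub>\<Gamma>\<^esub> g \<in> L'" using L' h(1) g(1) unfolding left_ideal_def by blast
        have "f \<in> L'" if f: "f \<in> carrier \<Gamma>" for f
        proof -
          have fh: "f \<otimes>\<^bsub>\<Gamma>\<^esub> (h \<otimes>\<^bsub>\<Gamma>\<^esub> g) \<in> L'" using L' f hg unfolding left_ideal_def by blast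
          moreover have "f \<ominus>\<^bsub>\<Gamma>\<^esub> f \<otimes>\<^bsub>\<Gamma>\<^esub> (h \<otimes>\<^bsub>\<Gamma>\<^esub> g) \<in> L'"
            using unit[OF f _ h(2)] hg L'G L' by blast
          ultimately have "(f \<ominus>\<^bsub>\<Gamma>\<^esub> f \<otimes>\<^bsub>\<Gamma>\<^esub> (h \<otimes>\<^bsub>\<Gamma>\<^esub> g)) \<oplus>\<^bsub>\<Gamma>\<^esub> f \<otimes>\<^bsub>\<Gamma>\<^esub> (h \<otimes>\<^bsub>\<Gamma>\<^esub> g) \<in> L'"
            using subgroup.m_closed[OF sub] by simp
          moreover have "f \<otimes>\<^bsub>\<Gamma>\<^esub> (h \<otimes>\<^bsub>\<Gamma>\<^esub> g) \<in> carrier \<Gamma>" using fh L'G by blast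
          then have "(f \<ominus>\<^bsub>\<Gamma>\<^esub> f \<otimes>\<^bsub>\<Gamma>\<^esub> (h \<otimes>\<^bsub>\<Gamma>\<^esub> g)) \<oplus>\<^bsub>\<Gamma>\<^esub> f \<otimes>\<^bsub>\<Gamma>\<^esub> (h \<otimes>\<^bsub>\<Gamma>\<^esub> g) = f"
            using f by (simp add: Gamma.minus_eq Gamma.a_assoc Gamma.l_neg)
          ultimately show ?thesis by simp
        qed
        then have "L' = carrier \<Gamma>" using L'G by blast
        with \<open>L' \<noteq> carrier \<Gamma>\<close> show False by contradiction
      qed
    qed
  qed
qed

lemma jacobson_radical_annihilates:
  assumes f: "f \<in> jacobson_radical \<Gamma>" and v: "unit_section v" and z: "z \<in> units"
  shows "module_act f v z = \<zero>\<^bsub>St z\<^esub>"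
proof -
  have fG: "f \<in> carrier \<Gamma>" using f by (simp add: jacobson_radical_def)
  interpret ring "St z" using ring_stalk z .
  have point: "module_act f (point_section y e) z = \<zero>\<^bsub>St z\<^esub>" if y: "y \<in> units" "e \<in> C y" for y e
  proof (cases "e = \<zero>\<^bsub>St y\<^esub>")
    case True
    then show ?thesis by (intro module_act_zero[OF Gamma_section[OF fG] z]) (simp add: point_section_def)
  next
    case False
    then have "f \<in> annihilator (point_section y e)"
      using annihilator_maximal_modular[OF y] f by (simp add: jacobson_radical_def)
    then show ?thesis using z by (simp add: annihilator_def)
  qed
  define cut where "cut F = (\<lambda>x. if x \<in> F then v x else \<zero>\<^bsub>St x\<^esub>)" for F
  have cut: "unit_section (cut F)" for F
    using v zero_in_stalk by (simp add: cut_def unit_section_def)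
  have finite: "module_act f (cut F) z = \<zero>\<^bsub>St z\<^esub>" if "finite F" "F \<subseteq> units" for F
    using that
  proof (induction F rule: finite_induct)
    case empty
    show ?case by (intro module_act_zero[OF Gamma_section[OF fG] z]) (simp add: cut_def)
  next
    case (insert y F)
    then have y: "y \<in> units" "v y \<in> C y" using v by (auto simp: unit_section_def)
    let ?w = "\<lambda>x. point_section y (v y) x \<oplus>\<^bsub>St x\<^esub> cut F x"
    have "cut (insert y F) x = ?w x" if "x \<in> units" for x
      using insert(2) v that
      by (auto simp: cut_def point_section_def unit_section_def zero_in_stalk
          ring.ring_simprules(8,15)[OF ring_stalk])
    then have "module_act f (cut (insert y F)) z = module_act f ?w z"
      by (rule act_cong[OF fG cut z])
    also have "\<dots> = module_act f (point_section y (v y)) z \<oplus>\<^bsub>St z\<^esub> module_act f (cut F) z"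
      using pair_add_right[OF Gamma_section[OF fG] adapted_dom[OF point_section_unit_section[OF y(2)]]
          adapted_dom[OF cut] z] by (simp add: module_act_def)
    finally show ?case using point[OF y] insert by simp
  qed
  let ?F = "d ` {\<sigma> \<in> arr. r \<sigma> = z \<and> f \<sigma> \<noteq> \<zero>\<^bsub>St z\<^esub>}"
  have "module_act f v z = module_act f (cut ?F) z"
    unfolding module_act_def
    by (rule pair_cong[OF Gamma_section[OF fG] adapted_dom[OF v] z]) (auto simp: cut_def)
  also have "\<dots> = \<zero>\<^bsub>St z\<^esub>"
    using Gamma_fibre_finite[OF fG] z by (intro finite) (auto simp: fibre_finite_def)
  finally show ?thesis .
qed

end

section \<open>Ideals annihilating all sections\<close>

context ample_sheaf_of_rings
begin

lemma Gamma_minus_apply: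
  assumes "x \<in> carrier \<Gamma>" "y \<in> carrier \<Gamma>" "\<gamma> \<in> arr"
  shows "(x \<ominus>\<^bsub>\<Gamma>\<^esub> y) \<gamma> = x \<gamma> \<ominus>\<^bsub>St (r \<gamma>)\<^esub> y \<gamma>"
  using assms Gamma_section
  by (simp add: a_minus_def Gamma_simps(4) Gamma_a_inv section_add section_inv)

lemma sum_of_bisections_split:
  assumes "sum_of_bisections n f" "\<gamma> \<in> arr" "f \<gamma> \<noteq> \<zero>\<^bsub>St (r \<gamma>)\<^esub>"
  shows "\<exists>m U g h. n = Suc m \<and> bisection_section_on U g \<and> \<gamma> \<in> U \<and> sum_of_bisections m h \<and> f = g \<otimes>\<^bsub>\<S>\<^esub> h"
  using assms
proof (induction rule: sum_of_bisections.induct)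
  case zero
  then show ?case by (simp add: section_zero)
next
  case (add U g n h)
  note U = bisection_section_onD[OF add(1)]
  show ?case
  proof (cases "\<gamma> \<in> U")
    case True
    then show ?thesis using add by blast
  next
    case False
    then have "h \<gamma> \<noteq> \<zero>\<^bsub>St (r \<gamma>)\<^esub>"
      using add.prems U(7) by (auto simp: section_add ring.ring_simprules(2,8)[OF ring_stalk])
    then obtain m V g' h' where *: "n = Suc m" "bisection_section_on V g'" "\<gamma> \<in> V"
      "sum_of_bisections m h'" "h = g' \<otimes>\<^bsub>\<S>\<^esub> h'"
      using add by blast
    have "g \<otimes>\<^bsub>\<S>\<^esub> h = g' \<otimes>\<^bsub>\<S>\<^esub> (g \<otimes>\<^bsub>\<S>\<^esub> h')"
      using U(5) bisection_section_onD(5)[OF *(2)] sum_of_bisections_section(1)[OF *(4)] *(5)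
      by (simp add: sections.m_lcomm)
    moreover have "sum_of_bisections (Suc m) (g \<otimes>\<^bsub>\<S>\<^esub> h')"
      using sum_of_bisections.add[OF add(1) *(4)] .
    ultimately show ?thesis using * by blast
  qed
qed

lemma sum_of_bisections_mult_left:
  assumes u: "bisection_section_on W u" and f: "sum_of_bisections n f"
  shows "sum_of_bisections n (u \<otimes>\<^bsub>\<Gamma>\<^esub> f)"
  using f
proof (induction rule: sum_of_bisections.induct)
  note uS = bisection_section_onD(5)[OF u] bisection_section_fibre_finite[OF u]
  case zero
  show ?case
    using convolution_zero_right[OF uS] sum_of_bisections.zero by (simp add: Gamma_simps(2))
next
  note uS = bisection_section_onD(5)[OF u] bisection_section_fibre_finite[OF u]
  case (add U g n h)
  obtain V where "bisection_section_on V (u \<otimes>\<^bsub>\<Gamma>\<^esub> g)"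
    using bisection_section_convolution[OF u add(1)] unfolding Gamma_simps(2) by blast
  moreover have "u \<otimes>\<^bsub>\<Gamma>\<^esub> (g \<otimes>\<^bsub>\<S>\<^esub> h) = (u \<otimes>\<^bsub>\<Gamma>\<^esub> g) \<otimes>\<^bsub>\<S>\<^esub> (u \<otimes>\<^bsub>\<Gamma>\<^esub> h)"
    using convolution_add_right[OF uS bisection_section_onD(5)[OF add(1)] sum_of_bisections_section(1)[OF add(2)]]
    by (simp add: Gamma_simps(2))
  ultimately show ?case using sum_of_bisections.add add.IH by metis
qed

definition commutator :: "('g \<Rightarrow> 'e) \<Rightarrow> ('g \<Rightarrow> 'e) \<Rightarrow> 'g \<Rightarrow> 'e" where
  "commutator a f = a \<otimes>\<^bsub>\<Gamma>\<^esub> f \<ominus>\<^bsub>\<Gamma>\<^esub> f \<otimes>\<^bsub>\<Gamma>\<^esub> a"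

lemma commutator_add:
  assumes a: "a \<in> carrier \<Gamma>" and f: "f \<in> carrier \<Gamma>" and g: "g \<in> carrier \<Gamma>"
  shows "commutator a (f \<oplus>\<^bsub>\<Gamma>\<^esub> g) = commutator a f \<oplus>\<^bsub>\<Gamma>\<^esub> commutator a g"
proof -
  have c: "a \<otimes>\<^bsub>\<Gamma>\<^esub> f \<in> carrier \<Gamma>" "a \<otimes>\<^bsub>\<Gamma>\<^esub> g \<in> carrier \<Gamma>" "f \<otimes>\<^bsub>\<Gamma>\<^esub> a \<in> carrier \<Gamma>" "g \<otimes>\<^bsub>\<Gamma>\<^esub> a \<in> carrier \<Gamma>"
    using a f g Gamma_mult_closed by auto
  show ?thesis
    unfolding commutator_def Gamma_r_distr[OF a f g] Gamma_l_distr[OF f g a] a_minus_def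
    using c by (simp add: Gamma.minus_add Gamma.a_ac)
qed

lemma commutator_eq_zero_iff:
  assumes "a \<in> carrier \<Gamma>" "f \<in> carrier \<Gamma>"
  shows "commutator a f = \<zero>\<^bsub>\<Gamma>\<^esub> \<longleftrightarrow> a \<otimes>\<^bsub>\<Gamma>\<^esub> f = f \<otimes>\<^bsub>\<Gamma>\<^esub> a"
  unfolding commutator_def
  using assms Gamma_mult_closed by (metis Gamma.minus_eq Gamma.r_neg Gamma.minus_equality
      Gamma.minus_minus Gamma.a_inv_closed)

lemma bisection_section_commutator:
  assumes a: "a \<in> carrier \<Gamma>" "\<And>\<gamma>. \<gamma> \<in> arr \<Longrightarrow> \<gamma> \<notin> units \<Longrightarrow> a \<gamma> = \<zero>\<^bsub>St (r \<gamma>)\<^esub>"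
    and c: "continuous_map (unit_space \<G>) \<E> a" and f: "bisection_section_on U f"
  shows "bisection_section_on U (commutator a f)"
proof -
  note U = bisection_section_onD[OF f] and ff = bisection_section_fibre_finite[OF f]
  note aS = Gamma_section[OF a(1)]
  have fG: "f \<in> carrier \<Gamma>" using bisection_section_in_Gamma[OF f] .
  let ?X = "subtopology \<T> U"
  have tX: "topspace ?X = U" using U(4) by auto
  have eq: "commutator a f \<gamma> = a (r \<gamma>) \<otimes>\<^bsub>St (r \<gamma>)\<^esub> f \<gamma> \<ominus>\<^bsub>St (r \<gamma>)\<^esub> f \<gamma> \<otimes>\<^bsub>St (r \<gamma>)\<^esub> act \<O> \<gamma> (a (d \<gamma>))"
    if "\<gamma> \<in> arr" for \<gamma>
    unfolding commutator_def Gamma_minus_apply[OF Gamma_mult_closed[OF a(1) fG] Gamma_mult_closed[OF fG a(1)] that]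
    using convolution_unit_left[OF aS a(2) U(5) that] convolution_unit_right[OF aS a(2) U(5) ff that]
    by (simp add: Gamma_simps(2))
  have aC: "a (r \<gamma>) \<in> C (r \<gamma>)" "act \<O> \<gamma> (a (d \<gamma>)) \<in> C (r \<gamma>)" if "\<gamma> \<in> arr" for \<gamma>
    using that section_in[OF aS] act_closed[OF that] by auto
  have ar: "continuous_map ?X \<E> (\<lambda>\<gamma>. a (r \<gamma>))" and ad: "continuous_map ?X \<E> (\<lambda>\<gamma>. a (d \<gamma>))"
    using continuous_map_compose[OF continuous_map_from_subtopology[OF continuous_map_ran] c]
      continuous_map_compose[OF continuous_map_from_subtopology[OF continuous_map_dom] c] by (simp_all add: o_def)
  have aa: "continuous_map ?X \<E> (\<lambda>\<gamma>. act \<O> \<gamma> (a (d \<gamma>)))"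
  proof (rule continuous_map_act[OF _ ad])
    show "continuous_map ?X \<T> (\<lambda>\<gamma>. \<gamma>)"
      using continuous_map_from_subtopology[OF continuous_map_id[unfolded id_def]] .
    show "d \<gamma> = \<pi> (a (d \<gamma>))" if "\<gamma> \<in> topspace ?X" for \<gamma>
      using that section_proj[OF aS, of "d \<gamma>"] tX U(4) by auto
  qed
  have p: "\<pi> e = r \<gamma>" if "e \<in> C (r \<gamma>)" "\<gamma> \<in> arr" for e \<gamma>
    using that in_stalk_iff by simp
  have mC: "x \<otimes>\<^bsub>St (r \<gamma>)\<^esub> y \<in> C (r \<gamma>)" if "x \<in> C (r \<gamma>)" "y \<in> C (r \<gamma>)" "\<gamma> \<in> arr" for x y \<gamma>
    using that ring.ring_simprules(5)[OF ring_stalk] by simp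
  have fC: "f \<gamma> \<in> C (r \<gamma>)" if "\<gamma> \<in> arr" for \<gamma> using section_in[OF U(5) that refl] .
  have UA: "\<gamma> \<in> arr" if "\<gamma> \<in> topspace ?X" for \<gamma> using that tX U(4) by blast
  have "continuous_map ?X \<E> (\<lambda>\<gamma>. a (r \<gamma>) \<otimes>\<^bsub>St (r \<gamma>)\<^esub> f \<gamma> \<ominus>\<^bsub>St (r \<gamma>)\<^esub> f \<gamma> \<otimes>\<^bsub>St (r \<gamma>)\<^esub> act \<O> \<gamma> (a (d \<gamma>)))"
    by (intro continuous_map_stalk_diff continuous_map_stalk_mult ar U(6) aa)
      (use UA p aC fC mC in blast)+
  then have "continuous_map ?X \<E> (commutator a f)"
    by (rule continuous_map_eq) (use eq UA in simp)
  moreover have "commutator a f \<gamma> = \<zero>\<^bsub>St (r \<gamma>)\<^esub>" if "\<gamma> \<in> arr - U" for \<gamma>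
  proof -
    interpret ring "St (r \<gamma>)" using ring_stalk that by simp
    show ?thesis using eq[of \<gamma>] U(7)[of \<gamma>] that aC[of \<gamma>] by (simp add: minus_eq)
  qed
  moreover have "commutator a f \<in> carrier \<Gamma>"
    unfolding commutator_def using Gamma_mult_closed a(1) fG by simp
  ultimately show ?thesis
    unfolding bisection_section_on_def using U(1) Gamma_section by blast
qed

lemma sum_of_bisections_commutator:
  assumes a: "a \<in> carrier \<Gamma>" "\<And>\<gamma>. \<gamma> \<in> arr \<Longrightarrow> \<gamma> \<notin> units \<Longrightarrow> a \<gamma> = \<zero>\<^bsub>St (r \<gamma>)\<^esub>"
    and c: "continuous_map (unit_space \<G>) \<E> a" and f: "sum_of_bisections n f"
  shows "sum_of_bisections n (commutator a f)"
  using f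
proof (induction rule: sum_of_bisections.induct)
  case zero
  have "commutator a \<zero>\<^bsub>\<Gamma>\<^esub> = \<zero>\<^bsub>\<Gamma>\<^esub>"
    using commutator_eq_zero_iff[OF a(1) Gamma.zero_closed] convolution_zero_left[OF Gamma_section[OF a(1)]]
      convolution_zero_right[OF Gamma_section[OF a(1)] Gamma_fibre_finite[OF a(1)]]
    by (simp add: Gamma_simps(2,3))
  then show ?case using sum_of_bisections.zero by (simp add: Gamma_simps(3))
next
  case (add U g n h)
  have "commutator a (g \<otimes>\<^bsub>\<S>\<^esub> h) = commutator a g \<otimes>\<^bsub>\<S>\<^esub> commutator a h"
    using commutator_add[OF a(1) bisection_section_in_Gamma[OF add(1)], of h] Gamma_iff add(2)
    unfolding Gamma_simps(4) by blast
  moreover have "bisection_section_on U (commutator a g)"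
    using a(2) by (rule bisection_section_commutator[OF a(1) _ c add(1)])
  ultimately show ?case using sum_of_bisections.add add.IH by metis
qed

lemma Gamma_c_unitsD:
  assumes "a \<in> Gamma_c_units \<G> \<O>"
  shows "continuous_map (unit_space \<G>) \<E> a"
    and "\<And>\<gamma>. \<gamma> \<in> arr \<Longrightarrow> \<gamma> \<notin> units \<Longrightarrow> a \<gamma> = \<zero>\<^bsub>St (r \<gamma>)\<^esub>"
proof -
  obtain s where s: "continuous_map (unit_space \<G>) \<E> s" "a = extend_by_zero \<G> \<O> s"
    using assms unfolding Gamma_c_units_def unit_sections_def by blast
  show "continuous_map (unit_space \<G>) \<E> a"
    using s(1) by (rule continuous_map_eq) (simp add: s(2) extend_by_zero_def)
  show "a \<gamma> = \<zero>\<^bsub>St (r \<gamma>)\<^esub>" if "\<gamma> \<in> arr" "\<gamma> \<notin> units" for \<gamma>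
    using that by (simp add: s(2) extend_by_zero_def)
qed

end

context ample_sheaf_of_fields
begin

text \<open>
  An element killing all sections and written with the least number of bisection sections is
  translated so that one of its terms lives on the unit space. Its commutator with \<open>a\<close> loses
  that term, hence vanishes by minimality.
\<close>

lemma annihilating_element_zero:
  assumes max: "maximal_commutative_subring (Gamma_c_units \<G> \<O>) \<Gamma>"
    and f0: "f0 \<in> carrier \<Gamma>" "\<And>v z. unit_section v \<Longrightarrow> z \<in> units \<Longrightarrow> module_act f0 v z = \<zero>\<^bsub>St z\<^esub>"
  shows "f0 = \<zero>\<^bsub>\<Gamma>\<^esub>"
proof (rule ccontr)
  assume nz: "f0 \<noteq> \<zero>\<^bsub>\<Gamma>\<^esub>"
  let ?A = "Gamma_c_units \<G> \<O>"
  define kills where "kills f \<longleftrightarrow> (\<forall>v z. unit_section v \<longrightarrow> z \<in> units \<longrightarrow> module_act f v z = \<zero>\<^bsub>St z\<^esub>)" for f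
  let ?P = "\<lambda>n. \<exists>f. sum_of_bisections n f \<and> kills f \<and> f \<noteq> \<zero>\<^bsub>\<Gamma>\<^esub>"
  have "subgroup ?A (add_monoid \<Gamma>)"
    using max unfolding maximal_commutative_subring_def commutative_subring_def nonunital_subring_def by blast
  from subgroup.subset[OF this] have AG: "a \<in> carrier \<Gamma>" if "a \<in> ?A" for a using that by auto
  have ex: "\<exists>n. ?P n" using f0 nz Gamma_iff unfolding kills_def by blast
  define n where "n = (LEAST n. ?P n)"
  have n: "?P n" "\<And>m. m < n \<Longrightarrow> \<not> ?P m"
    unfolding n_def using LeastI_ex[OF ex] not_less_Least by blast+
  then obtain f where f: "sum_of_bisections n f" "kills f" "f \<noteq> \<zero>\<^bsub>\<Gamma>\<^esub>" by blast
  have fG: "f \<in> carrier \<Gamma>" using f(1) Gamma_iff by blast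
  have "\<exists>\<gamma>\<in>arr. f \<gamma> \<noteq> \<zero>\<^bsub>St (r \<gamma>)\<^esub>"
  proof (rule ccontr)
    assume "\<not> ?thesis"
    then have "f = \<one>\<^bsub>\<S>\<^esub>"
      by (intro section_eqI Gamma_section[OF fG]) (auto simp: section_zero)
    with f(3) show False by (simp add: Gamma_simps(3))
  qed
  then obtain \<gamma> where \<gamma>: "\<gamma> \<in> arr" "f \<gamma> \<noteq> \<zero>\<^bsub>St (r \<gamma>)\<^esub>" by blast
  obtain m U g h where dec: "n = Suc m" "bisection_section_on U g" "\<gamma> \<in> U" "sum_of_bisections m h"
    "f = g \<otimes>\<^bsub>\<S>\<^esub> h"
    using sum_of_bisections_split[OF f(1) \<gamma>] by blast
  note U = bisection_section_onD[OF dec(2)]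
  let ?W = "gi ` U"
  define u where "u = (\<lambda>\<gamma>\<in>arr. if \<gamma> \<in> ?W then \<one>\<^bsub>St (r \<gamma>)\<^esub> else \<zero>\<^bsub>St (r \<gamma>)\<^esub>)"
  have u: "bisection_section_on ?W u"
    unfolding u_def by (rule bisection_section_one[OF compact_open_bisection_inverse[OF U(1)]])
  note W = bisection_section_onD[OF u] and uf = bisection_section_fibre_finite[OF u]
  have uG: "u \<in> carrier \<Gamma>" and gG: "g \<in> carrier \<Gamma>" and hG: "h \<in> carrier \<Gamma>"
    using bisection_section_in_Gamma u dec(2,4) Gamma_iff by blast+
  define f' where "f' = u \<otimes>\<^bsub>\<Gamma>\<^esub> f"
  define g' where "g' = u \<otimes>\<^bsub>\<Gamma>\<^esub> g"
  define h' where "h' = u \<otimes>\<^bsub>\<Gamma>\<^esub> h"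
  have G': "f' \<in> carrier \<Gamma>" "g' \<in> carrier \<Gamma>" "h' \<in> carrier \<Gamma>"
    unfolding f'_def g'_def h'_def using Gamma_mult_closed uG fG gG hG by auto
  have f'_eq: "f' = g' \<oplus>\<^bsub>\<Gamma>\<^esub> h'"
    unfolding f'_def g'_def h'_def dec(5) using Gamma_r_distr[OF uG gG hG] by (simp add: Gamma_simps(4))
  have h'_sum: "sum_of_bisections m h'"
    unfolding h'_def using sum_of_bisections_mult_left[OF u dec(4)] .
  have f'_kills: "kills f'"
    unfolding kills_def f'_def
  proof (intro allI impI)
    fix v z assume v: "unit_section v" and z: "z \<in> units"
    show "module_act (u \<otimes>\<^bsub>\<Gamma>\<^esub> f) v z = \<zero>\<^bsub>St z\<^esub>"
      unfolding act_mult[OF uG fG v z]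
      by (rule module_act_zero[OF Gamma_section[OF uG] z]) (use f(2) v in \<open>simp add: kills_def\<close>)
  qed
  have f'_nz: "f' (d \<gamma>) \<noteq> \<zero>\<^bsub>St (d \<gamma>)\<^esub>"
  proof -
    have x: "d \<gamma> \<in> arr" "r (d \<gamma>) = d \<gamma>" "d \<gamma> \<in> units" using \<gamma>(1) by auto
    interpret ring "St (d \<gamma>)" using ring_stalk x by simp
    have i: "gi \<gamma> \<in> arr" "r (gi \<gamma>) = d \<gamma>" "d (gi \<gamma>) = r \<gamma>"
      using \<gamma>(1) inv_closed ran_inv dom_inv by auto
    note k = adapted_translate[OF Gamma_section[OF fG] x(1,2)]
    have "f' (d \<gamma>) = pair (d \<gamma>) u (\<lambda>\<sigma>. f (gi \<sigma> \<cdot> d \<gamma>))"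
      unfolding f'_def Gamma_simps(2)
      using convolution_eq_pair[OF W(5) uf Gamma_section[OF fG] x(1)] x(2) by simp
    also have "\<dots> = u (gi \<gamma>) \<otimes>\<^bsub>St (d \<gamma>)\<^esub> act \<O> (gi \<gamma>) (f (gi (gi \<gamma>) \<cdot> d \<gamma>))"
    proof (rule pair_single[OF W(5) uf k x(3) i(1,2)])
      fix \<sigma> assume s: "\<sigma> \<in> arr" "r \<sigma> = d \<gamma>" "\<sigma> \<noteq> gi \<gamma>"
      have "\<sigma> \<notin> ?W"
      proof
        assume "\<sigma> \<in> ?W"
        moreover have "gi \<gamma> \<in> ?W" using dec(3) by blast
        ultimately have "\<sigma> = gi \<gamma>"
          using W(3) s(2) i(2) unfolding bisection_def by (metis inj_onD)
        with s(3) show False by contradiction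
      qed
      then have "u \<sigma> = \<zero>\<^bsub>St (d \<gamma>)\<^esub>" using W(7)[OF s(1)] s(2) by simp
      then show "u \<sigma> \<otimes>\<^bsub>St (d \<gamma>)\<^esub> act \<O> \<sigma> (f (gi \<sigma> \<cdot> d \<gamma>)) = \<zero>\<^bsub>St (d \<gamma>)\<^esub>"
        using act_closed[OF s(1) adaptedD[OF k s(1,2)]] s(2) by simp
    qed
    also have "\<dots> = act \<O> (gi \<gamma>) (f \<gamma>)"
      using \<gamma>(1) i dec(3) act_closed[OF i(1), of "f \<gamma>"] section_in[OF Gamma_section[OF fG] \<gamma>(1) refl]
      by (simp add: u_def)
    finally show ?thesis
      using act_eq_zero_iff[OF i(1), of "f \<gamma>"] section_in[OF Gamma_section[OF fG] \<gamma>(1) refl] i \<gamma>(2) by simp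
  qed
  have g'_units: "g' \<sigma> = \<zero>\<^bsub>St (r \<sigma>)\<^esub>" if s: "\<sigma> \<in> arr" "\<sigma> \<notin> units" for \<sigma>
    unfolding g'_def Gamma_simps(2) convolution_eq_pair[OF W(5) uf U(5) s(1)]
  proof (rule pair_eq_zero)
    show "r \<sigma> \<in> units" using s by simp
    interpret ring "St (r \<sigma>)" using ring_stalk s by simp
    fix \<tau> assume t: "\<tau> \<in> arr" "r \<tau> = r \<sigma>"
    note i = inv_mul_in_arrows[OF t(1) s(1) t(2)]
    have gC: "g (gi \<tau> \<cdot> \<sigma>) \<in> C (d \<tau>)" using section_in[OF U(5) i(1,2)] .
    show "u \<tau> \<otimes>\<^bsub>St (r \<sigma>)\<^esub> act \<O> \<tau> (g (gi \<tau> \<cdot> \<sigma>)) = \<zero>\<^bsub>St (r \<sigma>)\<^esub>"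
    proof (cases "\<tau> \<in> ?W")
      case True
      then have tU: "gi \<tau> \<in> U" using U(4) by auto
      have "gi \<tau> \<cdot> \<sigma> \<notin> U"
      proof
        assume "gi \<tau> \<cdot> \<sigma> \<in> U"
        then have "gi \<tau> \<cdot> \<sigma> = gi \<tau>"
          using U(3) tU i(2) ran_inv[OF t(1)] unfolding bisection_def by (metis inj_onD)
        then have "r \<tau> = \<sigma>" using mul_inv_cancel[OF t(1) s(1) t(2)] by (simp only: mul_inv)
        then show False using ran_in_units[OF t(1)] s(2) by (simp only:)
      qed
      then have "g (gi \<tau> \<cdot> \<sigma>) = \<zero>\<^bsub>St (d \<tau>)\<^esub>" using U(7)[OF i(1)] i(2) by simp
      then show ?thesis using act_zero[OF t(1)] section_in[OF W(5) t] t(2) by simp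
    next
      case False
      then show ?thesis using W(7)[OF t(1)] t(2) act_closed[OF t(1) gC] by simp
    qed
  qed
  have "a \<otimes>\<^bsub>\<Gamma>\<^esub> f' = f' \<otimes>\<^bsub>\<Gamma>\<^esub> a" if a: "a \<in> ?A" for a
  proof -
    note aG = AG[OF a] and aS = Gamma_section[OF AG[OF a]] and au = Gamma_c_unitsD[OF a]
    note g'S = Gamma_section[OF G'(2)] Gamma_fibre_finite[OF G'(2)]
    have "a \<otimes>\<^bsub>\<Gamma>\<^esub> g' = g' \<otimes>\<^bsub>\<Gamma>\<^esub> a"
    proof (rule section_eqI)
      fix \<sigma> assume s: "\<sigma> \<in> arr"
      interpret field "St (r \<sigma>)" using field_stalk s by simp
      have "a (r \<sigma>) \<otimes>\<^bsub>St (r \<sigma>)\<^esub> g' \<sigma> = g' \<sigma> \<otimes>\<^bsub>St (r \<sigma>)\<^esub> act \<O> \<sigma> (a (d \<sigma>))"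
      proof (cases "\<sigma> \<in> units")
        case True
        then have "r \<sigma> = \<sigma>" "d \<sigma> = \<sigma>" by auto
        then show ?thesis
          using act_id[OF True] section_in[OF aS s refl] section_in[OF g'S(1) s refl] m_comm by simp
      next
        case False
        have "a (r \<sigma>) \<in> C (r \<sigma>)" "act \<O> \<sigma> (a (d \<sigma>)) \<in> C (r \<sigma>)"
          using s section_in[OF aS] act_closed[OF s] by auto
        then show ?thesis using g'_units[OF s False] by simp
      qed
      then show "(a \<otimes>\<^bsub>\<Gamma>\<^esub> g') \<sigma> = (g' \<otimes>\<^bsub>\<Gamma>\<^esub> a) \<sigma>"
        using convolution_unit_left[OF aS au(2) g'S(1) s] convolution_unit_right[OF aS au(2) g'S s]
        by (simp add: Gamma_simps(2))
    qed (intro Gamma_section Gamma_mult_closed aG G'(2))+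
    then have "commutator a g' = \<zero>\<^bsub>\<Gamma>\<^esub>" using commutator_eq_zero_iff[OF aG G'(2)] by simp
    moreover have hc: "sum_of_bisections m (commutator a h')"
      using au(2) by (rule sum_of_bisections_commutator[OF aG _ au(1) h'_sum])
    moreover from this have "commutator a h' \<in> carrier \<Gamma>" using Gamma_iff by blast
    ultimately have eq: "commutator a f' = commutator a h'"
      unfolding f'_eq commutator_add[OF aG G'(2,3)] by simp
    have "kills (commutator a f')"
      unfolding kills_def commutator_def
    proof (intro allI impI)
      fix v z assume v: "unit_section v" and z: "z \<in> units"
      interpret ring "St z" using ring_stalk z .
      have "module_act (a \<otimes>\<^bsub>\<Gamma>\<^esub> f') v z = \<zero>\<^bsub>St z\<^esub>"
        unfolding act_mult[OF aG G'(1) v z]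
        by (rule module_act_zero[OF aS z]) (use f'_kills v in \<open>simp add: kills_def\<close>)
      moreover have "module_act (f' \<otimes>\<^bsub>\<Gamma>\<^esub> a) v z = \<zero>\<^bsub>St z\<^esub>"
        unfolding act_mult[OF G'(1) aG v z]
        using f'_kills module_act_unit_section[OF aS v] z by (simp add: kills_def)
      ultimately show "module_act (a \<otimes>\<^bsub>\<Gamma>\<^esub> f' \<ominus>\<^bsub>\<Gamma>\<^esub> f' \<otimes>\<^bsub>\<Gamma>\<^esub> a) v z = \<zero>\<^bsub>St z\<^esub>"
        using act_diff[OF Gamma_mult_closed[OF aG G'(1)] Gamma_mult_closed[OF G'(1) aG] v z]
        by (simp add: minus_eq)
    qed
    then have "commutator a f' = \<zero>\<^bsub>\<Gamma>\<^esub>" using n(2)[of m] hc eq dec(1) by auto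
    then show ?thesis using commutator_eq_zero_iff[OF aG G'(1)] by simp
  qed
  then have "f' \<in> ?A"
    using maximal_commutative_subring_centralizer[OF abelian_group_Gamma Gamma_mult_closed Gamma_assoc
        Gamma_l_distr Gamma_r_distr max G'(1)] by blast
  note f'_units = Gamma_c_unitsD(2)[OF this]
  have x: "d \<gamma> \<in> arr" "r (d \<gamma>) = d \<gamma>" "d \<gamma> \<in> units" "d (d \<gamma>) = d \<gamma>" using \<gamma>(1) by auto
  have one: "unit_section (\<lambda>x. \<one>\<^bsub>St x\<^esub>)" by (simp add: unit_section_def one_in_stalk)
  interpret ring "St (d \<gamma>)" using ring_stalk x by simp
  note f'S = Gamma_section[OF G'(1)]
  have "module_act f' (\<lambda>x. \<one>\<^bsub>St x\<^esub>) (d \<gamma>) = f' (d \<gamma>) \<otimes>\<^bsub>St (d \<gamma>)\<^esub> act \<O> (d \<gamma>) \<one>\<^bsub>St (d (d \<gamma>))\<^esub>"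
    unfolding module_act_def
  proof (rule pair_single[OF f'S Gamma_fibre_finite[OF G'(1)] adapted_dom[OF one] x(3,1,2)])
    fix \<sigma> assume s: "\<sigma> \<in> arr" "r \<sigma> = d \<gamma>" "\<sigma> \<noteq> d \<gamma>"
    then have "\<sigma> \<notin> units" by auto
    then have "f' \<sigma> = \<zero>\<^bsub>St (d \<gamma>)\<^esub>" using f'_units[OF s(1)] s(2) by simp
    then show "f' \<sigma> \<otimes>\<^bsub>St (d \<gamma>)\<^esub> act \<O> \<sigma> \<one>\<^bsub>St (d \<sigma>)\<^esub> = \<zero>\<^bsub>St (d \<gamma>)\<^esub>"
      using act_closed[OF s(1), of "\<one>\<^bsub>St (d \<sigma>)\<^esub>"] one_in_stalk[of "d \<sigma>"] s by simp
  qed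
  also have "\<dots> = f' (d \<gamma>)"
    using act_id[OF x(3), of "\<one>\<^bsub>St (d \<gamma>)\<^esub>"] x section_in[OF f'S x(1,2)] by simp
  finally show False using f'_nz f'_kills one x(3) by (simp add: kills_def)
qed

end

theorem theorem4p26:
  fixes \<G> :: "'g groupoid" and \<O> :: "('g, 'e) ring_sheaf"
  assumes "ample_groupoid \<G>"
    and "groupoid_sheaf_of_fields \<G> \<O>"
    and "maximal_commutative_subring (Gamma_c_units \<G> \<O>) (Gamma_c \<G> \<O>)"
  shows "semiprimitive (Gamma_c \<G> \<O>)"
proof -
  interpret A: ample_groupoid \<G> by fact
  interpret F: groupoid_sheaf_of_fields \<G> \<O> by fact
  interpret ample_sheaf_of_fields \<G> \<O> by unfold_locales
  show ?thesis
    unfolding semiprimitive_def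
  proof (intro equalityI subsetI)
    fix f assume f: "f \<in> jacobson_radical (Gamma_c \<G> \<O>)"
    then have "f = \<zero>\<^bsub>Gamma_c \<G> \<O>\<^esub>"
      using annihilating_element_zero[OF assms(3)] jacobson_radical_annihilates[OF f]
      by (simp add: jacobson_radical_def)
    then show "f \<in> {\<zero>\<^bsub>Gamma_c \<G> \<O>\<^esub>}" by simp
  next
    fix f assume "f \<in> {\<zero>\<^bsub>Gamma_c \<G> \<O>\<^esub>}"
    then show "f \<in> jacobson_radical (Gamma_c \<G> \<O>)"
      using Gamma.zero_closed subgroup.one_closed[of _ "add_monoid (Gamma_c \<G> \<O>)"]
      by (auto simp: jacobson_radical_def maximal_left_ideal_def left_ideal_def)
  qed
qed

end
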